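(* Let $K\subset\mathbb{R}^2$ be a compact strictly convex set of constant width and area $F$ bounded by a curve $\Gamma=\partial K$ of class $\mathcal{C}^2$ and length $L$. Let $F_e$ be the area with multiplicities of the evolute of $\Gamma$, let $\Delta=L^2-4\pi F$ be the isoperimetric deficit of $\Gamma$, and for $P\notin K$ let $\omega=\omega(P)$ be the visual angle of $\Gamma$ from $P$. Then $$\frac49\pi|F_e|-\Delta\ \ge\ \frac{64}{9}\int_{P\notin K}\Big(\omega-2\sin\omega+\sin2\omega-\frac14\sin4\omega-\sin^3\omega\Big)\,dP.$$ The right hand side of this inequality is a strictly positive quantity except when $\frac49\pi|F_e|-\Delta=0$, in which case it also vanishes. Equality holds if and only if $K$ is a disk, or it is bounded by a curve parallel to a Steiner curve, or it is bounded by a curve parallel to a hypocycloid of five cusps, or it is the Minkowski sum of compact sets of the previous types.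
   Context: Let $p(\varphi)=\sup\{\langle x,(\cos\varphi,\sin\varphi)\rangle : x\in K\}$ be the ($2\pi$-periodic) support function of $K$. "Strictly convex set bounded by a curve of class $\mathcal{C}^2$" means that $p$ is of class $\mathcal{C}^2$ and $p(\varphi)+p''(\varphi)>0$ for every $\varphi$. Constant width means that $p(\varphi)+p(\varphi+\pi)$ is constant. With $N(\varphi)=(\cos\varphi,\sin\varphi)$ the boundary is $\gamma(\varphi)=p(\varphi)N(\varphi)+p'(\varphi)N'(\varphi)$, with $L=\int_0^{2\pi}p\,d\varphi$ and $F=\frac12\int_0^{2\pi}(p^2-p'^2)\,d\varphi$. The evolute of $\Gamma$ is the envelope of its normal lines, $\tilde\gamma=\gamma-(p+p'')N$; it is the envelope of the lines $x\cos t+y\sin t=f(t)$ with $f(t)=p'(t-\pi/2)$. The area with multiplicities of the curve enveloped by a family $x\cos t+y\sin t=f(t)$, with $f$ $2\pi$-periodic, is $\frac12\int_0^{2\pi}(f^2-f'^2)\,dt$. Thus $F_e=\frac12\int_0^{2\pi}(p'^2-p''^2)\,d\varphi\le 0$. For $P\notin K$, the visual angle $\omega(P)\in(0,\pi)$ is the angle between the two tangent lines from $P$ to $\Gamma$ (the angle under which $K$ is seen from $P$), and $dP$ is the area (Lebesgue) measure on the plane. A $\mathcal{C}^2$ function $f$ is the generalized support function of the (possibly non-convex) curve enveloped by the lines $x\cos t+y\sin t=f(t)$. The parallel curve at (signed) distance $c$ has generalized support function $f+c$. A Steiner curve (deltoid) is the hypocycloid of three cusps. The hypocycloid of five cusps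 meant here is the one obtained by rolling a circle of radius $r$ inside a circle of radius $\frac52 r$; up to rigid motion it has generalized support function $\frac r2\sin(5\theta)$. In terms of generalized support functions: a curve parallel to a Steiner curve (at distance $c\in\mathbb{R}$) is one with generalized support function $c+a\cos\varphi+b\sin\varphi+A\sin(3(\varphi-\varphi_0))$, and a curve parallel to a hypocycloid of five cusps (at distance $c\in\mathbb{R}$) is one with generalized support function $c+a\cos\varphi+b\sin\varphi+A\sin(5(\varphi-\varphi_0))$, where $A>0$ and $a,b,\varphi_0\in\mathbb{R}$. The Minkowski sum of sets $X,Y\subset\mathbb{R}^2$ is $X+Y=\{x+y : x\in X,\ y\in Y\}$.
   Formalization: In the equality case, Minkowski sums of sets are taken of strictly convex bodies, and sums of possibly non-convex curves (adding generalized support functions) are also allowed; with sums of sets alone, p=19/10+sin(3t)/8+sin(5t)/24 refutes "only if". *)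

theory Defs
  imports "HOL-Analysis.Analysis"
begin

definition nvec :: "real \<Rightarrow> real^2" where
  "nvec t = vector [cos t, sin t]"

definition tvec :: "real \<Rightarrow> real^2" where
  "tvec t = vector [- sin t, cos t]"

definition supp_fun :: "(real^2) set \<Rightarrow> real \<Rightarrow> real" where
  "supp_fun K t = (SUP x\<in>K. x \<bullet> nvec t)"

definition C2_fun :: "(real \<Rightarrow> real) \<Rightarrow> bool" where
  "C2_fun f \<longleftrightarrow> f C1_differentiable_on UNIV \<and> deriv f C1_differentiable_on UNIV"

(* Strict convexity and the regularity of the boundary are expressed through the
   support function p: it is of class C^2 and the radius of curvature p + p'' is positive. *)
definition C2_strictly_convex :: "(real^2) set \<Rightarrow> bool" where
  "C2_strictly_convex K \<longleftrightarrow>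
     K \<noteq> {} \<and> compact K \<and> convex K \<and> C2_fun (supp_fun K) \<and>
     (\<forall>t. supp_fun K t + deriv (deriv (supp_fun K)) t > 0)"

definition constant_width :: "(real^2) set \<Rightarrow> bool" where
  "constant_width K \<longleftrightarrow> (\<exists>w. \<forall>t. supp_fun K t + supp_fun K (t + pi) = w)"

(* The curve with generalized support function f, i.e. the envelope of the lines
   x cos t + y sin t = f(t); it need not be convex and may have cusps. *)
definition env_point :: "(real \<Rightarrow> real) \<Rightarrow> real \<Rightarrow> real^2" where
  "env_point f t = f t *\<^sub>R nvec t + deriv f t *\<^sub>R tvec t"

definition env_curve :: "(real \<Rightarrow> real) \<Rightarrow> (real^2) set" where
  "env_curve f = range (env_point f)"

(* Area with multiplicities of env_curve f, for f of period 2 pi. *)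
definition env_area :: "(real \<Rightarrow> real) \<Rightarrow> real" where
  "env_area f = 1/2 * integral {0..2*pi} (\<lambda>t. (f t)\<^sup>2 - (deriv f t)\<^sup>2)"

(* Length of the boundary of K, parametrized by the outer normal angle. *)
definition perimeter :: "(real^2) set \<Rightarrow> real" where
  "perimeter K =
     integral {0..2*pi} (\<lambda>t. norm (vector_derivative (env_point (supp_fun K)) (at t)))"

definition area :: "(real^2) set \<Rightarrow> real" where
  "area K = measure lborel K"

definition isoperimetric_deficit :: "(real^2) set \<Rightarrow> real" where
  "isoperimetric_deficit K = (perimeter K)\<^sup>2 - 4 * pi * area K"

(* The normal line at normal angle s is x cos t + y sin t = p'(s) with t = s + pi/2,
   so the evolute is the envelope with generalized support function p'(t - pi/2). *)
definition evolute_area :: "(real^2) set \<Rightarrow> real" where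
  "evolute_area K = env_area (\<lambda>t. deriv (supp_fun K) (t - pi/2))"

(* The points where the tangent (i.e. supporting) lines from P touch K. *)
definition tangent_points :: "(real^2) set \<Rightarrow> real^2 \<Rightarrow> (real^2) set" where
  "tangent_points K P =
     {x \<in> frontier K. \<exists>u. u \<noteq> 0 \<and> u \<bullet> x = u \<bullet> P \<and> (\<forall>y\<in>K. u \<bullet> y \<le> u \<bullet> P)}"

definition angle_at :: "real^2 \<Rightarrow> real^2 \<Rightarrow> real^2 \<Rightarrow> real" where
  "angle_at P x y = arccos (((x - P) \<bullet> (y - P)) / (norm (x - P) * norm (y - P)))"

(* Well defined when P lies outside a compact strictly convex body: there are then
   exactly two tangent lines, each touching K in one point, and the angle between the
   rays through these points is the one that contains K. *)
definition visual_angle :: "(real^2) set \<Rightarrow> real^2 \<Rightarrow> real" where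
  "visual_angle K P =
     (THE \<omega>. \<exists>x y. x \<noteq> y \<and> tangent_points K P = {x, y} \<and> \<omega> = angle_at P x y)"

definition is_disk :: "(real^2) set \<Rightarrow> bool" where
  "is_disk K \<longleftrightarrow> (\<exists>z r. r > 0 \<and> K = cball z r)"

(* Generalized support functions of circles, of the curves parallel to a Steiner curve
   and of the curves parallel to a hypocycloid of five cusps. In the last two the
   distance c may have any sign and the curve may have cusps. *)
definition circle_support :: "(real \<Rightarrow> real) \<Rightarrow> bool" where
  "circle_support f \<longleftrightarrow> (\<exists>r a b. r > 0 \<and> f = (\<lambda>t. r + a * cos t + b * sin t))"

definition parallel_to_steiner :: "(real \<Rightarrow> real) \<Rightarrow> bool" where
  "parallel_to_steiner f \<longleftrightarrow>
     (\<exists>c a b A t0. A > 0 \<and> f = (\<lambda>t. c + a * cos t + b * sin t + A * sin (3 * (t - t0))))"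

definition parallel_to_five_cusped :: "(real \<Rightarrow> real) \<Rightarrow> bool" where
  "parallel_to_five_cusped f \<longleftrightarrow>
     (\<exists>c a b A t0. A > 0 \<and> f = (\<lambda>t. c + a * cos t + b * sin t + A * sin (5 * (t - t0))))"

definition bounded_by_parallel_to_steiner :: "(real^2) set \<Rightarrow> bool" where
  "bounded_by_parallel_to_steiner K \<longleftrightarrow>
     (\<exists>f. parallel_to_steiner f \<and> frontier K = env_curve f)"

definition bounded_by_parallel_to_five_cusped :: "(real^2) set \<Rightarrow> bool" where
  "bounded_by_parallel_to_five_cusped K \<longleftrightarrow>
     (\<exists>f. parallel_to_five_cusped f \<and> frontier K = env_curve f)"

definition minkowski_sum :: "(real^2) set \<Rightarrow> (real^2) set \<Rightarrow> (real^2) set" where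
  "minkowski_sum X Y = {x + y | x y. x \<in> X \<and> y \<in> Y}"

inductive minkowski_sum_of_bodies :: "(real^2) set \<Rightarrow> bool" where
  disk: "is_disk X \<Longrightarrow> minkowski_sum_of_bodies X"
| steiner: "C2_strictly_convex X \<Longrightarrow> bounded_by_parallel_to_steiner X \<Longrightarrow> minkowski_sum_of_bodies X"
| five_cusped:
    "C2_strictly_convex X \<Longrightarrow> bounded_by_parallel_to_five_cusped X \<Longrightarrow> minkowski_sum_of_bodies X"
| sum: "minkowski_sum_of_bodies X \<Longrightarrow> minkowski_sum_of_bodies Y \<Longrightarrow>
    minkowski_sum_of_bodies (minkowski_sum X Y)"

(* Minkowski sum of the regions bounded by possibly non-convex curves: the generalized
   support functions are added, i.e. points with the same normal angle are added. For
   convex regions this is the Minkowski sum of sets. Non-convex summands cannot be avoided: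
   p(t) = 19/10 + sin(3t)/8 + sin(5t)/24 has p + p'' = 19/10 - sin(3t) - sin(5t) > 0, but
   if the body were a sum of convex bodies of the three basic types, the constant term
   of p would be at least 8/8 + 24/24 = 2. *)
definition minkowski_sum_of_curves :: "(real^2) set \<Rightarrow> bool" where
  "minkowski_sum_of_curves K \<longleftrightarrow>
     (\<exists>fs. fs \<noteq> [] \<and>
        (\<forall>f\<in>set fs. circle_support f \<or> parallel_to_steiner f \<or> parallel_to_five_cusped f) \<and>
        frontier K = env_curve (\<lambda>t. \<Sum>f\<leftarrow>fs. f t))"

end

theory Submission
  imports Defs "HOL-Real_Asymp.Real_Asymp"
begin

text \<open>The angle expression owes its coefficients to its second derivative: at
  \<open>pi - \<phi>\<close> this is \<open>sin \<phi>\<close> times the kernel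
  \<open>1/2 - 9/2 cos 2\<phi> - 8 cos 3\<phi>\<close>, and after the integrations by parts only the
  kernel meets C. It is orthogonal to cos on \<open>[0, pi]\<close>, which removes the term with
  C(0). Its frequencies 0 and 2 are symmetric about \<open>pi/2\<close>, where constant width makes
  C antisymmetric up to a constant, so they see only the length; frequency 3 extracts the third
  amplitude, and \<open>pi F\<close> is the boundary term at \<open>\<phi> = 0\<close>. The obstacle
  is convergence: for points near infinity the Jacobian grows like \<open>(pi - \<phi>)^-3\<close>,
  which the triple zero of the angle expression at 0 just compensates. The factors 4/9 and 64/9
  place the zeros: up to a common factor the left side has the weights
  \<open>(n^2 - 1) (n^2 - 9)\<close>, blind to \<open>n = 3\<close>, and the right side
  \<open>16 (n^2 - 1)\<close> except for weight 0 at \<open>n = 3\<close>, so the difference is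
  blind to \<open>n = 5\<close> as well. In the equality case the given curve is known only as a
  point set, possibly traced with the opposite normal, so the support function has to be recovered
  from the frontier.\<close>

text \<open>
  Let \<open>p\<close> be the support function of \<open>K\<close>, with Fourier amplitudes \<open>c\<^sub>n\<close>. The exterior of \<open>K\<close> is
  parametrized by the pairs of normal angles \<open>x\<close> and \<open>x + \<phi>\<close> of the two tangent lines through a point;
  the visual angle is then \<open>pi - \<phi>\<close>. For fixed \<open>\<phi>\<close> the integral of the Jacobian over \<open>x\<close> is the second
  derivative of \<open>(C(\<phi>) - C(0) cos \<phi>) / sin \<phi>\<close>, where \<open>C(\<phi>) = \<integral> p(x) p(x + \<phi>) dx\<close>. Two integrations by parts
  give \<open>L^2/4 - pi F - 4 pi^2 c\<^sub>3^2\<close> for the integral of the visual angle expression. By Parseval's identity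
  both sides of the inequality are then series in the \<open>c\<^sub>n^2\<close>, in which only odd \<open>n\<close> occur because of the
  constant width, and their difference is \<open>2 pi^2/9\<close> times the sum of \<open>(n^2 - 1) (n^2 - 25) c\<^sub>n^2\<close> over
  odd \<open>n \<ge> 7\<close>. Hence equality means that \<open>p\<close> has no harmonics other than those of order 0, 1, 3 and 5.
\<close>

section \<open>Fourier series and Parseval's identity\<close>

abbreviation circ :: "(real \<Rightarrow> real) \<Rightarrow> real" where
  "circ f \<equiv> integral {0..2*pi} f"

lemmas hk_add = Henstock_Kurzweil_Integration.integral_add
  and hk_diff = Henstock_Kurzweil_Integration.integral_diff
  and hk_cong = Henstock_Kurzweil_Integration.integral_cong
  and hk_nonneg = Henstock_Kurzweil_Integration.integral_nonneg
  and hk_combine = Henstock_Kurzweil_Integration.integral_combine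

lemma integrable_cont: "continuous_on UNIV f \<Longrightarrow> (f :: real \<Rightarrow> real) integrable_on {a..b}"
  by (meson continuous_on_subset integrable_continuous_interval subset_UNIV)

lemma ftc:
  fixes F :: "real \<Rightarrow> real"
  assumes "a \<le> b" "\<And>x. (F has_field_derivative f x) (at x)"
  shows "(f has_integral F b - F a) {a..b}"
  using assms
  by (intro fundamental_theorem_of_calculus)
     (auto simp: has_real_derivative_iff_has_vector_derivative intro: has_vector_derivative_at_within)

section \<open>Orthogonality of the harmonics over one period\<close>

lemma integral_cos_int:
  "circ (\<lambda>t. cos (of_int j * t)) = (if j = 0 then 2*pi else 0)"
proof (cases "j = 0")
  case False
  have "((\<lambda>t. cos (of_int j * t)) has_integral (sin (of_int j * (2*pi)) / of_int j - sin (of_int j * 0) / of_int j)) {0..2*pi}"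
    using False
    by (intro ftc) (auto intro!: derivative_eq_intros)
  moreover have "sin (of_int j * (2*pi)) = 0"
    by (metis mult.commute sin_int_2pin)
  ultimately show ?thesis using False by (simp add: integral_unique)
qed auto

lemma integral_sin_int:
  "circ (\<lambda>t. sin (of_int j * t)) = 0"
proof (cases "j = 0")
  case False
  have "((\<lambda>t. sin (of_int j * t)) has_integral (- cos (of_int j * (2*pi)) / of_int j - - cos (of_int j * 0) / of_int j)) {0..2*pi}"
    using False
    by (intro ftc) (auto intro!: derivative_eq_intros)
  moreover have "cos (of_int j * (2*pi)) = 1"
    by (metis mult.commute cos_int_2pin)
  ultimately show ?thesis using False by (simp add: integral_unique)
qed auto

lemma integral_cos_cos:
  "circ (\<lambda>t. cos (real m * t) * cos (real n * t)) =
     (if m = n then if m = 0 then 2*pi else pi else 0)"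
proof -
  have "circ (\<lambda>t. cos (real m * t) * cos (real n * t)) =
        circ (\<lambda>t. 1/2 * cos (of_int (int m - int n) * t) + 1/2 * cos (of_int (int m + int n) * t))"
    by (simp add: cos_times_cos ring_distribs add_divide_distrib diff_divide_distrib)
  also have "\<dots> =
     1/2 * circ (\<lambda>t. cos (of_int (int m - int n) * t)) +
     1/2 * circ (\<lambda>t. cos (of_int (int m + int n) * t))"
    by (subst hk_add)
       (auto intro!: integrable_cont continuous_intros)
  also have "\<dots> = (if m = n then if m = 0 then 2*pi else pi else 0)"
    unfolding integral_cos_int by auto
  finally show ?thesis .
qed

lemma integral_sin_sin:
  "circ (\<lambda>t. sin (real m * t) * sin (real n * t)) =
     (if m = n \<and> m \<noteq> 0 then pi else 0)"
proof -
  have "circ (\<lambda>t. sin (real m * t) * sin (real n * t)) =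
        circ (\<lambda>t. 1/2 * cos (of_int (int m - int n) * t) - 1/2 * cos (of_int (int m + int n) * t))"
    by (simp add: sin_times_sin ring_distribs add_divide_distrib diff_divide_distrib)
  also have "\<dots> =
     1/2 * circ (\<lambda>t. cos (of_int (int m - int n) * t)) -
     1/2 * circ (\<lambda>t. cos (of_int (int m + int n) * t))"
    by (subst hk_diff)
       (auto intro!: integrable_cont continuous_intros)
  also have "\<dots> = (if m = n \<and> m \<noteq> 0 then pi else 0)"
    unfolding integral_cos_int by auto
  finally show ?thesis .
qed

lemma integral_sin_cos:
  "circ (\<lambda>t. sin (real m * t) * cos (real n * t)) = 0"
proof -
  have "circ (\<lambda>t. sin (real m * t) * cos (real n * t)) =
        circ (\<lambda>t. 1/2 * sin (of_int (int m - int n) * t) + 1/2 * sin (of_int (int m + int n) * t))"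
    by (simp add: sin_times_cos ring_distribs add_divide_distrib diff_divide_distrib add.commute)
  also have "\<dots> =
     1/2 * circ (\<lambda>t. sin (of_int (int m - int n) * t)) +
     1/2 * circ (\<lambda>t. sin (of_int (int m + int n) * t))"
    by (subst hk_add)
       (auto intro!: integrable_cont continuous_intros)
  also have "\<dots> = 0"
    unfolding integral_sin_int by auto
  finally show ?thesis .
qed

lemma integral_cos_sin:
  "circ (\<lambda>t. cos (real m * t) * sin (real n * t)) = 0"
  using integral_sin_cos[of n m] by (simp add: mult.commute)

section \<open>Trigonometric polynomials and their density among continuous periodic
  functions\<close>

inductive trig_poly :: "nat \<Rightarrow> (real \<Rightarrow> real) \<Rightarrow> bool" for N where
  cos: "n \<le> N \<Longrightarrow> trig_poly N (\<lambda>t. cos (real n * t))"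
| sin: "n \<le> N \<Longrightarrow> trig_poly N (\<lambda>t. sin (real n * t))"
| scale: "trig_poly N f \<Longrightarrow> trig_poly N (\<lambda>t. c * f t)"
| add: "trig_poly N f \<Longrightarrow> trig_poly N g \<Longrightarrow> trig_poly N (\<lambda>t. f t + g t)"

lemma trig_poly_mono: "trig_poly M f \<Longrightarrow> M \<le> N \<Longrightarrow> trig_poly N f"
  by (induction rule: trig_poly.induct) (auto intro: trig_poly.intros)

lemma trig_poly_const: "trig_poly N (\<lambda>t. c)"
  using trig_poly.scale[OF trig_poly.cos[of 0 N], of c] by simp

lemma trig_poly_minus: "trig_poly N f \<Longrightarrow> trig_poly N (\<lambda>t. - f t)"
  using trig_poly.scale[of N f "-1"] by simp

lemma trig_poly_diff: "trig_poly N f \<Longrightarrow> trig_poly N g \<Longrightarrow> trig_poly N (\<lambda>t. f t - g t)"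
  using trig_poly.add[OF _ trig_poly_minus] by fastforce

lemma trig_poly_sum: "(\<And>i. i \<in> I \<Longrightarrow> trig_poly N (f i)) \<Longrightarrow> trig_poly N (\<lambda>t. \<Sum>i\<in>I. f i t)"
  by (induction I rule: infinite_finite_induct)
     (auto intro: trig_poly_const[of _ 0] trig_poly.add)

lemma trig_poly_cos_int: "\<bar>j\<bar> \<le> int N \<Longrightarrow> trig_poly N (\<lambda>t. cos (of_int j * t))"
  using trig_poly.cos[of "nat \<bar>j\<bar>" N]
  by (cases "j \<ge> 0") (auto simp: nat_le_iff)

lemma trig_poly_sin_int: "\<bar>j\<bar> \<le> int N \<Longrightarrow> trig_poly N (\<lambda>t. sin (of_int j * t))"
  using trig_poly.sin[of "nat \<bar>j\<bar>" N] trig_poly_minus[OF trig_poly.sin[of "nat \<bar>j\<bar>" N]]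
  by (cases "j \<ge> 0") (auto simp: nat_le_iff)

lemma trig_poly_mult_aux:
  assumes "trig_poly N g" "m \<le> M"
  shows "trig_poly (M + N) (\<lambda>t. cos (real m * t) * g t) \<and> trig_poly (M + N) (\<lambda>t. sin (real m * t) * g t)"
  using assms(1)
proof induction
  case (cos n)
  have 1: "(\<lambda>t. cos (real m * t) * cos (real n * t)) =
        (\<lambda>t. 1/2 * cos (of_int (int m - int n) * t) + 1/2 * cos (of_int (int m + int n) * t))"
    by (auto simp: fun_eq_iff cos_times_cos ring_distribs)
  have 2: "(\<lambda>t. sin (real m * t) * cos (real n * t)) =
        (\<lambda>t. 1/2 * sin (of_int (int m - int n) * t) + 1/2 * sin (of_int (int m + int n) * t))"
    by (auto simp: fun_eq_iff sin_times_cos ring_distribs)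
  show ?case unfolding 1 2 using cos assms(2)
    by (intro conjI trig_poly.add trig_poly.scale trig_poly_cos_int trig_poly_sin_int) auto
next
  case (sin n)
  have 1: "(\<lambda>t. cos (real m * t) * sin (real n * t)) =
        (\<lambda>t. 1/2 * sin (of_int (int m + int n) * t) - 1/2 * sin (of_int (int m - int n) * t))"
    by (auto simp: fun_eq_iff cos_times_sin ring_distribs)
  have 2: "(\<lambda>t. sin (real m * t) * sin (real n * t)) =
        (\<lambda>t. 1/2 * cos (of_int (int m - int n) * t) - 1/2 * cos (of_int (int m + int n) * t))"
    by (auto simp: fun_eq_iff sin_times_sin ring_distribs)
  show ?case unfolding 1 2 using sin assms(2)
    by (intro conjI trig_poly_diff trig_poly.scale trig_poly_cos_int trig_poly_sin_int) auto
next
  case (scale f c)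
  then show ?case
    by (auto dest: trig_poly.scale[of _ _ c] simp: algebra_simps)
next
  case (add f g)
  then show ?case
    by (auto dest: trig_poly.add simp: algebra_simps)
qed

text \<open>Degrees add by the product-to-sum formulas. This closure turns any real polynomial in
  the coordinates of \<open>cis t\<close> into a trigonometric polynomial.\<close>

lemma trig_poly_mult:
  assumes "trig_poly M f" "trig_poly N g"
  shows "trig_poly (M + N) (\<lambda>t. f t * g t)"
  using assms(1)
proof induction
  case (scale f c)
  then show ?case by (auto dest: trig_poly.scale[of _ _ c] simp: algebra_simps)
next
  case (add f g)
  then show ?case by (auto dest: trig_poly.add simp: algebra_simps)
qed (use trig_poly_mult_aux[OF assms(2)] in auto)

lemma continuous_on_trig_poly: "trig_poly N f \<Longrightarrow> continuous_on A f"
  by (induction rule: trig_poly.induct) (auto intro!: continuous_intros)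

lemma real_polynomial_function_trig_poly:
  assumes "real_polynomial_function (q :: complex \<Rightarrow> real)"
  shows "\<exists>N. trig_poly N (\<lambda>t. q (cis t))"
  using assms
proof induction
  case (linear f)
  have "(\<lambda>t. f (cis t)) = (\<lambda>t. f 1 * cos (real 1 * t) + f \<i> * sin (real 1 * t))"
  proof
    fix t
    have "cis t = cos t *\<^sub>R 1 + sin t *\<^sub>R \<i>" by (simp add: complex_eq_iff)
    then show "f (cis t) = f 1 * cos (real 1 * t) + f \<i> * sin (real 1 * t)" using linear
      by (simp add: linear_simps)
  qed
  then show ?case
    by (simp only:) (intro exI[of _ 1] trig_poly.add trig_poly.scale trig_poly.cos trig_poly.sin, auto)
next
  case (const c)
  then show ?case using trig_poly_const by blast
next
  case (add f g)
  then obtain M N where "trig_poly M (\<lambda>t. f (cis t))" "trig_poly N (\<lambda>t. g (cis t))" by blast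
  then show ?case
    using trig_poly.add[of "max M N"] trig_poly_mono by (meson max.cobounded1 max.cobounded2)
next
  case (mult f g)
  then show ?case using trig_poly_mult by blast
qed

text \<open>A periodic function factors through the unit circle, a compact set on which
  Stone-Weierstrass supplies polynomial approximations.\<close>

lemma trig_poly_approx:
  assumes cont: "continuous_on UNIV f" and per: "\<And>t. f (t + 2*pi) = f t" and "0 < e"
  obtains N g where "trig_poly N g" "\<And>t. t \<in> {0..2*pi} \<Longrightarrow> \<bar>f t - g t\<bar> < e"
proof -
  define F where "F = (\<lambda>z. f (Arg2pi z))"
  have F_cis: "F (cis t) = f t" if "t \<in> {0..2*pi}" for t
  proof (cases "t = 2*pi")
    case True
    then show ?thesis using per[of 0] by (simp add: F_def Arg2pi_of_real[of 1, simplified])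
  next
    case False
    have "Arg2pi (cis t) = t"
      by (rule Arg2pi_unique[of 1]) (use that False in \<open>auto simp: cis_conv_exp\<close>)
    then show ?thesis by (simp add: F_def)
  qed
  have img: "cis ` {0..2*pi} = sphere 0 1"
  proof
    show "sphere 0 1 \<subseteq> cis ` {0..2*pi}"
    proof
      fix z :: complex assume "z \<in> sphere 0 1"
      then have "z = cis (Arg2pi z)" using Arg2pi_eq[of z] by (simp add: cis_conv_exp)
      then show "z \<in> cis ` {0..2*pi}" using Arg2pi_ge_0[of z] Arg2pi_lt_2pi[of z]
        by (metis atLeastAtMost_iff imageI less_le)
    qed
  qed auto
  \<comment> \<open>\<open>Arg2pi\<close> jumps at 1, so continuity of \<open>F\<close> is checked
    on closed preimages: each is the image under \<open>cis\<close> of a compact part of the closed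
    period, both ends of which carry the same value of \<open>f\<close>.\<close>
  have "continuous_on (sphere 0 1) F"
    unfolding continuous_on_closed_vimage[OF closed_sphere]
  proof (intro allI impI)
    fix B :: "real set" assume "closed B"
    have eq: "F -` B \<inter> sphere 0 1 = cis ` (f -` B \<inter> {0..2*pi})"
      unfolding img[symmetric] using F_cis by auto
    have "closed (f -` B)"
      using cont \<open>closed B\<close> by (simp add: continuous_on_closed_vimage[OF closed_UNIV])
    then have "compact (f -` B \<inter> {0..2*pi})" by (simp add: closed_Int_compact)
    then have "compact (cis ` (f -` B \<inter> {0..2*pi}))"
      by (intro compact_continuous_image continuous_intros)
    then show "closed (F -` B \<inter> sphere 0 1)" unfolding eq by (rule compact_imp_closed)
  qed
  then obtain q where q: "real_polynomial_function q" "\<And>z. z \<in> sphere 0 1 \<Longrightarrow> \<bar>F z - q z\<bar> < e"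
    using Stone_Weierstrass_real_polynomial_function[of "sphere (0::complex) 1" F e] \<open>0 < e\<close> by auto
  obtain N where "trig_poly N (\<lambda>t. q (cis t))"
    using real_polynomial_function_trig_poly[OF q(1)] by blast
  moreover have "\<bar>f t - q (cis t)\<bar> < e" if "t \<in> {0..2*pi}" for t
    using q(2)[of "cis t"] F_cis[OF that] by simp
  ultimately show thesis using that by blast
qed

section \<open>Fourier coefficients and best approximation in the mean\<close>

definition fcos :: "(real \<Rightarrow> real) \<Rightarrow> nat \<Rightarrow> real" where
  "fcos f n = circ (\<lambda>t. f t * cos (real n * t))"

definition fsin :: "(real \<Rightarrow> real) \<Rightarrow> nat \<Rightarrow> real" where
  "fsin f n = circ (\<lambda>t. f t * sin (real n * t))"

text \<open>Normalized to be the contribution of harmonic \<open>n > 0\<close> to the integral of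
  \<open>f^2\<close>. The constant harmonic would need another factor 1/2 and is kept apart as
  \<open>(fcos f 0)^2 / (2*pi)\<close>.\<close>

definition energy :: "(real \<Rightarrow> real) \<Rightarrow> nat \<Rightarrow> real" where
  "energy f n = ((fcos f n)^2 + (fsin f n)^2) / pi"

definition fourier_sum :: "(real \<Rightarrow> real) \<Rightarrow> nat \<Rightarrow> real \<Rightarrow> real" where
  "fourier_sum f N t = fcos f 0 / (2*pi) +
     (\<Sum>n=1..N. fcos f n / pi * cos (real n * t) + fsin f n / pi * sin (real n * t))"

lemma trig_poly_fourier_sum: "trig_poly N (fourier_sum f N)"
  unfolding fourier_sum_def[abs_def]
  by (intro trig_poly.add trig_poly_const trig_poly_sum trig_poly.scale trig_poly.cos trig_poly.sin) auto

lemma fcos_add: "continuous_on UNIV f \<Longrightarrow> continuous_on UNIV g \<Longrightarrow>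
    fcos (\<lambda>t. f t + g t) n = fcos f n + fcos g n"
  unfolding fcos_def ring_distribs
  by (intro hk_add integrable_cont continuous_intros)

lemma fsin_add: "continuous_on UNIV f \<Longrightarrow> continuous_on UNIV g \<Longrightarrow>
    fsin (\<lambda>t. f t + g t) n = fsin f n + fsin g n"
  unfolding fsin_def ring_distribs
  by (intro hk_add integrable_cont continuous_intros)

lemma fcos_scale: "fcos (\<lambda>t. c * f t) n = c * fcos f n"
  unfolding fcos_def by (simp add: mult.assoc)

lemma fsin_scale: "fsin (\<lambda>t. c * f t) n = c * fsin f n"
  unfolding fsin_def by (simp add: mult.assoc)

lemma fcos_sum: "(\<And>i. i \<in> I \<Longrightarrow> continuous_on UNIV (f i)) \<Longrightarrow>
    fcos (\<lambda>t. \<Sum>i\<in>I. f i t) n = (\<Sum>i\<in>I. fcos (f i) n)"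
  by (induction I rule: infinite_finite_induct)
     (auto simp: fcos_add continuous_on_sum, auto simp: fcos_def)

lemma fsin_sum: "(\<And>i. i \<in> I \<Longrightarrow> continuous_on UNIV (f i)) \<Longrightarrow>
    fsin (\<lambda>t. \<Sum>i\<in>I. f i t) n = (\<Sum>i\<in>I. fsin (f i) n)"
  by (induction I rule: infinite_finite_induct)
     (auto simp: fsin_add continuous_on_sum, auto simp: fsin_def)

lemma fcos_const: "fcos (\<lambda>t. c) n = (if n = 0 then 2 * pi * c else 0)"
  using fcos_scale[of c "\<lambda>t. cos (real 0 * t)" n] integral_cos_cos[of 0 n]
  by (auto simp: fcos_def)

lemma fsin_const: "fsin (\<lambda>t. c) n = 0"
  using fsin_scale[of c "\<lambda>t. cos (real 0 * t)" n] integral_cos_sin[of 0 n]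
  by (auto simp: fsin_def)

lemma fcos_fourier_sum:
  assumes "m \<le> N" shows "fcos (fourier_sum f N) m = fcos f m"
proof -
  have *: "fcos (\<lambda>t. cos (real n * t)) m = (if n = m then if n = 0 then 2*pi else pi else 0)"
     "fcos (\<lambda>t. sin (real n * t)) m = 0" for n
    using integral_cos_cos[of n m] integral_sin_cos[of n m] by (auto simp: fcos_def)
  have "fcos (fourier_sum f N) m = (if m = 0 then fcos f 0 else 0) +
      (\<Sum>n=1..N. fcos f n / pi * (if n = m then pi else 0))"
    unfolding fourier_sum_def[abs_def]
    by (subst fcos_add, (auto intro!: continuous_intros)[2], subst fcos_sum, (auto intro!: continuous_intros)[1],
        subst fcos_add, (auto intro!: continuous_intros)[2], subst fcos_scale, subst fcos_scale)
       (auto simp: fcos_const * intro!: sum.cong)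
  also have "\<dots> = fcos f m" using assms by (cases "m = 0") (auto simp: if_distrib cong: if_cong)
  finally show ?thesis .
qed

lemma fsin_fourier_sum:
  assumes "m \<le> N" shows "fsin (fourier_sum f N) m = fsin f m"
proof -
  have *: "fsin (\<lambda>t. sin (real n * t)) m = (if n = m \<and> n \<noteq> 0 then pi else 0)"
     "fsin (\<lambda>t. cos (real n * t)) m = 0" for n
    using integral_sin_sin[of n m] integral_cos_sin[of n m] by (auto simp: fsin_def)
  have "fsin (fourier_sum f N) m =
      (\<Sum>n=1..N. fsin f n / pi * (if n = m then pi else 0))"
    unfolding fourier_sum_def[abs_def]
    by (subst fsin_add, (auto intro!: continuous_intros)[2], subst fsin_sum, (auto intro!: continuous_intros)[1],
        subst fsin_add, (auto intro!: continuous_intros)[2], subst fsin_scale, subst fsin_scale)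
       (auto simp: fsin_const * intro!: sum.cong)
  also have "\<dots> = fsin f m" using assms
    by (cases "m = 0") (auto simp: if_distrib fsin_def cong: if_cong)
  finally show ?thesis .
qed

text \<open>Up to degree \<open>N\<close> the partial sum has the same coefficients as
  \<open>f\<close>, so the residual is orthogonal to every generator of \<open>trig_poly N\<close>;
  the rest is linearity.\<close>

lemma fourier_residual_orthogonal:
  assumes f: "continuous_on UNIV f" and "trig_poly N g"
  shows "circ (\<lambda>t. (f t - fourier_sum f N t) * g t) = 0"
proof -
  note c = continuous_on_trig_poly[OF trig_poly_fourier_sum]
  show ?thesis using assms(2)
  proof induction
    case (cos n)
    have "circ (\<lambda>t. (f t - fourier_sum f N t) * cos (real n * t)) =
      fcos f n - fcos (fourier_sum f N) n"
      unfolding fcos_def left_diff_distrib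
      by (intro hk_diff integrable_cont continuous_intros f c)
    then show ?case using fcos_fourier_sum[OF cos] by simp
  next
    case (sin n)
    have "circ (\<lambda>t. (f t - fourier_sum f N t) * sin (real n * t)) =
      fsin f n - fsin (fourier_sum f N) n"
      unfolding fsin_def left_diff_distrib
      by (intro hk_diff integrable_cont continuous_intros f c)
    then show ?case using fsin_fourier_sum[OF sin] by simp
  next
    case (scale g a)
    have "(\<lambda>t. (f t - fourier_sum f N t) * (a * g t)) = (\<lambda>t. a * ((f t - fourier_sum f N t) * g t))"
      by (auto simp: algebra_simps)
    then show ?case using scale by simp
  next
    case (add g h)
    then show ?case unfolding ring_distribs(1)
      by (subst hk_add)
         (auto intro!: integrable_cont continuous_intros f c continuous_on_trig_poly[OF add.hyps(1)]
            continuous_on_trig_poly[OF add.hyps(2)])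
  qed
qed

lemma integral_fourier_sum_mult:
  assumes f: "continuous_on UNIV f"
  shows "circ (\<lambda>t. f t * fourier_sum f N t) = (fcos f 0)^2 / (2*pi) + (\<Sum>n=1..N. energy f n)"
proof -
  have "circ (\<lambda>t. f t * fourier_sum f N t) =
    circ (\<lambda>t. fcos f 0 / (2*pi) * (f t * cos (real 0 * t)) +
     (\<Sum>n=1..N. fcos f n / pi * (f t * cos (real n * t)) + fsin f n / pi * (f t * sin (real n * t))))"
    unfolding fourier_sum_def
    by (intro arg_cong2[where f=integral] refl ext) (simp add: ring_distribs sum_distrib_left mult_ac)
  also have "\<dots> = fcos f 0 / (2*pi) * fcos f 0 + (\<Sum>n=1..N. fcos f n / pi * fcos f n + fsin f n / pi * fsin f n)"
    unfolding fcos_def[of f "_"] fsin_def[of f "_"]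
    by (subst hk_add,
        (intro integrable_cont continuous_intros f)+,
        subst Henstock_Kurzweil_Integration.integral_sum, simp,
        (intro integrable_cont continuous_intros f)+,
        subst hk_add,
        (intro integrable_cont continuous_intros f)+, simp)
  also have "\<dots> = (fcos f 0)^2 / (2*pi) + (\<Sum>n=1..N. energy f n)"
    by (simp add: energy_def power2_eq_square add_divide_distrib)
  finally show ?thesis .
qed

lemma integral_residual_sq:
  assumes f: "continuous_on UNIV f"
  shows "circ (\<lambda>t. (f t - fourier_sum f N t)^2) =
     circ (\<lambda>t. (f t)^2) - (fcos f 0)^2 / (2*pi) - (\<Sum>n=1..N. energy f n)"
proof -
  note c = continuous_on_trig_poly[OF trig_poly_fourier_sum]
  have "(\<lambda>t. (f t - fourier_sum f N t)^2) =
    (\<lambda>t. (f t)^2 - f t * fourier_sum f N t - (f t - fourier_sum f N t) * fourier_sum f N t)"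
    by (auto simp: power2_eq_square algebra_simps)
  then have "circ (\<lambda>t. (f t - fourier_sum f N t)^2) =
     circ (\<lambda>t. (f t)^2) - circ (\<lambda>t. f t * fourier_sum f N t) -
     circ (\<lambda>t. (f t - fourier_sum f N t) * fourier_sum f N t)"
    by (simp only:) ((subst hk_diff,
        (intro integrable_cont continuous_intros f c)+)+, simp)
  then show ?thesis
    using integral_fourier_sum_mult[OF f, of N] fourier_residual_orthogonal[OF f trig_poly_fourier_sum, of N] by simp
qed

text \<open>Pythagoras: \<open>f - g\<close> is the residual plus a trigonometric polynomial of
  degree \<open>N\<close>, and the two are orthogonal.\<close>

lemma integral_residual_sq_le:
  assumes f: "continuous_on UNIV f" and g: "trig_poly N g"
  shows "circ (\<lambda>t. (f t - fourier_sum f N t)^2) \<le> circ (\<lambda>t. (f t - g t)^2)"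
proof -
  note c = continuous_on_trig_poly[OF trig_poly_fourier_sum]
  note cg = continuous_on_trig_poly[OF g]
  have tp: "trig_poly N (\<lambda>t. fourier_sum f N t - g t)"
    by (intro trig_poly_diff trig_poly_fourier_sum g)
  have "(\<lambda>t. (f t - g t)^2) = (\<lambda>t. (f t - fourier_sum f N t)^2 + (fourier_sum f N t - g t)^2 +
        2 * ((f t - fourier_sum f N t) * (fourier_sum f N t - g t)))"
    by (auto simp: power2_eq_square algebra_simps)
  then have "circ (\<lambda>t. (f t - g t)^2) =
     circ (\<lambda>t. (f t - fourier_sum f N t)^2) +
     circ (\<lambda>t. (fourier_sum f N t - g t)^2) +
     2 * circ (\<lambda>t. (f t - fourier_sum f N t) * (fourier_sum f N t - g t))"
    by (simp only:) ((subst hk_add,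
        (intro integrable_cont continuous_intros f c cg)+)+, simp)
  moreover have "circ (\<lambda>t. (fourier_sum f N t - g t)^2) \<ge> 0"
    by (intro hk_nonneg integrable_cont continuous_intros c cg) auto
  ultimately show ?thesis using fourier_residual_orthogonal[OF f tp] by simp
qed

lemma energy_nonneg: "energy f n \<ge> 0"
  by (simp add: energy_def)

text \<open>Nonnegativity of the squared residual bounds the partial sums from above (Bessel). A
  uniformly close trigonometric polynomial of degree \<open>M\<close> bounds all residuals with
  \<open>N \<ge> M\<close> by best approximation. The shift by \<open>Suc\<close> skips the constant
  harmonic.\<close>

theorem parseval:
  assumes f: "continuous_on UNIV f" and per: "\<And>t. f (t + 2*pi) = f t"
  shows "(\<lambda>n. energy f (Suc n)) sums (circ (\<lambda>t. (f t)^2) - (fcos f 0)^2 / (2*pi))"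
proof -
  define J where "J = circ (\<lambda>t. (f t)^2) - (fcos f 0)^2 / (2*pi)"
  have res: "circ (\<lambda>t. (f t - fourier_sum f N t)^2) = J - (\<Sum>n<N. energy f (Suc n))" for N
    using integral_residual_sq[OF f, of N]
    by (simp add: J_def sum.atLeast1_atMost_eq)
  have le: "(\<Sum>n<N. energy f (Suc n)) \<le> J" for N
  proof -
    have "0 \<le> circ (\<lambda>t. (f t - fourier_sum f N t)^2)"
      by (intro hk_nonneg integrable_cont continuous_intros f
          continuous_on_trig_poly[OF trig_poly_fourier_sum]) auto
    then show ?thesis using res[of N] by simp
  qed
  have "\<exists>N0. \<forall>N\<ge>N0. J - (\<Sum>n<N. energy f (Suc n)) < e" if "e > 0" for e
  proof -
    \<comment> \<open>A uniform error \<open>d\<close> costs at most \<open>2*pi*d^2 = e/2\<close>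
      in the mean square.\<close>
    define d where "d = sqrt (e / (4*pi))"
    have d: "d > 0" "d^2 = e / (4*pi)" using that by (auto simp: d_def)
    obtain M g where g: "trig_poly M g" "\<And>t. t \<in> {0..2*pi} \<Longrightarrow> \<bar>f t - g t\<bar> < d"
      using trig_poly_approx[OF f per d(1)] by blast
    have "J - (\<Sum>n<N. energy f (Suc n)) < e" if "N \<ge> M" for N
    proof -
      have "J - (\<Sum>n<N. energy f (Suc n)) \<le> circ (\<lambda>t. (f t - g t)^2)"
        using integral_residual_sq_le[OF f trig_poly_mono[OF g(1) that]] res[of N] by simp
      also have "\<dots> \<le> circ (\<lambda>t. d^2)"
      proof (intro integral_le integrable_cont continuous_intros f continuous_on_trig_poly[OF g(1)])
        fix t :: real assume "t \<in> {0..2*pi}"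
        then show "(f t - g t)^2 \<le> d^2" using g(2)[of t] by (metis abs_ge_zero less_imp_le power2_abs power_mono)
      qed
      also have "\<dots> = e/2" by (simp add: d(2))
      finally show ?thesis using \<open>e > 0\<close> by simp
    qed
    then show ?thesis by blast
  qed
  then show ?thesis
    unfolding sums_def J_def[symmetric] LIMSEQ_def dist_real_def
    using le by (subst abs_minus_commute) (simp add: abs_of_nonneg)
qed

section \<open>Shifts of periodic functions and Fourier coefficients of derivatives\<close>

lemma periodic_shift_integral:
  fixes f :: "real \<Rightarrow> real"
  assumes f: "continuous_on UNIV f" and per: "\<And>t. f (t + 2*pi) = f t" and a: "0 \<le> a" "a \<le> 2*pi"
  shows "circ (\<lambda>t. f (t + a)) = circ f"
proof -
  have "circ (\<lambda>t. f (t + a)) = integral {a..2*pi+a} f"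
    using integral_shift_Icc_real[of 0 "2*pi" f a] by (simp add: o_def add.commute)
  also have "\<dots> = integral {a..2*pi} f + integral {2*pi..2*pi+a} f"
    using a by (intro hk_combine[symmetric] integrable_cont f) auto
  also have "integral {2*pi..2*pi+a} f = integral {0..a} (\<lambda>t. f (t + 2*pi))"
    using integral_shift_Icc_real[of 0 a f "2*pi"] by (simp add: o_def add.commute)
  also have "\<dots> = integral {0..a} f" by (simp add: per)
  also have "integral {a..2*pi} f + integral {0..a} f = circ f"
    using a by (subst add.commute, intro hk_combine integrable_cont f) auto
  finally show ?thesis .
qed

lemma fcos_deriv:
  assumes d: "\<And>t. (f has_field_derivative f' t) (at t)" and c: "continuous_on UNIV f'"
    and per: "\<And>t. f (t + 2*pi) = f t"
  shows "fcos f' n = real n * fsin f n" "fsin f' n = - real n * fcos f n"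
proof -
  have f: "continuous_on UNIV f" using d by (meson DERIV_isCont continuous_at_imp_continuous_on)
  have per0: "f (2*pi) = f 0" using per[of 0] by simp
  have cs: "cos (real n * (2*pi)) = 1" "sin (real n * (2*pi)) = 0"
    by (metis cos_2npi mult.commute mult.left_commute, metis sin_2npi mult.commute mult.left_commute)
  have "((\<lambda>t. f' t * cos (real n * t) - real n * (f t * sin (real n * t))) has_integral
     (f (2*pi) * cos (real n * (2*pi)) - f 0 * cos (real n * 0))) {0..2*pi}"
    by (intro ftc) (auto intro!: derivative_eq_intros d)
  then have "circ (\<lambda>t. f' t * cos (real n * t) - real n * (f t * sin (real n * t))) = 0"
    using cs per0 by (simp add: integral_unique)
  then show "fcos f' n = real n * fsin f n" unfolding fcos_def fsin_def
    by (subst (asm) hk_diff)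
       (auto intro!: integrable_cont continuous_intros f c)
  have "((\<lambda>t. f' t * sin (real n * t) + real n * (f t * cos (real n * t))) has_integral
     (f (2*pi) * sin (real n * (2*pi)) - f 0 * sin (real n * 0))) {0..2*pi}"
    by (intro ftc) (auto intro!: derivative_eq_intros d)
  then have "circ (\<lambda>t. f' t * sin (real n * t) + real n * (f t * cos (real n * t))) = 0"
    using cs per0 by (simp add: integral_unique)
  then show "fsin f' n = - real n * fcos f n" unfolding fcos_def fsin_def
    by (subst (asm) hk_add)
       (auto intro!: integrable_cont continuous_intros f c)
qed

lemma energy_deriv:
  assumes "\<And>t. (f has_field_derivative f' t) (at t)" "continuous_on UNIV f'" "\<And>t. f (t + 2*pi) = f t"
  shows "energy f' n = (real n)^2 * energy f n"
  by (simp add: energy_def fcos_deriv[OF assms] power_mult_distrib ring_distribs)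

section \<open>Support functions and a Sturm comparison\<close>

text \<open>The right-hand sides are the solution of \<open>y'' + y = 0\<close> with the value and
  slope of \<open>u\<close> at \<open>a\<close>, the support function of a single point. Applied to
  \<open>p\<close>, to its translates and to \<open>M - p\<close>, the comparison yields all later
  inequalities on tangent lines.\<close>

lemma sturm_pos:
  fixes u u1 u2 :: "real \<Rightarrow> real"
  assumes u: "\<And>t. (u has_field_derivative u1 t) (at t)"
    and u1: "\<And>t. (u1 has_field_derivative u2 t) (at t)"
    and pos: "\<And>t. u t + u2 t > 0"
    and d: "0 < d" "d \<le> pi"
  shows "u (a + d) > u a * cos d + u1 a * sin d"
    and "u (a - d) > u a * cos d - u1 a * sin d"
proof -
  \<comment> \<open>The Wronskian of \<open>u\<close> and \<open>\<lambda>x. sin (a + d - x)\<close> is monotone.\<close>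
  define W where "W = (\<lambda>x. u1 x * sin (a + d - x) + u x * cos (a + d - x))"
  have "\<exists>z. a < z \<and> z < a + d \<and> W (a + d) - W a = (a + d - a) * ((u z + u2 z) * sin (a + d - z))"
    unfolding W_def using d
    by (intro MVT2) (auto intro!: derivative_eq_intros u u1 simp: algebra_simps)
  then obtain z where z: "a < z" "z < a + d" "W (a + d) - W a = d * ((u z + u2 z) * sin (a + d - z))" by auto
  have "sin (a + d - z) > 0" using z d by (intro sin_gt_zero) auto
  then have "W (a + d) > W a" using z(3) pos[of z] d(1) by (smt (verit) mult_pos_pos)
  then show "u (a + d) > u a * cos d + u1 a * sin d" by (simp add: W_def)
  define V where "V = (\<lambda>x. u1 x * sin (a - d - x) + u x * cos (a - d - x))"
  have "\<exists>z. a - d < z \<and> z < a \<and> V a - V (a - d) = (a - (a - d)) * ((u z + u2 z) * sin (a - d - z))"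
    unfolding V_def using d
    by (intro MVT2) (auto intro!: derivative_eq_intros u u1 simp: algebra_simps)
  then obtain z where z: "a - d < z" "z < a" "V a - V (a - d) = d * ((u z + u2 z) * sin (a - d - z))" by auto
  have "sin (z - (a - d)) > 0" using z d by (intro sin_gt_zero) auto
  then have "sin (a - d - z) < 0" using sin_minus[of "z - (a - d)"] by simp
  then have "V a < V (a - d)" using z(3) pos[of z] d(1) by (smt (verit) mult_pos_neg mult_pos_pos)
  then show "u (a - d) > u a * cos d - u1 a * sin d" by (simp add: V_def)
qed

locale convex_support =
  fixes p p1 p2 :: "real \<Rightarrow> real"
  assumes p: "\<And>t. (p has_field_derivative p1 t) (at t)"
    and p1: "\<And>t. (p1 has_field_derivative p2 t) (at t)"
    and p2_cont: "continuous_on UNIV p2"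
    and per: "\<And>t. p (t + 2*pi) = p t"
    and pos: "\<And>t. p t + p2 t > 0"
begin

lemma p_cont: "continuous_on A p"
  using p by (meson DERIV_isCont continuous_at_imp_continuous_on)

lemma p1_cont: "continuous_on A p1"
  using p1 by (meson DERIV_isCont continuous_at_imp_continuous_on)

lemma per1: "p1 (t + 2*pi) = p1 t"
proof -
  have "((\<lambda>t. p (t + 2*pi)) has_field_derivative p1 (t + 2*pi)) (at t)"
    using DERIV_shift[of p "p1 (t + 2*pi)" t "2*pi"] p by simp
  then show ?thesis using DERIV_unique p per by (simp add: per) blast
qed

lemma per2: "p2 (t + 2*pi) = p2 t"
proof -
  have "((\<lambda>t. p1 (t + 2*pi)) has_field_derivative p2 (t + 2*pi)) (at t)"
    using DERIV_shift[of p1 "p2 (t + 2*pi)" t "2*pi"] p1 by simp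
  then show ?thesis using DERIV_unique p1 per by (simp add: per1) blast
qed

lemma per_int:
  "p (t + 2 * pi * of_int k) = p t" "p1 (t + 2 * pi * of_int k) = p1 t"
proof -
  have *: "f (t + 2 * pi * of_int k) = f t" if f: "\<And>t. f (t + 2*pi) = f t" for f :: "real \<Rightarrow> real"
  proof (induction k arbitrary: t rule: int_induct[of _ 0])
    case (step1 i)
    then show ?case using f[of "t + 2 * pi * of_int i"] by (simp add: algebra_simps)
  next
    case (step2 i)
    then show ?case using f[of "t + 2 * pi * of_int (i - 1)"] by (simp add: algebra_simps)
  qed auto
  show "p (t + 2 * pi * of_int k) = p t" "p1 (t + 2 * pi * of_int k) = p1 t"
    using * per per1 by auto
qed

text \<open>A maximum over one period bounds the radius of curvature everywhere. Comparison with the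
  circle of radius \<open>M\<close> later controls the Jacobian near the boundary of the
  body.\<close>

lemma curvature_bound: obtains M where "M > 0" "\<And>t. p t + p2 t < M"
proof -
  have "compact ((\<lambda>t. p t + p2 t) ` {0..2*pi})"
    by (intro compact_continuous_image continuous_intros p_cont)
       (auto intro: continuous_on_subset[OF p2_cont])
  then have "bdd_above ((\<lambda>t. p t + p2 t) ` {0..2*pi})"
    by (simp add: compact_imp_bounded bounded_imp_bdd_above)
  then obtain M where M: "\<And>t. t \<in> {0..2*pi} \<Longrightarrow> p t + p2 t \<le> M"
    unfolding bdd_above_def by force
  have "p t + p2 t < \<bar>M\<bar> + 1" for t
  proof -
    define k where "k = \<lfloor>t / (2*pi)\<rfloor>"
    have "t - 2 * pi * of_int k \<in> {0..2*pi}"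
      unfolding k_def using floor_divide_lower[of "2*pi" t] floor_divide_upper[of "2*pi" t]
      by (auto simp: algebra_simps)
    moreover have "p2 (s + 2 * pi * of_int k) = p2 s" for s
      using per_int(2)[of _ k] DERIV_shift[of p1 "p2 (s + 2 * pi * of_int k)" s "2 * pi * of_int k"] p1
      by (simp add: per_int) (metis DERIV_unique p1)
    ultimately show ?thesis
      using M[of "t - 2 * pi * of_int k"] per_int(1)[of "t - 2 * pi * of_int k" k]
      by (metis abs_ge_self add.commute diff_add_cancel le_less_trans less_add_one dual_order.trans)
  qed
  then show thesis using that[of "\<bar>M\<bar> + 1"] by auto
qed

text \<open>Up to the factor \<open>sin \<phi>\<close>, these are the lengths of the tangent segments with normal angles \<open>x\<close> and \<open>x + \<phi>\<close>
  from their common point.\<close>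

definition N1 :: "real \<Rightarrow> real \<Rightarrow> real" where
  "N1 x \<phi> = p (x + \<phi>) - p x * cos \<phi> - p1 x * sin \<phi>"

definition N2 :: "real \<Rightarrow> real \<Rightarrow> real" where
  "N2 x \<phi> = p x - p (x + \<phi>) * cos \<phi> + p1 (x + \<phi>) * sin \<phi>"

lemma N1_pos: "0 < \<phi> \<Longrightarrow> \<phi> \<le> pi \<Longrightarrow> N1 x \<phi> > 0"
  using sturm_pos(1)[OF p p1 pos, of \<phi> x] by (simp add: N1_def)

lemma N2_pos: "0 < \<phi> \<Longrightarrow> \<phi> \<le> pi \<Longrightarrow> N2 x \<phi> > 0"
  using sturm_pos(2)[OF p p1 pos, of \<phi> "x + \<phi>"] by (simp add: N2_def)

text \<open>Sturm comparison for \<open>M - p\<close>: the quantity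
  \<open>M * (1 - cos \<phi>)\<close> is what \<open>N1\<close> and \<open>N2\<close> become for a
  circle of radius \<open>M\<close>. It shows that both are of second order in
  \<open>\<phi>\<close>.\<close>

lemma
  assumes M: "\<And>t. p t + p2 t < M" and \<phi>: "0 < \<phi>" "\<phi> \<le> pi"
  shows N1_less: "N1 x \<phi> < M * (1 - cos \<phi>)" and N2_less: "N2 x \<phi> < M * (1 - cos \<phi>)"
proof -
  have 1: "((\<lambda>t. M - p t) has_field_derivative - p1 t) (at t)" for t
    by (auto intro!: derivative_eq_intros p)
  have 2: "((\<lambda>t. - p1 t) has_field_derivative - p2 t) (at t)" for t
    by (auto intro!: derivative_eq_intros p1)
  show "N1 x \<phi> < M * (1 - cos \<phi>)"
    using sturm_pos(1)[OF 1 2 _ \<phi>, of x] M by (simp add: N1_def algebra_simps)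
  show "N2 x \<phi> < M * (1 - cos \<phi>)"
    using sturm_pos(2)[OF 1 2 _ \<phi>, of "x + \<phi>"] M by (simp add: N2_def algebra_simps)
qed

text \<open>The left side is the support function of the boundary point with normal angle
  \<open>x\<close>, so this is strict convexity: each other support line misses that point. Beyond
  \<open>pi\<close> the comparison runs backwards from \<open>x\<close>, and the period brings the
  angle back.\<close>

lemma tangent_line_less:
  assumes "0 < d" "d < 2*pi"
  shows "p x * cos d + p1 x * sin d < p (x + d)"
proof (cases "d \<le> pi")
  case True
  then show ?thesis using N1_pos[of d x] assms by (simp add: N1_def)
next
  case False
  then have "p (x + (d - 2*pi)) > p x * cos (2*pi - d) - p1 x * sin (2*pi - d)"
    using sturm_pos(2)[OF p p1 pos, of "2*pi - d" x] assms by (simp add: algebra_simps)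
  moreover have "p (x + (d - 2*pi)) = p (x + d)" using per[of "x + (d - 2*pi)"] by simp
  ultimately show ?thesis by (simp add: cos_diff sin_diff)
qed

end

section \<open>Tangent lines and the visual angle\<close>

lemma inner_nvec: "x \<bullet> nvec t = x $ 1 * cos t + x $ 2 * sin t"
  by (simp add: nvec_def inner_vec_def sum_2)

lemma inner_tvec: "x \<bullet> tvec t = x $ 2 * cos t - x $ 1 * sin t"
  by (simp add: tvec_def inner_vec_def sum_2)

lemma nvec_component [simp]: "nvec t $ 1 = cos t" "nvec t $ 2 = sin t"
  by (simp_all add: nvec_def)

lemma tvec_component [simp]: "tvec t $ 1 = - sin t" "tvec t $ 2 = cos t"
  by (simp_all add: tvec_def)

lemma frame_inner:
  "nvec s \<bullet> nvec t = cos (t - s)" "tvec s \<bullet> tvec t = cos (t - s)"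
  "tvec s \<bullet> nvec t = sin (t - s)" "nvec s \<bullet> tvec t = - sin (t - s)"
  by (simp_all add: inner_nvec inner_tvec cos_diff sin_diff)

lemma norm_nvec [simp]: "norm (nvec t) = 1" and norm_tvec [simp]: "norm (tvec t) = 1"
  by (simp_all add: norm_eq_sqrt_inner frame_inner)

lemma frame_expand: "x = (x \<bullet> nvec t) *\<^sub>R nvec t + (x \<bullet> tvec t) *\<^sub>R tvec t"
proof -
  have "(u * cos t + v * sin t) * cos t - (v * cos t - u * sin t) * sin t = u"
    "(u * cos t + v * sin t) * sin t + (v * cos t - u * sin t) * cos t = v" for u v
    using sin_cos_squared_add3[of t] by algebra+
  from this[of "x $ 1" "x $ 2"] show ?thesis
    by (simp add: vec_eq_iff forall_2 inner_nvec inner_tvec)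
qed

lemma nvec_nonzero [simp]: "nvec t \<noteq> 0"
  by (metis norm_nvec norm_zero zero_neq_one)

lemma polar_nvec:
  assumes "u \<noteq> 0" obtains r t where "r > 0" "u = r *\<^sub>R nvec t"
proof -
  have pos: "norm u > 0" using assms by simp
  have sq: "(norm u)^2 = (u $ 1)^2 + (u $ 2)^2"
    unfolding power2_norm_eq_inner by (simp add: inner_vec_def sum_2 power2_eq_square)
  have "(u $ 1 / norm u)^2 + (u $ 2 / norm u)^2 = 1"
    using pos by (simp add: power_divide flip: add_divide_distrib sq)
  then obtain t where "u $ 1 / norm u = cos t" "u $ 2 / norm u = sin t"
    using sincos_total_2pi by metis
  then have "u $ 1 = norm u * cos t" "u $ 2 = norm u * sin t"
    using pos by (metis less_numeral_extra(3) nonzero_mult_div_cancel_left times_divide_eq_right)+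
  then have "u = norm u *\<^sub>R nvec t" by (simp only: vec_eq_iff forall_2) simp
  then show thesis using that pos by blast
qed

lemma nvec_periodic: "nvec (t + 2 * pi * of_int k) = nvec t"
  and tvec_periodic: "tvec (t + 2 * pi * of_int k) = tvec t"
  unfolding nvec_def tvec_def sin_add cos_add sin_int_2pin cos_int_2pin mult_1_right mult_zero_right diff_zero add_0_right by (rule refl)+

lemma angle_reduce:
  fixes a t :: real
  obtains d k where "0 \<le> d" "d < 2*pi" "t = a + d + 2 * pi * of_int k"
proof -
  define k where "k = \<lfloor>(t - a) / (2*pi)\<rfloor>"
  define d where "d = t - a - 2 * pi * of_int k"
  have pos: "0 < 2 * pi" by simp
  have lo: "of_int k * (2 * pi) \<le> t - a"
    unfolding k_def by (rule floor_divide_lower[OF pos])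
  have hi: "t - a < (of_int k + 1) * (2 * pi)"
    unfolding k_def by (rule floor_divide_upper[OF pos])
  have "0 \<le> d" using lo unfolding d_def by (simp add: mult.commute)
  moreover have "d < 2 * pi" using hi unfolding d_def distrib_right by (simp add: mult.commute)
  moreover have "t = a + d + 2 * pi * of_int k" by (simp add: d_def)
  ultimately show thesis by (rule that)
qed

lemma shift_eq_iff:
  assumes "a \<le> x" "x < a + 2*pi" "a \<le> y" "y < a + 2*pi" "y = x + 2 * pi * of_int k"
  shows "x = y"
proof -
  have "\<bar>2 * pi * of_int k\<bar> < 2*pi" using assms by auto
  then have "\<bar>of_int k :: real\<bar> < 1" by (simp add: abs_mult)
  then have "k = 0" by linarith
  then show ?thesis using assms by simp
qed

locale body = convex_support +
  fixes K :: "(real^2) set"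
  assumes nonempty: "K \<noteq> {}" and compact: "compact K" and convex: "convex K"
    and p_def: "p = supp_fun K"
begin

section \<open>The body as the intersection of its supporting half-planes\<close>

lemma supp_ge: "x \<in> K \<Longrightarrow> x \<bullet> nvec t \<le> p t"
proof -
  assume "x \<in> K"
  moreover have "compact ((\<lambda>x. x \<bullet> nvec t) ` K)"
    by (intro compact_continuous_image continuous_intros compact)
  then have "bdd_above ((\<lambda>x. x \<bullet> nvec t) ` K)"
    by (simp add: compact_imp_bounded bounded_imp_bdd_above)
  ultimately show ?thesis unfolding p_def supp_fun_def by (intro cSUP_upper)
qed

lemma supp_le: "(\<And>x. x \<in> K \<Longrightarrow> x \<bullet> nvec t \<le> c) \<Longrightarrow> p t \<le> c"
  unfolding p_def supp_fun_def using nonempty by (intro cSUP_least)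

lemma supp_attained: obtains x where "x \<in> K" "x \<bullet> nvec t = p t"
proof -
  have "\<exists>x\<in>K. \<forall>y\<in>K. y \<bullet> nvec t \<le> x \<bullet> nvec t"
    by (intro continuous_attains_sup compact nonempty continuous_intros)
  then obtain x where "x \<in> K" "\<And>y. y \<in> K \<Longrightarrow> y \<bullet> nvec t \<le> x \<bullet> nvec t"
    by blast
  then show thesis using that[of x] supp_ge[of x t] supp_le[of t "x \<bullet> nvec t"] by force
qed

lemma mem_iff: "x \<in> K \<longleftrightarrow> (\<forall>t. x \<bullet> nvec t \<le> p t)"
proof
  assume *: "\<forall>t. x \<bullet> nvec t \<le> p t"
  show "x \<in> K"
  proof (rule ccontr)
    assume "x \<notin> K"
    then obtain a b where ab: "a \<bullet> x < b" "\<And>y. y \<in> K \<Longrightarrow> b < a \<bullet> y"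
      using separating_hyperplane_closed_point[OF convex compact_imp_closed[OF compact]] by metis
    have "- a \<noteq> 0" using ab nonempty by force
    then obtain r t where rt: "r > 0" "- a = r *\<^sub>R nvec t" using polar_nvec by blast
    obtain y where y: "y \<in> K" "y \<bullet> nvec t = p t" using supp_attained by blast
    have "(- a) \<bullet> y < (- a) \<bullet> x" using ab(1) ab(2)[OF y(1)] by simp
    then have "y \<bullet> nvec t < x \<bullet> nvec t" unfolding rt using rt(1) by (simp add: inner_commute)
    then show False using * y(2) by (metis linorder_not_less)
  qed
qed (use supp_ge in blast)

text \<open>\<open>h P\<close> is the support function of the translate of \<open>K\<close> that moves \<open>P\<close> to the origin; its zeros are
  the normal angles of the tangent lines through \<open>P\<close>.\<close>

definition h :: "real^2 \<Rightarrow> real \<Rightarrow> real" where "h P t = p t - P \<bullet> nvec t"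
definition h1 :: "real^2 \<Rightarrow> real \<Rightarrow> real" where "h1 P t = p1 t - P \<bullet> tvec t"

lemma h_deriv: "(h P has_field_derivative h1 P t) (at t)"
  "(h1 P has_field_derivative p2 t + P \<bullet> nvec t) (at t)"
  unfolding h_def[abs_def] h1_def[abs_def] inner_nvec inner_tvec
  by (auto intro!: derivative_eq_intros p p1 simp: algebra_simps)

lemma h_sturm:
  assumes "0 < d" "d \<le> pi"
  shows "h P (a + d) > h P a * cos d + h1 P a * sin d"
    and "h P (a - d) > h P a * cos d - h1 P a * sin d"
  using sturm_pos[OF h_deriv, of P d a] assms pos by (auto simp: h_def)

lemma h_period: "h P (t + 2 * pi * of_int k) = h P t" "h1 P (t + 2 * pi * of_int k) = h1 P t"
  by (auto simp: h_def h1_def per_int nvec_periodic tvec_periodic)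

lemma h_period1: "h P (t + 2 * pi) = h P t"
  using h_period(1)[of P t 1] by simp

lemma h_antipodal: "h P t + h P (t + pi) > 0"
  using h_sturm(1)[of pi P t] by simp

text \<open>Going back from \<open>z\<close> by \<open>2*pi - d \<le> pi\<close>, comparison keeps
  \<open>h P\<close> above \<open>- h1 P z * sin (2*pi - d) \<ge> 0\<close>; by periodicity this is
  the value at \<open>z + d\<close>.\<close>

lemma pos_before_descending_zero:
  assumes z: "h P z = 0" "h1 P z < 0" and d: "pi \<le> d" "d < 2*pi"
  shows "h P (z + d) > 0"
proof -
  have "h P (z - (2*pi - d)) > - h1 P z * sin (2*pi - d)"
    using h_sturm(2)[of "2*pi - d" P z] d z by auto
  moreover have "sin (2*pi - d) \<ge> 0" using d by (intro sin_ge_zero) auto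
  moreover have "h P (z - (2*pi - d)) = h P (z + d)"
    using h_period1[of P "z - (2*pi - d)"] by (simp add: algebra_simps)
  ultimately show ?thesis using z(2) by (smt (verit) mult_nonpos_nonneg minus_mult_left)
qed

text \<open>Of two descending zeros less than \<open>pi\<close> apart, the later one forces
  \<open>h P > 0\<close> at the earlier one by backward comparison; at distance \<open>pi\<close> or
  more the earlier one forces positivity at the later one. This makes the first tangent angle a
  coordinate of \<open>P\<close>.\<close>

lemma descending_unique:
  assumes z: "h P z = 0" "h1 P z < 0" and t: "h P t = 0" "h1 P t < 0"
  shows "\<exists>k. t = z + 2 * pi * of_int k"
proof -
  obtain d k where dk: "0 \<le> d" "d < 2*pi" "t = z + d + 2 * pi * of_int k"
    using angle_reduce[where a = z and t = t] by blast
  have td: "h P (z + d) = 0" "h1 P (z + d) < 0" using t unfolding dk(3) h_period by blast+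
  have "d = 0"
  proof (rule ccontr)
    assume "d \<noteq> 0"
    with dk have "d > 0" by simp
    show False
    proof (cases "d < pi")
      case True
      then show False using h_sturm(2)[of d P "z + d"] td z \<open>d > 0\<close> sin_gt_zero[of d] mult_neg_pos[of "h1 P (z + d)" "sin d"] by auto
    next
      case False
      then show False using pos_before_descending_zero[OF z, of d] dk td by simp
    qed
  qed
  then show ?thesis using dk by auto
qed

text \<open>A third zero between the two would need a negative slope by comparison with the
  ascending zero and a positive slope by comparison with the descending one. Between
  \<open>\<phi>\<close> and \<open>pi\<close>, forward comparison from the ascending zero gives
  positivity; from \<open>pi\<close> on, \<open>pos_before_descending_zero\<close> does.\<close>

lemma zeros_only:
  assumes z: "h P z = 0" "h1 P z < 0" and \<phi>: "0 < \<phi>" "\<phi> < pi"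
    and z': "h P (z + \<phi>) = 0" "h1 P (z + \<phi>) > 0" and t: "h P t = 0"
  shows "\<exists>k. t = z + 2 * pi * of_int k \<or> t = z + \<phi> + 2 * pi * of_int k"
proof -
  obtain d k where dk: "0 \<le> d" "d < 2*pi" "t = z + d + 2 * pi * of_int k"
    using angle_reduce[where a = z and t = t] by blast
  have td: "h P (z + d) = 0" using t unfolding dk(3) h_period .
  have "d = 0 \<or> d = \<phi>"
  proof (rule ccontr)
    assume "\<not> (d = 0 \<or> d = \<phi>)"
    then consider "d > 0" "d < \<phi>" | "d > \<phi>" "d < pi" | "d \<ge> pi" using dk by linarith
    then show False
    proof cases
      case 1
      have "0 > h1 P (z + d) * sin (\<phi> - d)"
        using h_sturm(1)[of "\<phi> - d" P "z + d"] 1 \<phi> td z' by auto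
      then have "h1 P (z + d) < 0" using sin_gt_zero[of "\<phi> - d"] 1 \<phi>
        by (smt (verit) mult_nonneg_nonneg)
      moreover have "0 > - h1 P (z + d) * sin d"
        using h_sturm(2)[of d P "z + d"] 1 \<phi> td z by auto
      then have "h1 P (z + d) > 0" using sin_gt_zero[of d] 1 \<phi>
        by (smt (verit) mult_nonneg_nonneg)
      ultimately show False by simp
    next
      case 2
      have "h P (z + \<phi> + (d - \<phi>)) > h1 P (z + \<phi>) * sin (d - \<phi>)"
        using h_sturm(1)[of "d - \<phi>" P "z + \<phi>"] 2 \<phi> z' by auto
      moreover have "sin (d - \<phi>) > 0" using 2 \<phi> by (intro sin_gt_zero) auto
      ultimately show False using td z'(2) by (smt (verit) mult_pos_pos)
    next
      case 3
      then show False using pos_before_descending_zero[OF z, of d] dk td by simp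
    qed
  qed
  then show ?thesis using dk by auto
qed

text \<open>Some half-plane separates \<open>P\<close> from \<open>K\<close>, so \<open>h P\<close>
  is negative at some \<open>t0\<close>, and positivity of antipodal sums makes it positive at
  \<open>t0 - pi\<close> and \<open>t0 + pi\<close>. The intermediate value theorem gives a zero on
  each side, and comparison back to \<open>t0\<close> gives the signs of the slopes.\<close>

lemma exterior_zeros:
  assumes "P \<notin> K"
  obtains z \<phi> where "h P z = 0" "h1 P z < 0" "0 < \<phi>" "\<phi> < pi" "h P (z + \<phi>) = 0" "h1 P (z + \<phi>) > 0"
proof -
  obtain t0 where t0: "h P t0 < 0" using assms by (auto simp: mem_iff h_def not_le)
  have cont: "isCont (h P) x" for x using h_deriv(1) DERIV_isCont by blast
  have m: "h P (t0 - pi) > 0" using h_antipodal[of P "t0 - pi"] t0 by simp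
  have q: "h P (t0 + pi) > 0" using h_antipodal[of P t0] t0 by simp
  obtain z where z: "t0 - pi \<le> z" "z \<le> t0" "h P z = 0"
    using IVT2[of "h P" t0 0 "t0 - pi"] m t0 cont by auto
  obtain y where y: "t0 \<le> y" "y \<le> t0 + pi" "h P y = 0"
    using IVT[of "h P" t0 0 "t0 + pi"] q t0 cont by auto
  have zs: "t0 - pi < z" "z < t0" using z m t0 by (auto simp: order_le_less)
  have ys: "t0 < y" "y < t0 + pi" using y q t0 by (auto simp: order_le_less)
  have "0 > h1 P z * sin (t0 - z)" using h_sturm(1)[of "t0 - z" P z] zs z(3) t0 by auto
  then have hz: "h1 P z < 0" using sin_gt_zero[of "t0 - z"] zs by (smt (verit) mult_nonneg_nonneg)
  have "0 > - h1 P y * sin (y - t0)" using h_sturm(2)[of "y - t0" P y] ys y(3) t0 by auto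
  then have hy: "h1 P y > 0" using sin_gt_zero[of "y - t0"] ys by (smt (verit) mult_nonneg_nonneg)
  \<comment> \<open>The two zeros are less than \<open>pi\<close> apart: at distance exactly
    \<open>pi\<close> an antipodal sum would vanish, and farther apart the ascending zero
    \<open>y\<close> would force positivity at \<open>z + 2*pi\<close>, which is a zero.\<close>
  have "y \<noteq> z + pi" using h_antipodal[of P z] z(3) y(3) by auto
  moreover have "\<not> y > z + pi"
  proof
    assume "y > z + pi"
    then have "h P (y + (z + 2*pi - y)) > h1 P y * sin (z + 2*pi - y)"
      using h_sturm(1)[of "z + 2*pi - y" P y] ys zs y(3) by auto
    moreover have "h P (y + (z + 2*pi - y)) = 0" using h_period1[of P z] z(3) by simp
    moreover have "sin (z + 2*pi - y) > 0" using \<open>y > z + pi\<close> ys zs by (intro sin_gt_zero) auto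
    ultimately show False using hy by (smt (verit) mult_pos_pos)
  qed
  ultimately show thesis using that[of z "y - z"] z y hz hy zs ys by auto
qed

section \<open>The boundary parametrized by its outer normal angle\<close>

definition gam :: "real \<Rightarrow> real^2" where "gam x = p x *\<^sub>R nvec x + p1 x *\<^sub>R tvec x"

lemma gam_inner: "gam x \<bullet> nvec (x + d) = p x * cos d + p1 x * sin d"
  "gam x \<bullet> tvec (x + d) = p1 x * cos d - p x * sin d"
  by (auto simp: gam_def frame_inner inner_add_left)

lemma gam_inner0: "gam x \<bullet> nvec x = p x" "gam x \<bullet> tvec x = p1 x"
  using gam_inner[of x 0] by auto

lemma gam_periodic: "gam (x + 2 * pi * of_int k) = gam x"
  by (simp add: gam_def per_int nvec_periodic tvec_periodic)

lemma gam_le: "gam x \<bullet> nvec t \<le> p t"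
proof -
  obtain d k where dk: "0 \<le> d" "d < 2*pi" "t = x + d + 2 * pi * of_int k"
    using angle_reduce[where a = x and t = t] by blast
  have "gam x \<bullet> nvec (x + d) \<le> p (x + d)"
    using tangent_line_less[of d x] dk gam_inner(1)[of x d] by (cases "d = 0") auto
  then show ?thesis using dk by (simp add: nvec_periodic per_int)
qed

lemma gam_in: "gam x \<in> K"
  using gam_le by (simp add: mem_iff)

lemma gam_less:
  assumes "0 < d" "d < 2*pi" shows "gam x \<bullet> nvec (x + d) < p (x + d)"
  using tangent_line_less[OF assms, of x] gam_inner(1)[of x d] by simp

text \<open>At a contact point \<open>h x\<close> attains its minimum 0 at \<open>t\<close>, so its
  slope vanishes there; value and slope are the two coordinates in the frame at angle
  \<open>t\<close>.\<close>

lemma gam_unique: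
  assumes "x \<in> K" "x \<bullet> nvec t = p t" shows "x = gam t"
proof -
  have "h x s \<ge> h x t" for s using supp_ge[OF assms(1)] assms(2) by (simp add: h_def)
  then have "h1 x t = 0"
    using DERIV_local_min[of "h x" "h1 x t" t 1] h_deriv(1) by auto
  then show ?thesis
    using frame_expand[of x t] assms(2) by (simp add: h1_def gam_def)
qed

text \<open>A point of \<open>K\<close> off the curve has positive distance \<open>h x t\<close>
  from every support line; the minimum over a period is the radius of a ball inside
  \<open>K\<close>. Conversely, a boundary point leaves \<open>K\<close> when moved along its outer
  normal.\<close>

lemma frontier_K: "frontier K = range gam"
proof
  show "range gam \<subseteq> frontier K"
  proof safe
    fix t
    have "gam t \<notin> interior K"
    proof
      assume "gam t \<in> interior K"
      then obtain e where e: "e > 0" "cball (gam t) e \<subseteq> K" by (meson mem_interior_cball)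
      have "gam t + e *\<^sub>R nvec t \<in> cball (gam t) e" using e(1) by (simp add: dist_norm)
      then have "(gam t + e *\<^sub>R nvec t) \<bullet> nvec t \<le> p t" using e supp_ge by blast
      then show False using e(1) by (simp add: inner_add_left gam_inner0 frame_inner)
    qed
    then show "gam t \<in> frontier K" using gam_in by (simp add: frontier_def closure_subset[THEN subsetD])
  qed
  show "frontier K \<subseteq> range gam"
  proof
    fix x assume x: "x \<in> frontier K"
    have xK: "x \<in> K" using x compact by (simp add: frontier_closed compact_imp_closed frontier_def)
    show "x \<in> range gam"
    proof (rule ccontr)
      assume neg: "x \<notin> range gam"
      then have gt: "h x t > 0" for t
        using gam_unique[OF xK, of t] supp_ge[OF xK, of t] by (auto simp: h_def order_le_less)
      have "\<exists>t\<in>{0..2*pi}. \<forall>s\<in>{0..2*pi}. h x t \<le> h x s"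
        by (intro continuous_attains_inf) (auto intro!: DERIV_continuous_on[OF h_deriv(1)[THEN DERIV_subset]])
      then obtain t where t: "\<And>s. s \<in> {0..2*pi} \<Longrightarrow> h x t \<le> h x s" by blast
      have t': "h x t \<le> h x s" for s
      proof -
        obtain d k where dk: "0 \<le> d" "d < 2*pi" "s = 0 + d + 2 * pi * of_int k"
    using angle_reduce[where a = 0 and t = s] by blast
        then show ?thesis using t[of d] by (simp add: h_period)
      qed
      have "ball x (h x t) \<subseteq> K"
      proof
        fix y assume y: "y \<in> ball x (h x t)"
        have "y \<bullet> nvec s \<le> p s" for s
        proof -
          have "(y - x) \<bullet> nvec s \<le> norm (y - x) * norm (nvec s)" by (rule norm_cauchy_schwarz)
          then show ?thesis using y t'[of s] by (simp add: dist_norm norm_minus_commute inner_diff_left h_def)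
        qed
        then show "y \<in> K" by (simp add: mem_iff)
      qed
      then have "x \<in> interior K" using gt by (meson centre_in_ball interior_maximal open_ball subset_iff)
      then show False using x by (simp add: frontier_def)
    qed
  qed
qed

section \<open>Tangent angles as coordinates on the exterior\<close>

definition chart :: "real \<Rightarrow> real \<Rightarrow> real^2" where
  "chart x \<phi> = gam x + (N1 x \<phi> / sin \<phi>) *\<^sub>R tvec x"

lemma h_tangent: "h (gam x + s *\<^sub>R tvec x) x = 0" "h1 (gam x + s *\<^sub>R tvec x) x = - s"
  by (simp_all add: h_def h1_def inner_add_left gam_inner0 frame_inner)

lemma chart_zeros:
  assumes "0 < \<phi>" "\<phi> < pi"
  shows "h (chart x \<phi>) x = 0" "h1 (chart x \<phi>) x = - (N1 x \<phi> / sin \<phi>)"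
    "h (chart x \<phi>) (x + \<phi>) = 0" "h1 (chart x \<phi>) (x + \<phi>) = N2 x \<phi> / sin \<phi>"
proof -
  have s: "sin \<phi> > 0" using assms by (rule sin_gt_zero)
  show "h (chart x \<phi>) x = 0" "h1 (chart x \<phi>) x = - (N1 x \<phi> / sin \<phi>)"
    unfolding chart_def by (rule h_tangent)+
  show "h (chart x \<phi>) (x + \<phi>) = 0"
    using s by (simp add: chart_def h_def inner_add_left gam_inner frame_inner N1_def)
  have "sin \<phi> * h1 (chart x \<phi>) (x + \<phi>) =
     p1 (x + \<phi>) * sin \<phi> + p x * (sin \<phi> * sin \<phi> + cos \<phi> * cos \<phi>) - p (x + \<phi>) * cos \<phi>"
  proof -
    have "h1 (chart x \<phi>) (x + \<phi>) = p1 (x + \<phi>) - (p1 x * cos \<phi> - p x * sin \<phi>) - N1 x \<phi> / sin \<phi> * cos \<phi>"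
      by (simp add: chart_def h1_def inner_add_left gam_inner frame_inner)
    then have "sin \<phi> * h1 (chart x \<phi>) (x + \<phi>) = sin \<phi> * (p1 (x + \<phi>) - (p1 x * cos \<phi> - p x * sin \<phi>)) - N1 x \<phi> * cos \<phi>"
      using s by (simp add: right_diff_distrib)
    also have "\<dots> = p1 (x + \<phi>) * sin \<phi> + p x * (sin \<phi> * sin \<phi> + cos \<phi> * cos \<phi>) - p (x + \<phi>) * cos \<phi>"
      unfolding N1_def by algebra
    finally show ?thesis .
  qed
  also have "\<dots> = N2 x \<phi>"
    using sin_cos_squared_add[of \<phi>] unfolding power2_eq_square by (simp add: N2_def)
  finally show "h1 (chart x \<phi>) (x + \<phi>) = N2 x \<phi> / sin \<phi>" using s by (simp add: field_simps)
qed

lemma chart_signs: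
  assumes "0 < \<phi>" "\<phi> < pi"
  shows "h1 (chart x \<phi>) x < 0" "h1 (chart x \<phi>) (x + \<phi>) > 0"
  using chart_zeros[OF assms, of x] sin_gt_zero[OF assms] N1_pos[of \<phi> x] N2_pos[of \<phi> x] assms by auto

lemma not_in_K: "h P x = 0 \<Longrightarrow> h1 P x \<noteq> 0 \<Longrightarrow> P \<notin> K"
  using gam_unique[of P x] by (auto simp: h_def h1_def gam_inner0)

lemma point_eq_tangent:
  assumes "h P x = 0" shows "P = gam x + (- h1 P x) *\<^sub>R tvec x"
  using frame_expand[of P x] assms by (simp add: h_def h1_def gam_def algebra_simps)

lemma point_eq_chart:
  assumes "h P x = 0" "h P (x + \<phi>) = 0" "0 < \<phi>" "\<phi> < pi"
  shows "P = chart x \<phi>"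
proof -
  have s: "sin \<phi> > 0" using assms by (intro sin_gt_zero)
  have P: "P = gam x + (- h1 P x) *\<^sub>R tvec x" by (rule point_eq_tangent[OF assms(1)])
  have "h P (x + \<phi>) = N1 x \<phi> + h1 P x * sin \<phi>"
    by (subst P) (simp add: h_def inner_add_left inner_diff_left gam_inner frame_inner N1_def)
  then have "- h1 P x = N1 x \<phi> / sin \<phi>" using assms(2) s by (simp add: field_simps)
  then show ?thesis using P by (simp add: chart_def)
qed

text \<open>The first angle is the descending zero of \<open>h P\<close>, unique up to the period;
  the second is then the only other zero.\<close>

lemma chart_inj:
  assumes "0 < \<phi>" "\<phi> < pi" "0 < \<phi>'" "\<phi>' < pi" "a \<le> x" "x < a + 2*pi" "a \<le> y" "y < a + 2*pi"
    and eq: "chart x \<phi> = chart y \<phi>'"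
  shows "x = y \<and> \<phi> = \<phi>'"
proof -
  define P where "P = chart x \<phi>"
  have x: "h P x = 0" "h1 P x < 0" "h P (x + \<phi>) = 0" "h1 P (x + \<phi>) > 0"
    using chart_zeros[OF assms(1,2)] chart_signs[OF assms(1,2)] by (auto simp: P_def)
  have y: "h P y = 0" "h1 P y < 0" "h P (y + \<phi>') = 0" "h1 P (y + \<phi>') > 0"
    using chart_zeros[OF assms(3,4)] chart_signs[OF assms(3,4)] by (auto simp: P_def eq)
  have xy: "x = y" using descending_unique[OF x(1,2) y(1,2)] shift_eq_iff assms by blast
  obtain k where "y + \<phi>' = x + 2 * pi * of_int k \<or> y + \<phi>' = x + \<phi> + 2 * pi * of_int k"
    using zeros_only[OF x(1,2) assms(1,2) x(3,4) y(3)] by blast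
  then have "\<phi>' = 0 + 2 * pi * of_int k \<or> \<phi>' = \<phi> + 2 * pi * of_int k" using xy by auto
  then have "0 = \<phi>' \<or> \<phi> = \<phi>'"
    using shift_eq_iff[of 0 0 \<phi>' k] shift_eq_iff[of 0 \<phi> \<phi>' k] assms by auto
  then show ?thesis using xy assms by auto
qed

lemma chart_surj:
  assumes "P \<notin> K"
  obtains x \<phi> where "a \<le> x" "x < a + 2*pi" "0 < \<phi>" "\<phi> < pi" "P = chart x \<phi>"
proof -
  obtain z \<phi> where z: "h P z = 0" "h1 P z < 0" "0 < \<phi>" "\<phi> < pi" "h P (z + \<phi>) = 0" "h1 P (z + \<phi>) > 0"
    using exterior_zeros[OF assms] by blast
  obtain d k where dk: "0 \<le> d" "d < 2*pi" "z = a + d + 2 * pi * of_int k"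
    using angle_reduce[where a = a and t = z] by blast
  have "h P (a + d) = 0" using z(1) dk by (simp add: h_period)
  moreover have "h P (a + d + \<phi>) = 0"
    using z(5) dk h_period(1)[of P "a + d + \<phi>" k] by (simp add: algebra_simps)
  ultimately have "P = chart (a + d) \<phi>" using point_eq_chart z by blast
  then show thesis using that[of "a + d" \<phi>] dk z by auto
qed

lemma chart_notin: "0 < \<phi> \<Longrightarrow> \<phi> < pi \<Longrightarrow> chart x \<phi> \<notin> K"
  using not_in_K[OF chart_zeros(1), of \<phi> x] chart_signs(1)[of \<phi> x] by auto

text \<open>With positive parameter a tangent ray has slope \<open>h1 P x = - s < 0\<close>, so
  \<open>x\<close> is the descending zero of its point. Hence the forward tangent rays never cross,
  which is what the area computation needs.\<close>

lemma tangent_inj: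
  assumes "0 < s" "0 < s'" "a \<le> x" "x < a + 2*pi" "a \<le> y" "y < a + 2*pi"
    and eq: "gam x + s *\<^sub>R tvec x = gam y + s' *\<^sub>R tvec y"
  shows "x = y \<and> s = s'"
proof -
  define P where "P = gam x + s *\<^sub>R tvec x"
  have x: "h P x = 0" "h1 P x = - s" using h_tangent[of x s] by (auto simp: P_def)
  have y: "h P y = 0" "h1 P y = - s'" using h_tangent[of y s'] by (auto simp: P_def eq)
  have "x = y" using descending_unique[of P x y] x y shift_eq_iff assms by fastforce
  then show ?thesis using x y by auto
qed

text \<open>A supporting line through \<open>P\<close> has a normal proportional to some
  \<open>nvec t\<close>, and touching \<open>K\<close> means \<open>h P t = 0\<close>. The zeros are
  already classified, and each support line meets \<open>K\<close> in one point.\<close>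

lemma tangent_points_chart:
  assumes \<phi>: "0 < \<phi>" "\<phi> < pi"
  shows "tangent_points K (chart x \<phi>) = {gam x, gam (x + \<phi>)}"
proof
  define P where "P = chart x \<phi>"
  have x: "h P x = 0" "h1 P x < 0" "h P (x + \<phi>) = 0" "h1 P (x + \<phi>) > 0"
    using chart_zeros[OF \<phi>] chart_signs[OF \<phi>] by (auto simp: P_def)
  show "{gam x, gam (x + \<phi>)} \<subseteq> tangent_points K (chart x \<phi>)"
  proof -
    have "gam t \<in> tangent_points K P" if "h P t = 0" for t
    proof -
      have "P \<bullet> nvec t = p t" using that by (simp add: h_def)
      then have "nvec t \<bullet> gam t = nvec t \<bullet> P" "\<forall>y\<in>K. nvec t \<bullet> y \<le> nvec t \<bullet> P"
        using gam_inner0(1)[of t] supp_ge[of _ t] by (simp_all add: inner_commute[of "nvec t"])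
      then show ?thesis unfolding tangent_points_def
        using frontier_K by (auto intro!: exI[of _ "nvec t"])
    qed
    then show ?thesis using x by (auto simp: P_def)
  qed
  show "tangent_points K (chart x \<phi>) \<subseteq> {gam x, gam (x + \<phi>)}"
  proof
    fix y assume "y \<in> tangent_points K (chart x \<phi>)"
    then obtain u where u: "y \<in> frontier K" "u \<noteq> 0" "u \<bullet> y = u \<bullet> P" "\<And>y. y \<in> K \<Longrightarrow> u \<bullet> y \<le> u \<bullet> P"
      unfolding tangent_points_def P_def by blast
    obtain r t where rt: "r > 0" "u = r *\<^sub>R nvec t" using polar_nvec u(2) by blast
    have yK: "y \<in> K" using u(1) frontier_K gam_in by auto
    have e: "y \<bullet> nvec t = P \<bullet> nvec t" using u(3) rt by (simp add: inner_commute)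
    have "p t \<le> P \<bullet> nvec t"
      using u(4) rt by (intro supp_le) (simp add: inner_commute)
    then have "y \<bullet> nvec t = p t" "h P t = 0" using e supp_ge[OF yK, of t] by (auto simp: h_def)
    then have "y = gam t" using gam_unique yK by blast
    then show "y \<in> {gam x, gam (x + \<phi>)}"
      using zeros_only[OF x(1,2) \<phi> x(3,4) \<open>h P t = 0\<close>] gam_periodic by auto
  qed
qed

text \<open>From \<open>P\<close> the contact points lie in the directions \<open>- tvec x\<close>
  and \<open>tvec (x + \<phi>)\<close>, whose inner product is \<open>- cos \<phi>\<close>. Symmetry
  of the angle makes the definite description independent of the order of the two points.\<close>

lemma visual_angle_chart:
  assumes \<phi>: "0 < \<phi>" "\<phi> < pi"
  shows "visual_angle K (chart x \<phi>) = pi - \<phi>"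
proof -
  define P where "P = chart x \<phi>"
  define s1 s2 where "s1 = N1 x \<phi> / sin \<phi>" and "s2 = N2 x \<phi> / sin \<phi>"
  have s: "s1 > 0" "s2 > 0"
    using sin_gt_zero[OF \<phi>] N1_pos[of \<phi> x] N2_pos[of \<phi> x] \<phi> by (auto simp: s1_def s2_def)
  have 1: "gam x - P = - (s1 *\<^sub>R tvec x)" by (simp add: P_def chart_def s1_def)
  have 2: "gam (x + \<phi>) - P = s2 *\<^sub>R tvec (x + \<phi>)"
    using point_eq_tangent[of P "x + \<phi>"] chart_zeros[OF \<phi>, of x] by (simp add: P_def s2_def)
  have ang: "angle_at P (gam x) (gam (x + \<phi>)) = pi - \<phi>"
  proof -
    have "angle_at P (gam x) (gam (x + \<phi>)) = arccos (- cos \<phi>)"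
      unfolding angle_at_def 1 2 using s by (simp add: frame_inner)
    also have "\<dots> = pi - \<phi>" using \<phi> by (simp add: arccos_minus arccos_cos)
    finally show ?thesis .
  qed
  have ang': "angle_at P (gam (x + \<phi>)) (gam x) = pi - \<phi>"
    using ang by (simp add: angle_at_def inner_commute mult.commute)
  have ne: "gam x \<noteq> gam (x + \<phi>)"
    using gam_less[of \<phi> x] gam_inner0(1)[of "x + \<phi>"] \<phi> by auto
  have tp: "tangent_points K P = {gam x, gam (x + \<phi>)}"
    unfolding P_def by (rule tangent_points_chart[OF \<phi>])
  show ?thesis unfolding visual_angle_def P_def[symmetric] tp
  proof (rule the_equality)
    show "\<exists>xa y. xa \<noteq> y \<and> {gam x, gam (x + \<phi>)} = {xa, y} \<and> pi - \<phi> = angle_at P xa y"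
      using ne ang by (intro exI[of _ "gam x"] exI[of _ "gam (x + \<phi>)"]) simp
    show "\<omega> = pi - \<phi>" if "\<exists>xa y. xa \<noteq> y \<and> {gam x, gam (x + \<phi>)} = {xa, y} \<and> \<omega> = angle_at P xa y" for \<omega>
      using that ang ang' by (auto simp: doubleton_eq_iff)
  qed
qed

lemma width_pos: "p t + p (t + pi) > 0"
  using tangent_line_less[of pi t] by simp

end

lemma C2_body:
  assumes "C2_strictly_convex K"
  shows "body (supp_fun K) (deriv (supp_fun K)) (deriv (deriv (supp_fun K))) K"
proof -
  define p where "p = supp_fun K"
  have a: "K \<noteq> {}" "compact K" "convex K" "C2_fun p" "\<And>t. p t + deriv (deriv p) t > 0"
    using assms by (auto simp: C2_strictly_convex_def p_def)
  have *: "(f has_field_derivative deriv f t) (at t)" "continuous_on UNIV (deriv f)"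
    if f: "f C1_differentiable_on UNIV" for f :: "real \<Rightarrow> real" and t
  proof -
    obtain D where D: "\<And>x. (f has_field_derivative D x) (at x)" "continuous_on UNIV D"
      using f by (auto simp: C1_differentiable_on_def has_real_derivative_iff_has_vector_derivative)
    have "deriv f = D" using D(1) by (auto intro!: DERIV_imp_deriv)
    then show "(f has_field_derivative deriv f t) (at t)" "continuous_on UNIV (deriv f)" using D by auto
  qed
  have C1: "p C1_differentiable_on UNIV" "deriv p C1_differentiable_on UNIV"
    using a(4) by (auto simp: C2_fun_def)
  show ?thesis unfolding p_def[symmetric]
  proof unfold_locales
    show "p (t + 2*pi) = p t" for t
      unfolding p_def supp_fun_def using nvec_periodic[of t 1] by simp
  qed (rule *(1)[OF C1(1)] *(1)[OF C1(2)] *(2)[OF C1(2)] a p_def)+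
qed

section \<open>The autocorrelation of the support function\<close>

definition angle_fun :: "real \<Rightarrow> real" where
  "angle_fun \<omega> = \<omega> - 2 * sin \<omega> + sin (2 * \<omega>) - 1/4 * sin (4 * \<omega>) - (sin \<omega>) ^ 3"

definition angle_fun1 :: "real \<Rightarrow> real" where
  "angle_fun1 \<omega> = 1 - 2 * cos \<omega> + 2 * cos (2 * \<omega>) - cos (4 * \<omega>) - 3 * (sin \<omega>)^2 * cos \<omega>"

definition angle_fun2 :: "real \<Rightarrow> real" where
  "angle_fun2 \<omega> = 2 * sin \<omega> - 4 * sin (2 * \<omega>) + 4 * sin (4 * \<omega>) - 6 * sin \<omega> * (cos \<omega>)^2 + 3 * (sin \<omega>) ^ 3"

text \<open>The quotient \<open>angle_fun2 (pi - \<phi>) / sin \<phi>\<close>. That this is a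
  trigonometric polynomial, with no frequency 1 and with 3 as its only odd frequency, is what
  singles out the third harmonic.\<close>

definition angle_kernel :: "real \<Rightarrow> real" where
  "angle_kernel \<phi> = 1/2 - 9/2 * cos (2 * \<phi>) - 8 * cos (3 * \<phi>)"

lemma angle_fun_deriv: "(angle_fun has_field_derivative angle_fun1 \<omega>) (at \<omega>)"
  unfolding angle_fun_def[abs_def] angle_fun1_def by (auto intro!: derivative_eq_intros)

lemma angle_fun1_deriv: "(angle_fun1 has_field_derivative angle_fun2 \<omega>) (at \<omega>)"
  unfolding angle_fun1_def[abs_def] angle_fun2_def
  by (auto intro!: derivative_eq_intros) (simp add: power2_eq_square power3_eq_cube)

lemma cos_multiple:
  fixes x :: real
  shows "cos (2 * x) = 2 * (cos x)^2 - 1" "cos (3 * x) = 4 * (cos x)^3 - 3 * cos x"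
    "cos (4 * x) = 8 * (cos x)^4 - 8 * (cos x)^2 + 1"
    "sin (2 * x) = 2 * sin x * cos x" "sin (4 * x) = sin x * (8 * (cos x)^3 - 4 * cos x)"
proof -
  show 2: "cos (2 * x) = 2 * (cos x)^2 - 1" by (rule cos_double_cos)
  show s: "sin (2 * x) = 2 * sin x * cos x" by (rule sin_double)
  show "cos (3 * x) = 4 * (cos x)^3 - 3 * cos x" by (rule cos_treble_cos)
  have "cos (4 * x) = 2 * (cos (2 * x))^2 - 1" using cos_double_cos[of "2 * x"] by simp
  then show "cos (4 * x) = 8 * (cos x)^4 - 8 * (cos x)^2 + 1" unfolding 2 by algebra
  have "sin (4 * x) = 2 * sin (2 * x) * cos (2 * x)" using sin_double[of "2 * x"] by simp
  then show "sin (4 * x) = sin x * (8 * (cos x)^3 - 4 * cos x)" unfolding 2 s by algebra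
qed

lemma angle_fun2_eq: "angle_fun2 (pi - \<phi>) = sin \<phi> * angle_kernel \<phi>"
proof -
  have s: "(sin \<phi>) ^ 3 = sin \<phi> * (1 - (cos \<phi>)^2)"
    unfolding cos_squared_eq by (simp add: power2_eq_square power3_eq_cube)
  show ?thesis
    unfolding angle_fun2_def angle_kernel_def cos_multiple[of \<phi>] cos_multiple[of "pi - \<phi>"] sin_pi_minus cos_pi_minus s
    by algebra
qed

text \<open>The factor \<open>1 - cos \<omega>\<close> exhibits the double zero of the first
  derivative at 0, hence the triple zero of \<open>angle_fun\<close>.\<close>

lemma angle_fun1_eq: "angle_fun1 \<omega> = (1 - cos \<omega>) * (8 * (cos \<omega>)^3 + 5 * (cos \<omega>)^2 - 7 * cos \<omega> - 2)"
  unfolding angle_fun1_def cos_multiple sin_squared_eq by algebra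

lemma angle_fun1_bound: "\<bar>angle_fun1 \<omega>\<bar> \<le> 22 * (1 - cos \<omega>)"
proof -
  have c: "\<bar>cos \<omega>\<bar> \<le> 1" by simp
  have "\<bar>cos \<omega>\<bar>^2 \<le> 1" "\<bar>cos \<omega>\<bar>^3 \<le> 1" using c power_le_one by (metis abs_ge_zero)+
  \<comment> \<open>22 = 8 + 5 + 7 + 2, the sum of the absolute values of the coefficients.\<close>
  then have "\<bar>8 * (cos \<omega>)^3 + 5 * (cos \<omega>)^2 - 7 * cos \<omega> - 2\<bar> \<le> 22"
    using c unfolding power_abs[symmetric] by linarith
  then have "(1 - cos \<omega>) * \<bar>8 * (cos \<omega>)^3 + 5 * (cos \<omega>)^2 - 7 * cos \<omega> - 2\<bar> \<le> (1 - cos \<omega>) * 22"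
    by (intro mult_left_mono) auto
  then show ?thesis unfolding angle_fun1_eq by (simp add: abs_mult)
qed

text \<open>The derivative \<open>22 * (1 - cos \<omega>)\<close> of the right side dominates that
  of \<open>angle_fun\<close> in absolute value, and everything vanishes at 0. This is the cubic
  decay in explicit form.\<close>

lemma angle_fun_bound: assumes "\<omega> \<ge> 0" shows "\<bar>angle_fun \<omega>\<bar> \<le> 22 * (\<omega> - sin \<omega>)"
proof -
  have "22 * (0 - sin 0) - angle_fun 0 \<le> 22 * (\<omega> - sin \<omega>) - angle_fun \<omega>"
    by (rule DERIV_nonneg_imp_nondecreasing[OF assms])
       (auto intro!: derivative_eq_intros angle_fun_deriv exI, use angle_fun1_bound in \<open>smt (verit)\<close>)
  moreover have "22 * (0 - sin 0) + angle_fun 0 \<le> 22 * (\<omega> - sin \<omega>) + angle_fun \<omega>"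
    by (rule DERIV_nonneg_imp_nondecreasing[OF assms])
       (auto intro!: derivative_eq_intros angle_fun_deriv exI, use angle_fun1_bound in \<open>smt (verit)\<close>)
  ultimately show ?thesis by (simp add: angle_fun_def abs_le_iff)
qed

lemma angle_fun_tendsto: "((\<lambda>\<phi>. angle_fun (pi - \<phi>) / (sin \<phi>)^2) \<longlongrightarrow> 0) (at_left pi)"
  and angle_fun1_tendsto: "((\<lambda>\<phi>. angle_fun1 (pi - \<phi>) / sin \<phi>) \<longlongrightarrow> 0) (at_left pi)"
proof -
  have lim: "filterlim (\<lambda>\<phi>. pi - \<phi>) (at_right 0) (at_left pi)"
    unfolding filterlim_at by (auto intro!: tendsto_eq_intros simp: eventually_at_filter)
  have "((\<lambda>\<omega>. angle_fun \<omega> / (sin \<omega>)^2) \<longlongrightarrow> 0) (at_right 0)"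
    unfolding angle_fun_def by real_asymp
  from filterlim_compose[OF this lim] show "((\<lambda>\<phi>. angle_fun (pi - \<phi>) / (sin \<phi>)^2) \<longlongrightarrow> 0) (at_left pi)" by simp
  have "((\<lambda>\<omega>. angle_fun1 \<omega> / sin \<omega>) \<longlongrightarrow> 0) (at_right 0)"
    unfolding angle_fun1_def by real_asymp
  from filterlim_compose[OF this lim] show "((\<lambda>\<phi>. angle_fun1 (pi - \<phi>) / sin \<phi>) \<longlongrightarrow> 0) (at_left pi)" by simp
qed

lemma integral_reflect_Icc:
  fixes f :: "real \<Rightarrow> real"
  shows "integral {0..a} (\<lambda>t. f (a - t)) = integral {0..a} f"
proof -
  have "integral {0..a} (\<lambda>t. f (a - t)) = integral {-a..-0} (\<lambda>t. f (a + t))"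
    using Henstock_Kurzweil_Integration.integral_reflect_real[of a 0 "\<lambda>t. f (a - t)"] by simp
  also have "\<dots> = integral {0..a} f"
    using integral_shift_Icc_real[of "-a" 0 f a] by (simp add: o_def)
  finally show ?thesis .
qed

lemma cont_tendsto: "continuous_on UNIV (f :: real \<Rightarrow> real) \<Longrightarrow> (f \<longlongrightarrow> f x) (at x within A)"
  by (meson UNIV_I continuous_on_def tendsto_within_subset top_greatest)

section \<open>Autocorrelation, the inner integral of the Jacobian and integration by parts\<close>

context convex_support
begin

definition area_integral where "area_integral = 1/2 * circ (\<lambda>x. (p x)^2 - (p1 x)^2)"
definition perim where "perim = circ p"

definition corr :: "real \<Rightarrow> real" where "corr \<phi> = circ (\<lambda>x. p x * p (x + \<phi>))"
definition corr1 :: "real \<Rightarrow> real" where "corr1 \<phi> = circ (\<lambda>x. p x * p1 (x + \<phi>))"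
definition corr2 :: "real \<Rightarrow> real" where "corr2 \<phi> = circ (\<lambda>x. p x * p2 (x + \<phi>))"

lemma p_cont': "continuous_on A f \<Longrightarrow> continuous_on A (\<lambda>x. p (f x))"
  and p1_cont': "continuous_on A f \<Longrightarrow> continuous_on A (\<lambda>x. p1 (f x))"
  and p2_cont': "continuous_on A f \<Longrightarrow> continuous_on A (\<lambda>x. p2 (f x))"
  by (auto intro: continuous_on_compose2[OF p_cont[of UNIV]] continuous_on_compose2[OF p1_cont[of UNIV]]
      continuous_on_compose2[OF p2_cont])

lemmas p_conts = p_cont' p1_cont' p2_cont'

lemma corr_deriv: "(corr has_field_derivative corr1 \<phi>) (at \<phi>)"
proof -
  have "((\<lambda>\<phi>. integral (cbox 0 (2*pi)) (\<lambda>x. p x * p (x + \<phi>))) has_field_derivative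
     integral (cbox 0 (2*pi)) (\<lambda>x. p x * p1 (x + \<phi>))) (at \<phi> within UNIV)"
    by (rule leibniz_rule_field_derivative)
       (auto simp: case_prod_unfold intro!: derivative_eq_intros p[THEN DERIV_chain2] integrable_cont
        continuous_intros p_conts)
  then show ?thesis by (simp add: corr_def[abs_def] corr1_def)
qed

lemma corr1_deriv: "(corr1 has_field_derivative corr2 \<phi>) (at \<phi>)"
proof -
  have "((\<lambda>\<phi>. integral (cbox 0 (2*pi)) (\<lambda>x. p x * p1 (x + \<phi>))) has_field_derivative
     integral (cbox 0 (2*pi)) (\<lambda>x. p x * p2 (x + \<phi>))) (at \<phi> within UNIV)"
    by (rule leibniz_rule_field_derivative)
       (auto simp: case_prod_unfold intro!: derivative_eq_intros p1[THEN DERIV_chain2] integrable_cont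
        continuous_intros p_conts)
  then show ?thesis by (simp add: corr1_def[abs_def] corr2_def)
qed

lemma corr_cont: "continuous_on A corr" and corr1_cont: "continuous_on A corr1"
  by (meson corr_deriv corr1_deriv DERIV_isCont continuous_at_imp_continuous_on)+

lemma corr2_cont: "continuous_on UNIV corr2"
proof -
  have "isCont corr2 \<phi>" for \<phi>
  proof -
    have "continuous_on {\<phi>-1..\<phi>+1} (\<lambda>\<phi>. integral (cbox 0 (2*pi)) (\<lambda>x. p x * p2 (x + \<phi>)))"
      by (intro integral_continuous_on_param) (auto simp: case_prod_unfold intro!: continuous_intros p_conts)
    then have "continuous_on {\<phi>-1..\<phi>+1} corr2" by (simp add: corr2_def[abs_def])
    then show ?thesis
      by (rule continuous_on_interior) simp
  qed
  then show ?thesis by (simp add: continuous_at_imp_continuous_on)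
qed

lemma p_2pi: "p (2*pi) = p 0" "p1 (2*pi) = p1 0" "p (2*pi + t) = p t" "p1 (2*pi + t) = p1 t"
  using per[of 0] per1[of 0] per[of t] per1[of t] by (auto simp: add.commute)

lemma integral_p_p1: "circ (\<lambda>x. p x * p1 x) = 0"
proof -
  have "((\<lambda>x. p x * p1 x) has_integral (p (2*pi))^2/2 - (p 0)^2/2) {0..2*pi}"
    by (intro ftc) (auto intro!: derivative_eq_intros p)
  then show ?thesis by (simp add: p_2pi integral_unique)
qed

lemma integral_p1_p: "circ (\<lambda>x. p1 x * p (x + \<phi>)) = - corr1 \<phi>"
proof -
  have "((\<lambda>x. p1 x * p (x + \<phi>) + p x * p1 (x + \<phi>)) has_integral p (2*pi) * p (2*pi + \<phi>) - p 0 * p (0 + \<phi>)) {0..2*pi}"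
    by (intro ftc) (auto intro!: derivative_eq_intros p p[THEN DERIV_chain2])
  then have "circ (\<lambda>x. p1 x * p (x + \<phi>) + p x * p1 (x + \<phi>)) = 0" by (simp add: p_2pi integral_unique)
  then show ?thesis
    by (subst (asm) hk_add)
       (auto simp: corr1_def intro!: integrable_cont continuous_intros p_conts)
qed

lemma integral_p1_p1: "circ (\<lambda>x. p1 x * p1 (x + \<phi>)) = - corr2 \<phi>"
proof -
  have "((\<lambda>x. p1 x * p1 (x + \<phi>) + p x * p2 (x + \<phi>)) has_integral p (2*pi) * p1 (2*pi + \<phi>) - p 0 * p1 (0 + \<phi>)) {0..2*pi}"
    by (intro ftc) (auto intro!: derivative_eq_intros p p1[THEN DERIV_chain2])
  then have "circ (\<lambda>x. p1 x * p1 (x + \<phi>) + p x * p2 (x + \<phi>)) = 0" by (simp add: p_2pi integral_unique)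
  then show ?thesis
    by (subst (asm) hk_add)
       (auto simp: corr2_def intro!: integrable_cont continuous_intros p_conts)
qed

lemma integral_shift_p_sq:
  assumes "0 \<le> \<phi>" "\<phi> \<le> 2*pi" shows "circ (\<lambda>x. (p (x + \<phi>))^2) = corr 0"
proof -
  have "continuous_on UNIV (\<lambda>x. (p x)^2)" by (intro continuous_intros p_conts)
  from periodic_shift_integral[OF this _ assms] show ?thesis
    by (simp add: per corr_def power2_eq_square)
qed

lemma integral_shift_p_p1:
  assumes "0 \<le> \<phi>" "\<phi> \<le> 2*pi" shows "circ (\<lambda>x. p (x + \<phi>) * p1 (x + \<phi>)) = 0"
proof -
  have "continuous_on UNIV (\<lambda>x. p x * p1 x)" by (intro continuous_intros p_conts)
  from periodic_shift_integral[OF this _ assms] show ?thesis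
    by (simp add: per per1 integral_p_p1)
qed

definition numer :: "real \<Rightarrow> real" where
  "numer \<phi> = (1 + (cos \<phi>)^2) * corr \<phi> - 2 * cos \<phi> * corr 0 - 2 * sin \<phi> * cos \<phi> * corr1 \<phi> + (sin \<phi>)^2 * corr2 \<phi>"

text \<open>Expanding the product leaves nine correlations of \<open>p\<close> and
  \<open>p'\<close>. Those at the same angle reduce to \<open>corr 0\<close> or to the vanishing
  integral of \<open>p p'\<close>; those at different angles become \<open>corr\<close> and its
  derivatives after integration by parts over the period.\<close>

lemma integral_N1_N2:
  assumes "0 \<le> \<phi>" "\<phi> \<le> 2*pi"
  shows "((\<lambda>x. N1 x \<phi> * N2 x \<phi>) has_integral numer \<phi>) {0..2*pi}"
proof -
  have i: "(f has_integral J) {0..2*pi}" if "continuous_on UNIV f" "circ f = J" for f :: "real \<Rightarrow> real" and J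
    using integrable_integral[OF integrable_cont[OF that(1)]] that(2) by auto
  have a: "((\<lambda>x. p x * p (x + \<phi>)) has_integral corr \<phi>) {0..2*pi}"
    "((\<lambda>x. (p (x + \<phi>))^2) has_integral corr 0) {0..2*pi}"
    "((\<lambda>x. p (x + \<phi>) * p1 (x + \<phi>)) has_integral 0) {0..2*pi}"
    "((\<lambda>x. (p x)^2) has_integral corr 0) {0..2*pi}"
    "((\<lambda>x. p x * p1 (x + \<phi>)) has_integral corr1 \<phi>) {0..2*pi}"
    "((\<lambda>x. p x * p1 x) has_integral 0) {0..2*pi}"
    "((\<lambda>x. p1 x * p (x + \<phi>)) has_integral - corr1 \<phi>) {0..2*pi}"
    "((\<lambda>x. p1 x * p1 (x + \<phi>)) has_integral - corr2 \<phi>) {0..2*pi}"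
    using integral_shift_p_sq[OF assms] integral_shift_p_p1[OF assms] integral_shift_p_sq[of 0]
      integral_p_p1 integral_p1_p[of \<phi>] integral_p1_p1[of \<phi>]
    by (intro i continuous_intros p_conts; simp add: corr_def[of \<phi>] corr1_def)+
  have "((\<lambda>x. p x * p (x + \<phi>) - cos \<phi> * (p (x + \<phi>))^2 + sin \<phi> * (p (x + \<phi>) * p1 (x + \<phi>))
      - cos \<phi> * (p x)^2 + (cos \<phi>)^2 * (p x * p (x + \<phi>)) - cos \<phi> * sin \<phi> * (p x * p1 (x + \<phi>))
      - sin \<phi> * (p x * p1 x) + sin \<phi> * cos \<phi> * (p1 x * p (x + \<phi>)) - (sin \<phi>)^2 * (p1 x * p1 (x + \<phi>)))
     has_integral
      corr \<phi> - cos \<phi> * corr 0 + sin \<phi> * 0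
      - cos \<phi> * corr 0 + (cos \<phi>)^2 * corr \<phi> - cos \<phi> * sin \<phi> * corr1 \<phi>
      - sin \<phi> * 0 + sin \<phi> * cos \<phi> * (- corr1 \<phi>) - (sin \<phi>)^2 * (- corr2 \<phi>)) {0..2*pi}" (is "(?f has_integral ?v) _")
    by (intro has_integral_add has_integral_diff has_integral_mult_right a)
  moreover have "(\<lambda>x. N1 x \<phi> * N2 x \<phi>) = ?f"
    unfolding N1_def N2_def power2_eq_square by (rule ext) algebra
  moreover have "numer \<phi> = ?v"
    unfolding numer_def by algebra
  ultimately show ?thesis by simp
qed

definition D0 :: "real \<Rightarrow> real" where "D0 \<phi> = corr \<phi> - corr 0 * cos \<phi>"
definition D1 :: "real \<Rightarrow> real" where "D1 \<phi> = corr1 \<phi> * sin \<phi> - corr \<phi> * cos \<phi> + corr 0"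

text \<open>With \<open>E = D0 / sin\<close> one has \<open>E' = D1 / sin^2\<close> and \<open>E'' = numer / sin^3\<close>, and \<open>Phi\<close> collects the boundary terms
  of two integrations by parts of \<open>angle_fun (pi - \<phi>) * E'' \<phi>\<close>.\<close>

definition Phi :: "real \<Rightarrow> real" where
  "Phi \<phi> = angle_fun (pi - \<phi>) / (sin \<phi>)^2 * D1 \<phi> + angle_fun1 (pi - \<phi>) / sin \<phi> * D0 \<phi>"

lemma D0_deriv: "(D0 has_field_derivative corr1 \<phi> + corr 0 * sin \<phi>) (at \<phi>)"
  unfolding D0_def[abs_def] by (auto intro!: derivative_eq_intros corr_deriv)

lemma D1_deriv: "(D1 has_field_derivative sin \<phi> * (corr2 \<phi> + corr \<phi>)) (at \<phi>)"
  unfolding D1_def[abs_def] by (auto intro!: derivative_eq_intros corr_deriv corr1_deriv simp: algebra_simps)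

text \<open>The terms with \<open>angle_fun1\<close> cancel because
  \<open>sin * D0' - cos * D0 = D1\<close>. What remains is the integrand with \<open>numer\<close>
  and, from differentiating \<open>angle_fun1\<close>, the kernel times \<open>D0\<close>.\<close>

lemma Phi_deriv:
  assumes "0 < \<phi>" "\<phi> < pi"
  shows "(Phi has_field_derivative angle_fun (pi - \<phi>) * numer \<phi> / (sin \<phi>)^3 - angle_kernel \<phi> * D0 \<phi>) (at \<phi>)"
proof -
  have s: "sin \<phi> \<noteq> 0" using sin_gt_zero[OF assms] by simp
  have d: "((\<lambda>\<phi>. pi - \<phi>) has_field_derivative -1) (at \<phi>)" by (auto intro!: derivative_eq_intros)
  have v: "((\<lambda>\<phi>. angle_fun (pi - \<phi>)) has_field_derivative - angle_fun1 (pi - \<phi>)) (at \<phi>)"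
    "((\<lambda>\<phi>. angle_fun1 (pi - \<phi>)) has_field_derivative - angle_fun2 (pi - \<phi>)) (at \<phi>)"
    using DERIV_chain2[OF angle_fun_deriv d] DERIV_chain2[OF angle_fun1_deriv d] by simp_all
  define c S where "c = cos \<phi>" and "S = sin \<phi>"
  have cs: "c * c = 1 - S * S" using sin_cos_squared_add3[of \<phi>] by (simp add: c_def S_def algebra_simps)
  have sq: "((\<lambda>\<phi>. (sin \<phi>)^2) has_field_derivative 2 * S * c) (at \<phi>)"
    by (auto intro!: derivative_eq_intros simp: c_def S_def)
  define E where "E = (- angle_fun1 (pi - \<phi>) * S^2 - angle_fun (pi - \<phi>) * (2 * S * c)) / (S^2 * S^2) * D1 \<phi>
     + (S * (corr2 \<phi> + corr \<phi>)) * (angle_fun (pi - \<phi>) / S^2)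
     + ((- angle_fun2 (pi - \<phi>) * S - angle_fun1 (pi - \<phi>) * c) / (S * S) * D0 \<phi> + (corr1 \<phi> + corr 0 * S) * (angle_fun1 (pi - \<phi>) / S))"
  have "(Phi has_field_derivative E) (at \<phi>)"
    unfolding Phi_def[abs_def] E_def S_def c_def
    by (intro DERIV_add DERIV_mult DERIV_divide v sq[unfolded S_def c_def] D0_deriv D1_deriv DERIV_sin) (use s in auto)
  moreover have "E = angle_fun (pi - \<phi>) * numer \<phi> / S^3 - angle_kernel \<phi> * D0 \<phi>"
  proof -
    have S: "S \<noteq> 0" using s by (simp add: S_def)
    have "E = (angle_fun (pi - \<phi>) * (S^2 * (corr2 \<phi> + corr \<phi>) - 2 * c * D1 \<phi>)
        + angle_fun1 (pi - \<phi>) * S * (S * (corr1 \<phi> + corr 0 * S) - c * D0 \<phi> - D1 \<phi>)) / S^3 - angle_fun2 (pi - \<phi>) / S * D0 \<phi>"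
      unfolding E_def using S by (simp add: divide_simps power2_eq_square power3_eq_cube) algebra
    also have "S * (corr1 \<phi> + corr 0 * S) - c * D0 \<phi> - D1 \<phi> = 0"
      unfolding D0_def D1_def c_def[symmetric] S_def[symmetric] using cs by algebra
    also have "S^2 * (corr2 \<phi> + corr \<phi>) - 2 * c * D1 \<phi> = numer \<phi>"
      unfolding numer_def D1_def c_def[symmetric] S_def[symmetric] using cs by algebra
    also have "angle_fun2 (pi - \<phi>) / S = angle_kernel \<phi>" using S by (simp add: angle_fun2_eq S_def)
    finally show ?thesis by simp
  qed
  ultimately show ?thesis by (simp add: S_def)
qed

lemma corr1_0: "corr1 0 = 0"
  using integral_p_p1 by (simp add: corr1_def)

lemma D0_cont: "continuous_on A D0" and D1_cont: "continuous_on A D1"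
  by (meson D0_deriv D1_deriv DERIV_isCont continuous_at_imp_continuous_on)+

lemma angle_fun_cont: "continuous_on A angle_fun" and angle_fun1_cont: "continuous_on A angle_fun1"
  by (meson angle_fun_deriv angle_fun1_deriv DERIV_isCont continuous_at_imp_continuous_on)+

text \<open>By l'Hopital \<open>D1 / sin^2\<close> tends to half of \<open>corr 0 + corr2 0\<close>
  while \<open>D0 / sin\<close> tends to 0, since \<open>corr1 0 = 0\<close>. With
  \<open>angle_fun pi = pi\<close> the limit is \<open>pi * area_integral\<close>, the area term of
  the final formula.\<close>

lemma Phi_left: "(Phi \<longlongrightarrow> pi * (corr 0 + corr2 0) / 2) (at_right 0)"
proof -
  have ev: "eventually (\<lambda>\<phi>. 0 < sin \<phi> \<and> 0 < cos \<phi>) (at_right (0::real))"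
    unfolding eventually_at_right[OF pi_half_gt_zero]
    by (auto intro!: exI[of _ "pi/2"] sin_gt_zero cos_gt_zero)
  have "((\<lambda>\<phi>. D1 \<phi> / (sin \<phi>)^2) \<longlongrightarrow> (corr 0 + corr2 0) / 2) (at_right 0)"
  proof (rule lhopital_right)
    show "(D1 \<longlongrightarrow> 0) (at_right 0)"
      using cont_tendsto[OF D1_cont, of 0] by (simp add: D1_def)
    show "((\<lambda>\<phi>. (sin \<phi>)^2) \<longlongrightarrow> 0) (at_right (0::real))"
      by (auto intro!: tendsto_eq_intros)
    show "eventually (\<lambda>\<phi>. (sin \<phi>)^2 \<noteq> 0) (at_right (0::real))"
      using ev by eventually_elim auto
    show "eventually (\<lambda>\<phi>. 2 * sin \<phi> * cos \<phi> \<noteq> 0) (at_right (0::real))"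
      using ev by eventually_elim auto
    show "eventually (\<lambda>\<phi>. (D1 has_field_derivative sin \<phi> * (corr2 \<phi> + corr \<phi>)) (at \<phi>)) (at_right 0)"
      using D1_deriv by simp
    show "eventually (\<lambda>\<phi>. ((\<lambda>\<phi>. (sin \<phi>)^2) has_field_derivative 2 * sin \<phi> * cos \<phi>) (at \<phi>)) (at_right (0::real))"
      by (auto intro!: derivative_eq_intros always_eventually)
    have "((\<lambda>\<phi>. (corr2 \<phi> + corr \<phi>) / (2 * cos \<phi>)) \<longlongrightarrow> (corr 0 + corr2 0) / 2) (at_right 0)"
      by (auto intro!: tendsto_eq_intros cont_tendsto[OF corr2_cont] cont_tendsto[OF corr_cont])
    then show "((\<lambda>\<phi>. sin \<phi> * (corr2 \<phi> + corr \<phi>) / (2 * sin \<phi> * cos \<phi>)) \<longlongrightarrow> (corr 0 + corr2 0) / 2) (at_right 0)"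
      by (rule Lim_transform_eventually) (use ev in eventually_elim, auto)
  qed
  then have 1: "((\<lambda>\<phi>. angle_fun (pi - \<phi>) * (D1 \<phi> / (sin \<phi>)^2)) \<longlongrightarrow> angle_fun (pi - 0) * ((corr 0 + corr2 0) / 2)) (at_right 0)"
    by (intro tendsto_mult cont_tendsto continuous_on_compose2[OF angle_fun_cont[of UNIV]] continuous_intros) auto
  have "((\<lambda>\<phi>. D0 \<phi> / sin \<phi>) \<longlongrightarrow> 0) (at_right 0)"
  proof (rule lhopital_right)
    show "(D0 \<longlongrightarrow> 0) (at_right 0)"
      using cont_tendsto[OF D0_cont, of 0] by (simp add: D0_def)
    show "(sin \<longlongrightarrow> 0) (at_right (0::real))"
      by (auto intro!: tendsto_eq_intros)
    show "eventually (\<lambda>\<phi>. sin \<phi> \<noteq> 0) (at_right (0::real))" "eventually (\<lambda>\<phi>. cos \<phi> \<noteq> 0) (at_right (0::real))"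
      using ev by (eventually_elim; auto)+
    show "eventually (\<lambda>\<phi>. (D0 has_field_derivative corr1 \<phi> + corr 0 * sin \<phi>) (at \<phi>)) (at_right 0)"
      using D0_deriv by simp
    show "eventually (\<lambda>\<phi>. (sin has_field_derivative cos \<phi>) (at \<phi>)) (at_right (0::real))"
      by (auto intro!: derivative_eq_intros always_eventually)
    show "((\<lambda>\<phi>. (corr1 \<phi> + corr 0 * sin \<phi>) / cos \<phi>) \<longlongrightarrow> 0) (at_right 0)"
      by (auto intro!: tendsto_eq_intros cont_tendsto[OF corr1_cont] simp: corr1_0)
  qed
  then have 2: "((\<lambda>\<phi>. angle_fun1 (pi - \<phi>) * (D0 \<phi> / sin \<phi>)) \<longlongrightarrow> angle_fun1 (pi - 0) * 0) (at_right 0)"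
    by (intro tendsto_mult cont_tendsto continuous_on_compose2[OF angle_fun1_cont[of UNIV]] continuous_intros) auto
  have "sin (4 * pi) = 0" using sin_npi[of 4] by simp
  then have "angle_fun pi = pi" by (simp add: angle_fun_def)
  then show ?thesis using tendsto_add[OF 1 2] by (simp add: Phi_def[abs_def])
qed

text \<open>Here \<open>D0\<close> and \<open>D1\<close> are merely bounded; the limit is 0 because
  \<open>angle_fun\<close> has a triple zero against \<open>sin^2\<close> and
  \<open>angle_fun1\<close> a double zero against \<open>sin\<close>.\<close>

lemma Phi_right: "(Phi \<longlongrightarrow> 0) (at_left pi)"
proof -
  have "(Phi \<longlongrightarrow> 0 * D1 pi + 0 * D0 pi) (at_left pi)"
    unfolding Phi_def[abs_def]
    by (intro tendsto_add tendsto_mult angle_fun_tendsto angle_fun1_tendsto cont_tendsto D0_cont D1_cont)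
  then show ?thesis by simp
qed

lemma has_integral_angle_fun_numer:
  "((\<lambda>\<phi>. angle_fun (pi - \<phi>) * numer \<phi> / (sin \<phi>)^3) has_integral
     integral {0..pi} (\<lambda>\<phi>. angle_kernel \<phi> * D0 \<phi>) - pi * (corr 0 + corr2 0) / 2) {0..pi}"
proof -
  \<comment> \<open>\<open>Phi\<close> divides by \<open>sin \<phi>\<close>, so its values at both
    ends are replaced by its limits. The fundamental theorem for a function continuous on the closed
    and differentiable on the open interval then also delivers integrability of the singular
    integrand.\<close>
  define Psi where "Psi = (\<lambda>\<phi>. if \<phi> = 0 then pi * (corr 0 + corr2 0) / 2 else if \<phi> = pi then 0 else Phi \<phi>)"
  have r: "eventually (\<lambda>y. Phi y = Psi y) (at_right 0)"
    unfolding eventually_at_right[OF pi_gt_zero] by (auto simp: Psi_def intro!: exI[of _ pi])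
  have l: "eventually (\<lambda>y. Phi y = Psi y) (at_left pi)"
    unfolding eventually_at_left[OF pi_gt_zero] by (auto simp: Psi_def intro!: exI[of _ 0])
  have cont: "continuous_on {0..pi} Psi"
  proof (rule continuous_on_IccI)
    show "(Psi \<longlongrightarrow> Psi 0) (at_right 0)"
      using Lim_transform_eventually[OF Phi_left r] by (simp add: Psi_def)
    show "(Psi \<longlongrightarrow> Psi pi) (at_left pi)"
      using Lim_transform_eventually[OF Phi_right l] by (simp add: Psi_def)
    fix x assume x: "0 < x" "x < pi"
    have "Phi \<midarrow>x\<rightarrow> Phi x" using DERIV_isCont[OF Phi_deriv[OF x]] by (simp add: isCont_def)
    moreover have "eventually (\<lambda>y. Phi y = Psi y) (at x)"
      using eventually_at_in_open'[of "{0<..<pi}" x] x by (auto elim!: eventually_mono simp: Psi_def)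
    ultimately show "Psi \<midarrow>x\<rightarrow> Psi x"
      using Lim_transform_eventually[of Phi "Phi x" "at x" Psi] x by (simp add: Psi_def)
  qed simp
  have "((\<lambda>\<phi>. angle_fun (pi - \<phi>) * numer \<phi> / (sin \<phi>)^3 - angle_kernel \<phi> * D0 \<phi>) has_integral Psi pi - Psi 0) {0..pi}"
  proof (rule fundamental_theorem_of_calculus_interior[OF _ cont])
    fix x assume x: "x \<in> {0<..<pi}"
    have "(Psi has_field_derivative angle_fun (pi - x) * numer x / (sin x)^3 - angle_kernel x * D0 x) (at x)"
      using Phi_deriv[of x] x
      by (rule_tac has_field_derivative_transform_within_open[of Phi _ _ "{0<..<pi}"]) (auto simp: Psi_def)
    then show "(Psi has_vector_derivative angle_fun (pi - x) * numer x / (sin x)^3 - angle_kernel x * D0 x) (at x)"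
      by (simp add: has_real_derivative_iff_has_vector_derivative)
  qed simp
  moreover have "((\<lambda>\<phi>. angle_kernel \<phi> * D0 \<phi>) has_integral integral {0..pi} (\<lambda>\<phi>. angle_kernel \<phi> * D0 \<phi>)) {0..pi}"
    unfolding angle_kernel_def by (intro integrable_integral integrable_cont continuous_intros D0_cont)
  ultimately have "((\<lambda>\<phi>. angle_fun (pi - \<phi>) * numer \<phi> / (sin \<phi>)^3 - angle_kernel \<phi> * D0 \<phi> + angle_kernel \<phi> * D0 \<phi>) has_integral
     (Psi pi - Psi 0) + integral {0..pi} (\<lambda>\<phi>. angle_kernel \<phi> * D0 \<phi>)) {0..pi}"
    by (rule has_integral_add)
  then show ?thesis by (simp add: Psi_def algebra_simps)
qed

text \<open>Products with \<open>cos\<close> again have integer frequencies, and the only one with a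
  mean on \<open>[0, pi]\<close> would be frequency 1 in the kernel, which is absent. This removes
  the term \<open>corr 0 * cos \<phi>\<close> of \<open>D0\<close>.\<close>

lemma integral_angle_kernel_cos: "integral {0..pi} (\<lambda>\<phi>. angle_kernel \<phi> * cos \<phi>) = 0"
proof -
  have "((\<lambda>\<phi>. angle_kernel \<phi> * cos \<phi>) has_integral
     (1/2 * sin pi - 9/4 * (sin (3 * pi) / 3 + sin pi) - 4 * (sin (4 * pi) / 4 + sin (2 * pi) / 2)) -
     (1/2 * sin 0 - 9/4 * (sin (3 * 0) / 3 + sin 0) - 4 * (sin (4 * 0) / 4 + sin (2 * 0) / 2))) {0..pi}"
  proof (rule fundamental_theorem_of_calculus)
    fix x :: real
    have "((\<lambda>x. 1/2 * sin x - 9/4 * (sin (3 * x) / 3 + sin x) - 4 * (sin (4 * x) / 4 + sin (2 * x) / 2))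
       has_field_derivative 1/2 * cos x - 9/4 * (cos (3 * x) + cos x) - 4 * (cos (4 * x) + cos (2 * x))) (at x)"
      by (auto intro!: derivative_eq_intros)
    moreover have "1/2 * cos x - 9/4 * (cos (3 * x) + cos x) - 4 * (cos (4 * x) + cos (2 * x)) = angle_kernel x * cos x"
      unfolding angle_kernel_def cos_multiple by algebra
    ultimately show "((\<lambda>x. 1/2 * sin x - 9/4 * (sin (3 * x) / 3 + sin x) - 4 * (sin (4 * x) / 4 + sin (2 * x) / 2))
       has_vector_derivative angle_kernel x * cos x) (at x within {0..pi})"
      by (simp add: has_real_derivative_iff_has_vector_derivative[symmetric] has_field_derivative_at_within)
  qed simp
  moreover have "sin (3 * pi) = 0" "sin (4 * pi) = 0" using sin_npi[of 3] sin_npi[of 4] by simp_all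
  ultimately show ?thesis by (simp add: integral_unique)
qed

lemma corr2_0: "corr2 0 = - circ (\<lambda>x. (p1 x)^2)"
  using integral_p1_p1[of 0] by (simp add: power2_eq_square)

end

section \<open>Consequences of constant width for the autocorrelation\<close>

locale constant_width_support = convex_support +
  fixes w
  assumes width: "p t + p (t + pi) = w"
begin

text \<open>Barbier's theorem, by averaging the width over a period.\<close>

lemma width_eq: "w = perim / pi"
proof -
  have "circ (\<lambda>t. p (t + pi)) = circ p"
    by (rule periodic_shift_integral) (auto intro: p_cont per)
  moreover have "circ (\<lambda>t. p t + p (t + pi)) = circ p + circ (\<lambda>t. p (t + pi))"
    by (intro hk_add integrable_cont continuous_intros p_conts)
  moreover have "circ (\<lambda>t. p t + p (t + pi)) = 2 * pi * w" by (simp add: width)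
  ultimately show ?thesis by (simp add: perim_def field_simps)
qed

lemma corr_neg:
  assumes "0 \<le> \<phi>" "\<phi> \<le> 2*pi" shows "corr (- \<phi>) = corr \<phi>"
proof -
  have "continuous_on UNIV (\<lambda>x. p x * p (x - \<phi>))" by (intro continuous_intros p_conts)
  moreover have "p (t + 2*pi) * p (t + 2*pi - \<phi>) = p t * p (t - \<phi>)" for t
    using per[of t] per[of "t - \<phi>"] by (simp add: algebra_simps)
  ultimately show ?thesis
    using periodic_shift_integral[of "\<lambda>x. p x * p (x - \<phi>)" \<phi>] assms
    by (simp add: corr_def mult.commute)
qed

lemma corr_per: "corr (\<phi> + 2*pi) = corr \<phi>"
  by (simp add: corr_def per add.assoc[symmetric])

lemma corr_reflect:
  assumes "0 \<le> \<phi>" "\<phi> \<le> 2*pi" shows "corr (2*pi - \<phi>) = corr \<phi>"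
  using corr_neg[OF assms] corr_per[of "-\<phi>"] by simp

lemma corr_half_turn: "corr (\<phi> + pi) = perim^2 / pi - corr \<phi>"
proof -
  have "p (x + (\<phi> + pi)) = w - p (x + \<phi>)" for x using width[of "x + \<phi>"] by (simp add: add.assoc)
  then have "p x * p (x + (\<phi> + pi)) = w * p x - p x * p (x + \<phi>)" for x
    by (simp add: right_diff_distrib mult.commute)
  then have "corr (\<phi> + pi) = circ (\<lambda>x. w * p x - p x * p (x + \<phi>))"
    by (simp only: corr_def)
  also have "\<dots> = circ (\<lambda>x. w * p x) - corr \<phi>"
    unfolding corr_def by (intro hk_diff integrable_cont continuous_intros p_conts)
  finally show ?thesis by (simp add: width_eq perim_def power2_eq_square)
qed

lemma corr_supplement:
  assumes "0 \<le> \<phi>" "\<phi> \<le> 2*pi" shows "corr (pi - \<phi>) = perim^2 / pi - corr \<phi>"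
  using corr_half_turn[of "-\<phi>"] corr_neg[OF assms] by simp

text \<open>Reflection at \<open>pi/2\<close> fixes this part of the kernel and sends
  \<open>corr\<close> to its complement in \<open>perim^2 / pi\<close>. So the integral is half of
  that of the kernel part times this constant, whatever \<open>corr\<close> is.\<close>

lemma integral_even_corr:
  "integral {0..pi} (\<lambda>\<phi>. (1/2 - 9/2 * cos (2 * \<phi>)) * corr \<phi>) = perim^2 / 4"
proof -
  define X where "X = integral {0..pi} (\<lambda>\<phi>. (1/2 - 9/2 * cos (2 * \<phi>)) * corr \<phi>)"
  define c where "c = perim^2 / pi"
  have "X = integral {0..pi} (\<lambda>\<phi>. (1/2 - 9/2 * cos (2 * (pi - \<phi>))) * corr (pi - \<phi>))"
    using integral_reflect_Icc[of pi "\<lambda>\<phi>. (1/2 - 9/2 * cos (2 * \<phi>)) * corr \<phi>"] by (simp add: X_def)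
  also have "\<dots> = integral {0..pi} (\<lambda>\<phi>. (1/2 - 9/2 * cos (2 * \<phi>)) * c - (1/2 - 9/2 * cos (2 * \<phi>)) * corr \<phi>)"
  proof (rule hk_cong)
    fix \<phi> assume \<phi>: "\<phi> \<in> {0..pi}"
    have "corr (pi - \<phi>) = c - corr \<phi>"
      unfolding c_def by (rule corr_supplement) (use \<phi> pi_gt_zero in \<open>auto simp del: pi_gt_zero\<close>)
    moreover have "cos (2 * (pi - \<phi>)) = cos (2 * \<phi>)" unfolding cos_multiple by simp
    ultimately show "(1/2 - 9/2 * cos (2 * (pi - \<phi>))) * corr (pi - \<phi>) =
       (1/2 - 9/2 * cos (2 * \<phi>)) * c - (1/2 - 9/2 * cos (2 * \<phi>)) * corr \<phi>"
      by (simp only: right_diff_distrib)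
  qed
  also have "\<dots> = integral {0..pi} (\<lambda>\<phi>. (1/2 - 9/2 * cos (2 * \<phi>)) * c) - X"
    unfolding X_def by (intro hk_diff integrable_cont continuous_intros corr_cont)
  also have "integral {0..pi} (\<lambda>\<phi>. (1/2 - 9/2 * cos (2 * \<phi>)) * c) = pi / 2 * c"
  proof -
    have "((\<lambda>\<phi>. (1/2 - 9/2 * cos (2 * \<phi>)) * c) has_integral
      (pi/2 - 9/4 * sin (2 * pi)) * c - (0/2 - 9/4 * sin (2 * 0)) * c) {0..pi}"
      by (intro ftc) (auto intro!: derivative_eq_intros)
    then have "((\<lambda>\<phi>. (1/2 - 9/2 * cos (2 * \<phi>)) * c) has_integral pi / 2 * c) {0..pi}" by simp
    then show ?thesis by (rule integral_unique)
  qed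
  finally have "2 * X = pi / 2 * c" by simp
  then show ?thesis by (simp add: X_def c_def)
qed

text \<open>Correlation theorem: exchanging the integrals and shifting the inner one by
  \<open>x\<close> turns the third coefficient of the autocorrelation into the squared third
  amplitude of \<open>p\<close>.\<close>

lemma integral_cos3_corr_full:
  "circ (\<lambda>\<phi>. cos (3 * \<phi>) * corr \<phi>) = pi * energy p 3"
proof -
  have "circ (\<lambda>\<phi>. cos (3 * \<phi>) * corr \<phi>) =
     circ (\<lambda>\<phi>. circ (\<lambda>x. cos (3 * \<phi>) * (p x * p (x + \<phi>))))"
    by (simp add: corr_def)
  also have "\<dots> = circ (\<lambda>x. circ (\<lambda>\<phi>. cos (3 * \<phi>) * (p x * p (x + \<phi>))))"
    using integral_swap_continuous[of 0 0 "2*pi" "2*pi" "\<lambda>\<phi> x. cos (3 * \<phi>) * (p x * p (x + \<phi>))"]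
    by (simp add: case_prod_unfold continuous_intros p_conts)
  also have "\<dots> = circ (\<lambda>x. fcos p 3 * (p x * cos (real 3 * x)) + fsin p 3 * (p x * sin (real 3 * x)))"
  proof (rule hk_cong)
    fix x :: real assume x: "x \<in> {0..2*pi}"
    have c: "continuous_on UNIV (\<lambda>u. cos (3 * (u - x)) * p u)" by (intro continuous_intros p_conts)
    have per3: "cos (3 * (u + 2*pi - x)) = cos (3 * (u - x))" for u
      using cos_multiple(2)[of "u - x"] cos_multiple(2)[of "u + 2*pi - x"] cos_periodic[of "u - x"]
      by (simp add: algebra_simps)
    have "circ (\<lambda>\<phi>. cos (3 * \<phi>) * (p x * p (x + \<phi>))) =
       p x * circ (\<lambda>\<phi>. cos (3 * (\<phi> + x - x)) * p (\<phi> + x))"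
      by (simp add: mult_ac add.commute flip: integral_mult_right)
    also have "circ (\<lambda>\<phi>. cos (3 * (\<phi> + x - x)) * p (\<phi> + x)) = circ (\<lambda>u. cos (3 * (u - x)) * p u)"
      by (rule periodic_shift_integral[OF c]) (use x per per3 in auto)
    also have "\<dots> = circ (\<lambda>u. cos (3 * x) * (p u * cos (real 3 * u)) + sin (3 * x) * (p u * sin (real 3 * u)))"
      by (simp add: right_diff_distrib cos_diff algebra_simps)
    also have "\<dots> = cos (3 * x) * fcos p 3 + sin (3 * x) * fsin p 3"
      unfolding fcos_def fsin_def
      by (subst hk_add)
         (auto intro!: integrable_cont continuous_intros p_conts)
    finally show "circ (\<lambda>\<phi>. cos (3 * \<phi>) * (p x * p (x + \<phi>))) =
       fcos p 3 * (p x * cos (real 3 * x)) + fsin p 3 * (p x * sin (real 3 * x))"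
      by (simp add: algebra_simps)
  qed
  also have "\<dots> = fcos p 3 * fcos p 3 + fsin p 3 * fsin p 3"
    by (subst hk_add)
       (auto intro!: integrable_cont continuous_intros p_conts simp: fcos_def fsin_def)
  finally show ?thesis by (simp add: energy_def power2_eq_square)
qed

text \<open>Both factors are symmetric about \<open>pi\<close>, so the half period carries half of
  the integral.\<close>

lemma integral_cos3_corr:
  "integral {0..pi} (\<lambda>\<phi>. cos (3 * \<phi>) * corr \<phi>) = pi * energy p 3 / 2"
proof -
  define f where "f = (\<lambda>\<phi>. cos (3 * \<phi>) * corr \<phi>)"
  have fc: "continuous_on UNIV f" unfolding f_def by (intro continuous_intros corr_cont)
  have "circ f = integral {0..pi} f + integral {pi..2*pi} f"
    by (intro hk_combine[symmetric] integrable_cont fc) auto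
  also have "integral {pi..2*pi} f = integral {0..pi} (\<lambda>\<phi>. f (pi + \<phi>))"
    using integral_shift_Icc_real[of 0 pi f pi] by (simp add: o_def)
  also have "\<dots> = integral {0..pi} (\<lambda>\<phi>. f (pi + (pi - \<phi>)))"
    using integral_reflect_Icc[of pi "\<lambda>\<phi>. f (pi + \<phi>)"] by simp
  also have "\<dots> = integral {0..pi} f"
  proof (rule hk_cong)
    fix \<phi> assume \<phi>: "\<phi> \<in> {0..pi}"
    have "corr (2*pi - \<phi>) = corr \<phi>" by (rule corr_reflect) (use \<phi> pi_gt_zero in \<open>auto simp del: pi_gt_zero\<close>)
    moreover have "cos (3 * (2*pi - \<phi>)) = cos (3 * \<phi>)" unfolding cos_multiple by (simp add: cos_diff)
    moreover have "pi + (pi - \<phi>) = 2*pi - \<phi>" by simp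
    ultimately show "f (pi + (pi - \<phi>)) = f \<phi>" unfolding f_def by simp
  qed
  finally show ?thesis using integral_cos3_corr_full by (simp add: f_def)
qed

lemma integral_angle_kernel_D0:
  "integral {0..pi} (\<lambda>\<phi>. angle_kernel \<phi> * D0 \<phi>) = perim^2 / 4 - 4 * pi * energy p 3"
proof -
  have "integral {0..pi} (\<lambda>\<phi>. angle_kernel \<phi> * D0 \<phi>) =
     integral {0..pi} (\<lambda>\<phi>. (1/2 - 9/2 * cos (2 * \<phi>)) * corr \<phi> - 8 * (cos (3 * \<phi>) * corr \<phi>) - corr 0 * (angle_kernel \<phi> * cos \<phi>))"
    unfolding angle_kernel_def D0_def by (rule hk_cong) algebra
  also have "\<dots> = integral {0..pi} (\<lambda>\<phi>. (1/2 - 9/2 * cos (2 * \<phi>)) * corr \<phi>)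
     - 8 * integral {0..pi} (\<lambda>\<phi>. cos (3 * \<phi>) * corr \<phi>) - corr 0 * integral {0..pi} (\<lambda>\<phi>. angle_kernel \<phi> * cos \<phi>)"
    unfolding angle_kernel_def
    by (subst hk_diff,
        (intro integrable_cont continuous_intros corr_cont)+)+ simp
  finally show ?thesis unfolding integral_even_corr integral_cos3_corr integral_angle_kernel_cos by simp
qed

theorem has_integral_angle_fun:
  "((\<lambda>\<phi>. angle_fun (pi - \<phi>) * numer \<phi> / (sin \<phi>)^3) has_integral
     perim^2 / 4 - 4 * pi * energy p 3 - pi * area_integral) {0..pi}"
proof -
  have "circ (\<lambda>x. (p x)^2 - (p1 x)^2) = corr 0 + corr2 0"
    unfolding corr2_0 corr_def
    by (subst hk_diff)
       (auto intro!: integrable_cont continuous_intros p_conts simp: power2_eq_square)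
  then show ?thesis using has_integral_angle_fun_numer by (simp add: integral_angle_kernel_D0 area_integral_def)
qed

end

section \<open>Fubini on the plane\<close>

lemma vec2_continuous: "continuous_on UNIV (\<lambda>(x::real, y::real). vector [x, y] :: real^2)"
  unfolding case_prod_unfold
  by (subst continuous_on_componentwise) (auto simp: Basis_vec_def UNIV_2 inner_axis intro!: continuous_intros)

lemma vec2_measurable: "(\<lambda>(x::real, y::real). vector [x, y] :: real^2) \<in> borel_measurable borel"
  by (rule borel_measurable_continuous_onI[OF vec2_continuous])

text \<open>Lebesgue measure is determined by its values on boxes. The identification carries Fubini
  from pairs over to \<open>real^2\<close>, where change of variables is stated.\<close>

lemma lborel_vec2:
  "distr (lborel :: (real \<times> real) measure) borel (\<lambda>(x, y). vector [x, y] :: real^2) = lborel"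
proof (rule lborel_eqI[symmetric])
  show "sets (distr (lborel :: (real \<times> real) measure) borel (\<lambda>(x, y). vector [x, y] :: real^2)) = sets borel" by simp
  fix l u :: "real^2" assume le: "\<And>b. b \<in> Basis \<Longrightarrow> l \<bullet> b \<le> u \<bullet> b"
  have lu: "l $ i \<le> u $ i" for i
    using le[of "axis i 1"] by (auto simp: inner_axis axis_in_Basis_iff)
  have box: "(\<lambda>(x, y). vector [x, y] :: real^2) -` box l u = {l $ 1<..<u $ 1} \<times> {l $ 2<..<u $ 2}"
    by (auto simp: box_def Basis_vec_def UNIV_2 inner_axis)
  have "axis 1 1 \<noteq> (axis 2 1 :: real^2)" by (simp add: axis_eq_axis)
  then have prod: "(\<Prod>b\<in>Basis. (u - l) \<bullet> b) = (u $ 1 - l $ 1) * (u $ 2 - l $ 2)"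
    by (simp add: Basis_vec_def UNIV_2 inner_axis)
  have "emeasure (distr (lborel :: (real \<times> real) measure) borel (\<lambda>(x, y). vector [x, y] :: real^2)) (box l u) =
     emeasure (lborel \<Otimes>\<^sub>M lborel) ({l $ 1<..<u $ 1} \<times> {l $ 2<..<u $ 2})"
    unfolding box[symmetric] lborel_prod
    by (subst emeasure_distr) (use vec2_measurable in auto)
  also have "\<dots> = ennreal ((u $ 1 - l $ 1) * (u $ 2 - l $ 2))"
    using lu by (subst lborel.emeasure_pair_measure_Times) (auto simp: ennreal_mult)
  finally show "emeasure (distr (lborel :: (real \<times> real) measure) borel (\<lambda>(x, y). vector [x, y] :: real^2)) (box l u) = (\<Prod>b\<in>Basis. (u - l) \<bullet> b)"
    unfolding prod .
qed

text \<open>Boundedness and measurability are assumed instead of continuity, because the area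
  computation uses a truncated integrand. Both orders of integration are given: the visual angle
  integral is done over the position angle first, the area over the tangent segment first.\<close>

lemma integral_rectangle:
  fixes f :: "real \<times> real \<Rightarrow> real"
  assumes A: "A \<in> sets borel" "emeasure lborel A < \<infinity>" and B: "B \<in> sets borel" "emeasure lborel B < \<infinity>"
    and meas: "(\<lambda>z. indicator (A \<times> B) z * f z) \<in> borel_measurable borel"
    and bound: "\<And>x y. x \<in> A \<Longrightarrow> y \<in> B \<Longrightarrow> \<bar>f (x, y)\<bar> \<le> C"
    and S_def: "S = {v :: real^2. v $ 1 \<in> A \<and> v $ 2 \<in> B}"
  shows "S \<in> sets borel" "(\<lambda>v. f (v $ 1, v $ 2)) absolutely_integrable_on S"
    "integral S (\<lambda>v. f (v $ 1, v $ 2)) = integral B (\<lambda>y. integral A (\<lambda>x. f (x, y)))"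
    "integral S (\<lambda>v. f (v $ 1, v $ 2)) = integral A (\<lambda>x. integral B (\<lambda>y. f (x, y)))"
proof -
  define h where "h = (\<lambda>z. indicator (A \<times> B) z * f z)"
  have hm [measurable]: "h \<in> borel_measurable (lborel \<Otimes>\<^sub>M lborel)" using meas by (simp add: h_def lborel_prod)
  have [measurable]: "A \<in> sets borel" "B \<in> sets borel" using A B by auto
  have AB: "A \<times> B \<in> sets (borel :: (real \<times> real) measure)" by (simp flip: borel_prod)
  have proj: "(\<lambda>v :: real^2. (v $ 1, v $ 2)) \<in> borel_measurable borel"
    by (intro borel_measurable_continuous_onI continuous_intros)
  have Seq: "S = (\<lambda>v. (v $ 1, v $ 2)) -` (A \<times> B)" by (auto simp: S_def)
  show S: "S \<in> sets borel"
    unfolding Seq using measurable_sets[OF proj AB] by simp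
  have hint: "integrable (lborel \<Otimes>\<^sub>M lborel) h"
  proof (rule Bochner_Integration.integrable_bound)
    show "integrable (lborel \<Otimes>\<^sub>M lborel) (\<lambda>z. C * indicator (A \<times> B) z)"
    proof (intro integrable_mult_right integrable_real_indicator)
      show "A \<times> B \<in> sets (lborel \<Otimes>\<^sub>M lborel)" by measurable
      show "emeasure (lborel \<Otimes>\<^sub>M lborel) (A \<times> B) < \<infinity>"
        using A B by (subst lborel.emeasure_pair_measure_Times) (auto simp: ennreal_mult_less_top)
    qed
    show "AE z in lborel \<Otimes>\<^sub>M lborel. norm (h z) \<le> norm (C * indicator (A \<times> B) z)"
      using bound by (intro AE_I2) (force simp: h_def indicator_def abs_le_iff)
  qed measurable
  define k where "k = (\<lambda>v :: real^2. h (v $ 1, v $ 2))"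
  have km: "k \<in> borel_measurable borel"
    unfolding k_def using measurable_compose[OF proj, of h borel] hm by (simp add: lborel_prod)
  have kv: "k (case z of (x, y) \<Rightarrow> vector [x, y]) = h z" for z
    by (simp add: k_def case_prod_unfold)
  have kint: "integrable lborel k"
    by (subst lborel_vec2[symmetric], subst integrable_distr_eq)
       (use vec2_measurable km kv hint in \<open>auto simp: lborel_prod\<close>)
  have keq: "integral\<^sup>L lborel k = integral\<^sup>L (lborel \<Otimes>\<^sub>M lborel) h"
    by (subst lborel_vec2[symmetric], subst integral_distr)
       (use vec2_measurable km kv in \<open>auto simp: lborel_prod\<close>)
  have kS: "k = (\<lambda>v. indicator S v *\<^sub>R f (v $ 1, v $ 2))"
    by (auto simp: k_def h_def S_def indicator_def)
  have si: "set_integrable lborel S (\<lambda>v. f (v $ 1, v $ 2))"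
    using kint by (simp add: set_integrable_def kS)
  then show "(\<lambda>v. f (v $ 1, v $ 2)) absolutely_integrable_on S"
    unfolding set_integrable_def by (simp add: integrable_completion borel_measurable_integrable)
  have Seqi: "integral S (\<lambda>v. f (v $ 1, v $ 2)) = integral\<^sup>L (lborel \<Otimes>\<^sub>M lborel) h"
    using set_borel_integral_eq_integral(2)[OF si] keq by (simp add: set_lebesgue_integral_def kS)
  have 1: "integral\<^sup>L (lborel \<Otimes>\<^sub>M lborel) h = (LINT y|lborel. LINT x|lborel. h (x, y))"
    using lborel_pair.integral_snd[of "\<lambda>x y. h (x, y)"] hint by simp
  have 2: "integral\<^sup>L (lborel \<Otimes>\<^sub>M lborel) h = (LINT x|lborel. LINT y|lborel. h (x, y))"
    using lborel_pair.integral_fst'[OF hint] by simp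
  have slice: "set_integrable lborel U g" "integral\<^sup>L lborel k = integral U g"
    if U: "U \<in> sets borel" "emeasure lborel U < \<infinity>" and g: "\<And>x. x \<in> U \<Longrightarrow> \<bar>g x\<bar> \<le> C"
      and k: "k \<in> borel_measurable lborel" "k = (\<lambda>x. indicator U x *\<^sub>R g x)" for U and g k :: "real \<Rightarrow> real"
  proof -
    show si: "set_integrable lborel U g"
      unfolding set_integrable_def k(2)[symmetric]
    proof (rule Bochner_Integration.integrable_bound[OF _ k(1)])
      show "integrable lborel (\<lambda>x. C * indicator U x)"
        using U by (intro integrable_mult_right integrable_real_indicator) auto
      show "AE x in lborel. norm (k x) \<le> norm (C * indicator U x)"
        using g by (intro AE_I2) (force simp: k(2) indicator_def abs_le_iff)
    qed
    show "integral\<^sup>L lborel k = integral U g"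
      using set_borel_integral_eq_integral(2)[OF si] by (simp add: set_lebesgue_integral_def k(2))
  qed
  have inA: "(LINT x|lborel. h (x, y)) = indicator B y *\<^sub>R integral A (\<lambda>x. f (x, y))" for y
  proof (cases "y \<in> B")
    case True
    have "(\<lambda>x. h (x, y)) = (\<lambda>x. indicator A x *\<^sub>R f (x, y))" using True by (auto simp: h_def indicator_def)
    moreover have "(\<lambda>x. h (x, y)) \<in> borel_measurable lborel" by measurable
    ultimately show ?thesis using slice(2)[OF A bound[OF _ True]] True by simp
  qed (simp add: h_def)
  have inB: "(LINT y|lborel. h (x, y)) = indicator A x *\<^sub>R integral B (\<lambda>y. f (x, y))" for x
  proof (cases "x \<in> A")
    case True
    have "(\<lambda>y. h (x, y)) = (\<lambda>y. indicator B y *\<^sub>R f (x, y))" using True by (auto simp: h_def indicator_def)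
    moreover have "(\<lambda>y. h (x, y)) \<in> borel_measurable lborel" by measurable
    ultimately show ?thesis using slice(2)[OF B bound[OF True]] True by simp
  qed (simp add: h_def)
  have iB: "set_integrable lborel B (\<lambda>y. integral A (\<lambda>x. f (x, y)))"
    using lborel_pair.integrable_snd[of "\<lambda>x y. h (x, y)"] hint inA by (simp add: set_integrable_def)
  have iA: "set_integrable lborel A (\<lambda>x. integral B (\<lambda>y. f (x, y)))"
    using lborel_pair.integrable_fst'[OF hint] inB by (simp add: set_integrable_def)
  show "integral S (\<lambda>v. f (v $ 1, v $ 2)) = integral B (\<lambda>y. integral A (\<lambda>x. f (x, y)))"
    using set_borel_integral_eq_integral(2)[OF iB] by (simp add: Seqi 1 inA set_lebesgue_integral_def)
  show "integral S (\<lambda>v. f (v $ 1, v $ 2)) = integral A (\<lambda>x. integral B (\<lambda>y. f (x, y)))"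
    using set_borel_integral_eq_integral(2)[OF iA] by (simp add: Seqi 2 inB set_lebesgue_integral_def)
qed

section \<open>Change of variables on the exterior\<close>

text \<open>The general theorem is for vector-valued integrands, so real functions are passed
  through \<open>real^1\<close>.\<close>

lemma integral_change_of_variables_real:
  fixes f :: "real^2 \<Rightarrow> real" and g :: "real^2 \<Rightarrow> real^2"
  assumes S: "S \<in> sets lebesgue"
    and der_g: "\<And>x. x \<in> S \<Longrightarrow> (g has_derivative g' x) (at x within S)"
    and inj: "inj_on g S"
    and int: "(\<lambda>x. \<bar>det (matrix (g' x))\<bar> * f (g x)) absolutely_integrable_on S"
  shows "f absolutely_integrable_on (g ` S)"
    "integral (g ` S) f = integral S (\<lambda>x. \<bar>det (matrix (g' x))\<bar> * f (g x))"
proof -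
  define b where "b = integral S (\<lambda>x. \<bar>det (matrix (g' x))\<bar> * f (g x))"
  have "(\<lambda>x. \<bar>det (matrix (g' x))\<bar> *\<^sub>R vec (f (g x)) :: real ^ 1) absolutely_integrable_on S \<and>
           integral S (\<lambda>x. \<bar>det (matrix (g' x))\<bar> *\<^sub>R vec (f (g x))) = (vec b :: real ^ 1)
         \<longleftrightarrow> (\<lambda>x. vec (f x) :: real ^ 1) absolutely_integrable_on (g ` S) \<and>
           integral (g ` S) (\<lambda>x. vec (f x)) = (vec b :: real ^ 1)"
    by (rule has_absolute_integral_change_of_variables[OF S der_g inj])
  moreover have "(\<lambda>x. \<bar>det (matrix (g' x))\<bar> *\<^sub>R vec (f (g x)) :: real ^ 1) = (\<lambda>x. vec (\<bar>det (matrix (g' x))\<bar> * f (g x)))"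
    by (simp add: vec_eq_iff fun_eq_iff)
  ultimately have "f absolutely_integrable_on (g ` S) \<and> integral (g ` S) f = b"
    using int by (simp add: absolutely_integrable_on_1_iff integral_on_1_eq b_def)
  then show "f absolutely_integrable_on (g ` S)" "integral (g ` S) f = integral S (\<lambda>x. \<bar>det (matrix (g' x))\<bar> * f (g x))"
    by (auto simp: b_def)
qed

lemma nth_has_derivative: "((\<lambda>v :: real^2. v $ i) has_derivative (\<lambda>w. w $ i)) F"
  by (rule bounded_linear_imp_has_derivative[OF bounded_linear_vec_nth])

lemma nvec_has_derivative: "((\<lambda>v :: real^2. nvec (v $ 1)) has_derivative (\<lambda>w. w $ 1 *\<^sub>R tvec (v $ 1))) (at v within S)"
  and tvec_has_derivative: "((\<lambda>v :: real^2. tvec (v $ 1)) has_derivative (\<lambda>w. - w $ 1 *\<^sub>R nvec (v $ 1))) (at v within S)"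
proof -
  note d = DERIV_compose_FDERIV[OF DERIV_cos nth_has_derivative[of 1]] DERIV_compose_FDERIV[OF DERIV_sin nth_has_derivative[of 1]]
  show "((\<lambda>v :: real^2. nvec (v $ 1)) has_derivative (\<lambda>w. w $ 1 *\<^sub>R tvec (v $ 1))) (at v within S)"
    by (subst has_derivative_componentwise_within)
       (auto simp: Basis_vec_def UNIV_2 inner_axis intro!: derivative_eq_intros nth_has_derivative d)
  show "((\<lambda>v :: real^2. tvec (v $ 1)) has_derivative (\<lambda>w. - w $ 1 *\<^sub>R nvec (v $ 1))) (at v within S)"
    by (subst has_derivative_componentwise_within)
       (auto simp: Basis_vec_def UNIV_2 inner_axis intro!: derivative_eq_intros nth_has_derivative d)
qed

section \<open>Boundedness of the angle expression times the Jacobian\<close>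

lemma sin_ge_half: assumes "0 \<le> y" "y \<le> pi/2" shows "y / 2 \<le> sin y"
proof -
  define z where "z = y / 2"
  have z: "0 \<le> z" "z \<le> pi/4" using assms by (auto simp: z_def)
  have "sin 0 - 0 * cos 0 \<le> sin z - z * cos z"
  proof (rule DERIV_nonneg_imp_nondecreasing[OF z(1)])
    fix x assume "0 \<le> x" "x \<le> z"
    moreover from this have "sin x \<ge> 0" using z by (intro sin_ge_zero) auto
    ultimately show "\<exists>D. ((\<lambda>x. sin x - x * cos x) has_field_derivative D) (at x) \<and> 0 \<le> D"
      by (intro exI[of _ "x * sin x"]) (auto intro!: derivative_eq_intros)
  qed
  then have a: "z * cos z \<le> sin z" by simp
  have "cos (pi/4) \<le> cos z" using z by (intro cos_monotone_0_pi_le) auto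
  then have c: "sqrt 2 / 2 \<le> cos z" by (simp add: cos_45)
  then have "(sqrt 2 / 2)^2 \<le> (cos z)^2" by (intro power_mono) auto
  then have "1/2 \<le> (cos z)^2" by (simp add: power_divide)
  then have "z * (1/2) \<le> z * (cos z)^2" using z by (intro mult_left_mono) auto
  also have "\<dots> = (z * cos z) * cos z" by (simp add: power2_eq_square)
  also have "\<dots> \<le> sin z * cos z"
    by (intro mult_right_mono a order_trans[OF _ c]) simp
  finally have "z \<le> 2 * sin z * cos z" by simp
  then show ?thesis using sin_double[of z] by (simp add: z_def)
qed

lemma sub_sin_le: fixes x :: real assumes "0 \<le> x" shows "x - sin x \<le> x^3 / 2"
proof (cases "x = 0")
  case False
  then have "0 < x" using assms by simp
  then have "\<exists>z. 0 < z \<and> z < x \<and> (x - sin x) - (0 - sin 0) = (x - 0) * (1 - cos z)"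
    by (intro MVT2) (auto intro!: derivative_eq_intros)
  then obtain z where z: "0 < z" "z < x" "x - sin x = x * (1 - cos z)" by auto
  have "1 - cos z = 2 * (sin (z/2))^2" using cos_double_sin[of "z/2"] by simp
  also have "(sin (z/2))^2 \<le> (z/2)^2" using abs_sin_x_le_abs_x[of "z/2"] by (rule abs_le_square_iff[THEN iffD1])
  also have "(z/2)^2 \<le> (x/2)^2" using z by (intro power_mono) auto
  finally have "1 - cos z \<le> x^2 / 2" by (simp add: power_divide)
  then have "x * (1 - cos z) \<le> x * (x^2 / 2)" using assms by (intro mult_left_mono)
  then show ?thesis using z(3) by (simp add: power2_eq_square power3_eq_cube)
qed simp

text \<open>\<open>cos (\<phi>/2)\<close> is the factor of \<open>sin \<phi>\<close> that vanishes
  at \<open>pi\<close>, so the cubic decay is expressed in it. The constant is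
  \<open>22/2 * 4^3\<close>, from \<open>\<omega> - sin \<omega> \<le> \<omega>^3 / 2\<close> and
  \<open>\<omega> \<le> 4 * cos (\<phi>/2)\<close>.\<close>

lemma angle_fun_cos_half_bound:
  assumes "0 < \<phi>" "\<phi> < pi" shows "\<bar>angle_fun (pi - \<phi>)\<bar> \<le> 704 * (cos (\<phi>/2))^3"
proof -
  define \<omega> where "\<omega> = pi - \<phi>"
  have w: "0 \<le> \<omega>" "\<omega> \<le> pi" using assms by (auto simp: \<omega>_def)
  have "\<omega> / 2 / 2 \<le> sin (\<omega> / 2)" by (rule sin_ge_half) (use w in auto)
  also have "sin (\<omega> / 2) = cos (\<phi> / 2)" by (simp add: \<omega>_def sin_diff diff_divide_distrib)
  finally have "\<omega> \<le> 4 * cos (\<phi> / 2)" by simp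
  then have "\<omega>^3 \<le> (4 * cos (\<phi> / 2))^3" using w by (intro power_mono)
  moreover have "\<bar>angle_fun \<omega>\<bar> \<le> 22 * (\<omega>^3 / 2)" using angle_fun_bound[OF w(1)] sub_sin_le[OF w(1)] by simp
  ultimately show ?thesis by (simp add: \<omega>_def power_mult_distrib)
qed

context convex_support
begin

text \<open>The two tangent lengths \<open>N1 / sin\<close> and \<open>N2 / sin\<close> multiplied
  and divided by the sine of the visual angle: the classical density of points in tangent
  coordinates.\<close>

definition jac :: "real \<Rightarrow> real \<Rightarrow> real" where
  "jac x \<phi> = N1 x \<phi> * N2 x \<phi> / (sin \<phi>)^3"

text \<open>With \<open>s\<close> and \<open>c\<close> the sine and cosine of
  \<open>\<phi>/2\<close>, comparison with a circle of radius \<open>M\<close> gives a Jacobian of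
  at most \<open>M^2 * s / (2 * c^3)\<close>: regular at 0, and at \<open>pi\<close> a pole that the
  factor \<open>c^3\<close> in the bound of \<open>angle_fun\<close> cancels.\<close>

lemma angle_fun_jac_bounded: obtains C where "\<And>x \<phi>. 0 < \<phi> \<Longrightarrow> \<phi> < pi \<Longrightarrow> \<bar>angle_fun (pi - \<phi>) * jac x \<phi>\<bar> \<le> C"
proof -
  obtain M where M: "M > 0" "\<And>t. p t + p2 t < M" using curvature_bound by blast
  have "\<bar>angle_fun (pi - \<phi>) * jac x \<phi>\<bar> \<le> 352 * M^2" if \<phi>: "0 < \<phi>" "\<phi> < pi" for x \<phi>
  proof -
    define s c where "s = sin (\<phi>/2)" and "c = cos (\<phi>/2)"
    have s: "0 < s" unfolding s_def by (rule sin_gt_zero) (use \<phi> in auto)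
    have c: "0 < c" unfolding c_def by (rule cos_gt_zero) (use \<phi> in auto)
    have s1: "s \<le> 1" by (simp add: s_def)
    have e: "1 - cos \<phi> = 2 * s^2" "sin \<phi> = 2 * s * c"
      using cos_double_sin[of "\<phi>/2"] sin_double[of "\<phi>/2"] by (auto simp: s_def c_def)
    have N: "0 < N1 x \<phi>" "0 < N2 x \<phi>" "N1 x \<phi> \<le> M * (2 * s^2)" "N2 x \<phi> \<le> M * (2 * s^2)"
      using N1_pos[of \<phi> x] N2_pos[of \<phi> x] N1_less[OF M(2), of \<phi> x] N2_less[OF M(2), of \<phi> x] \<phi> e by auto
    have "N1 x \<phi> * N2 x \<phi> \<le> (M * (2 * s^2)) * (M * (2 * s^2))"
      using N by (intro mult_mono) auto
    then have "jac x \<phi> \<le> (M * (2 * s^2)) * (M * (2 * s^2)) / (2 * s * c)^3"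
      unfolding jac_def e using s c by (intro divide_right_mono) auto
    also have "\<dots> = M^2 * s / (2 * c^3)"
      using s c by (simp add: field_simps power2_eq_square power3_eq_cube)
    finally have j: "jac x \<phi> \<le> M^2 * s / (2 * c^3)" .
    have j0: "0 \<le> jac x \<phi>" unfolding jac_def e using N s c by simp
    have "\<bar>angle_fun (pi - \<phi>)\<bar> * jac x \<phi> \<le> (704 * c^3) * (M^2 * s / (2 * c^3))"
      using angle_fun_cos_half_bound[OF \<phi>] j j0 c by (intro mult_mono) (auto simp: c_def)
    also have "\<dots> = 352 * M^2 * s" using c by simp
    also have "\<dots> \<le> 352 * M^2 * 1" using s1 by (intro mult_left_mono) auto
    finally show ?thesis using j0 by (simp add: abs_mult)
  qed
  then show thesis using that by blast
qed

end

context body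
begin

text \<open>The distance \<open>\<sigma>\<close> along the tangent is left open so that one
  derivative serves two charts: with \<open>tangent_length\<close> it is the chart by two tangent
  angles, with the second coordinate itself the sweep by tangent segments used for the area.\<close>

definition tangent_map :: "(real^2 \<Rightarrow> real) \<Rightarrow> real^2 \<Rightarrow> real^2" where
  "tangent_map \<sigma> v = gam (v $ 1) + \<sigma> v *\<^sub>R tvec (v $ 1)"

definition tangent_map_deriv :: "real \<Rightarrow> real \<Rightarrow> real \<Rightarrow> real \<Rightarrow> real^2 \<Rightarrow> real^2" where
  "tangent_map_deriv x s a b w = w $ 1 *\<^sub>R ((p x + p2 x) *\<^sub>R tvec x - s *\<^sub>R nvec x) + (a * w $ 1 + b * w $ 2) *\<^sub>R tvec x"

lemma tangent_map_has_derivative: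
  assumes "(\<sigma> has_derivative (\<lambda>w. a * w $ 1 + b * w $ 2)) (at v within S)"
  shows "(tangent_map \<sigma> has_derivative tangent_map_deriv (v $ 1) (\<sigma> v) a b) (at v within S)"
proof -
  note d = DERIV_compose_FDERIV[OF p nth_has_derivative[of 1]] DERIV_compose_FDERIV[OF p1 nth_has_derivative[of 1]]
  have "((\<lambda>v. p (v $ 1) *\<^sub>R nvec (v $ 1) + p1 (v $ 1) *\<^sub>R tvec (v $ 1) + \<sigma> v *\<^sub>R tvec (v $ 1)) has_derivative
     (\<lambda>w. p (v $ 1) *\<^sub>R (w $ 1 *\<^sub>R tvec (v $ 1)) + (w $ 1 * p1 (v $ 1)) *\<^sub>R nvec (v $ 1)
       + (p1 (v $ 1) *\<^sub>R (- w $ 1 *\<^sub>R nvec (v $ 1)) + (w $ 1 * p2 (v $ 1)) *\<^sub>R tvec (v $ 1))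
       + (\<sigma> v *\<^sub>R (- w $ 1 *\<^sub>R nvec (v $ 1)) + (a * w $ 1 + b * w $ 2) *\<^sub>R tvec (v $ 1)))) (at v within S)"
    by (intro has_derivative_add has_derivative_scaleR nvec_has_derivative tvec_has_derivative d assms)
  moreover have "(\<lambda>w. p (v $ 1) *\<^sub>R (w $ 1 *\<^sub>R tvec (v $ 1)) + (w $ 1 * p1 (v $ 1)) *\<^sub>R nvec (v $ 1)
       + (p1 (v $ 1) *\<^sub>R (- w $ 1 *\<^sub>R nvec (v $ 1)) + (w $ 1 * p2 (v $ 1)) *\<^sub>R tvec (v $ 1))
       + (\<sigma> v *\<^sub>R (- w $ 1 *\<^sub>R nvec (v $ 1)) + (a * w $ 1 + b * w $ 2) *\<^sub>R tvec (v $ 1)))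
     = tangent_map_deriv (v $ 1) (\<sigma> v) a b"
    by (auto simp: tangent_map_deriv_def fun_eq_iff algebra_simps)
  ultimately show ?thesis unfolding tangent_map_def[abs_def] gam_def by simp
qed

text \<open>The second coordinate moves the point along \<open>tvec x\<close> only, so of the first
  partial derivative only the normal component \<open>- s\<close> counts; curvature and
  \<open>a\<close> drop out.\<close>

lemma det_tangent_map_deriv: "det (matrix (tangent_map_deriv x s a b)) = - s * b"
  unfolding det_2 matrix_def tangent_map_deriv_def
  by (simp add: axis_def) (use sin_cos_squared_add3[of x] in algebra)

definition tangent_length :: "real^2 \<Rightarrow> real" where "tangent_length v = N1 (v $ 1) (v $ 2) / sin (v $ 2)"

lemma chart_tangent_map: "tangent_map tangent_length v = chart (v $ 1) (v $ 2)"
  by (simp add: tangent_map_def chart_def tangent_length_def)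

text \<open>Only the second partial derivative enters the determinant, and it is the other tangent
  length divided by \<open>sin\<close>; this is where \<open>N2\<close> comes in.\<close>

lemma tangent_length_has_derivative:
  assumes "0 < v $ 2" "v $ 2 < pi"
  shows "(tangent_length has_derivative (\<lambda>w. ((p1 (v $ 1 + v $ 2) - p1 (v $ 1) * cos (v $ 2) - p2 (v $ 1) * sin (v $ 2)) / sin (v $ 2)) * w $ 1
     + N2 (v $ 1) (v $ 2) / (sin (v $ 2))^2 * w $ 2)) (at v within S)"
proof -
  have s: "sin (v $ 2) \<noteq> 0" using sin_gt_zero[OF assms] by simp
  have sum: "((\<lambda>v :: real^2. v $ 1 + v $ 2) has_derivative (\<lambda>w. w $ 1 + w $ 2)) (at v within S)"
    by (intro has_derivative_add nth_has_derivative)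
  note d = DERIV_compose_FDERIV[OF p nth_has_derivative[of 1]] DERIV_compose_FDERIV[OF p1 nth_has_derivative[of 1]]
    DERIV_compose_FDERIV[OF p sum] DERIV_compose_FDERIV[OF DERIV_cos nth_has_derivative[of 2]]
    DERIV_compose_FDERIV[OF DERIV_sin nth_has_derivative[of 2]]
  define x t where "x = v $ 1" and "t = v $ 2"
  have "(tangent_length has_derivative (\<lambda>w. (((w $ 1 + w $ 2) * p1 (x + t) - (p x * (w $ 2 * - sin t) + w $ 1 * p1 x * cos t)
      - (p1 x * (w $ 2 * cos t) + w $ 1 * p2 x * sin t)) * sin t -
      (p (x + t) - p x * cos t - p1 x * sin t) * (w $ 2 * cos t)) / (sin t * sin t))) (at v within S)"
    unfolding tangent_length_def[abs_def] N1_def x_def t_def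
    by (intro has_derivative_divide' has_derivative_diff has_derivative_mult d s)
  moreover have "(((w $ 1 + w $ 2) * p1 (x + t) - (p x * (w $ 2 * - sin t) + w $ 1 * p1 x * cos t)
      - (p1 x * (w $ 2 * cos t) + w $ 1 * p2 x * sin t)) * sin t -
      (p (x + t) - p x * cos t - p1 x * sin t) * (w $ 2 * cos t)) / (sin t * sin t) =
      (p1 (x + t) - p1 x * cos t - p2 x * sin t) / sin t * w $ 1 + N2 x t / (sin t)^2 * w $ 2" for w :: "real^2"
  proof -
    have "((w $ 1 + w $ 2) * p1 (x + t) - (p x * (w $ 2 * - sin t) + w $ 1 * p1 x * cos t)
      - (p1 x * (w $ 2 * cos t) + w $ 1 * p2 x * sin t)) * sin t -
      (p (x + t) - p x * cos t - p1 x * sin t) * (w $ 2 * cos t) =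
      (p1 (x + t) - p1 x * cos t - p2 x * sin t) * w $ 1 * sin t + N2 x t * w $ 2"
      unfolding N2_def using sin_cos_squared_add3[of t] by algebra
    then show ?thesis using s by (simp add: t_def[symmetric] add_divide_distrib power2_eq_square)
  qed
  ultimately show ?thesis by (simp add: x_def t_def)
qed

lemma jac_eq: "\<bar>det (matrix (tangent_map_deriv x (N1 x \<phi> / sin \<phi>) a (N2 x \<phi> / (sin \<phi>)^2)))\<bar> = jac x \<phi>"
  if "0 < \<phi>" "\<phi> < pi"
proof -
  have "sin \<phi> > 0" "N1 x \<phi> > 0" "N2 x \<phi> > 0" using that by (auto intro: sin_gt_zero N1_pos N2_pos)
  then show ?thesis
    unfolding det_tangent_map_deriv by (simp add: jac_def abs_mult power2_eq_square power3_eq_cube)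
qed

lemma continuous_on_chart: "continuous_on {v. 0 < v $ 2 \<and> v $ 2 < pi} (tangent_map tangent_length)"
  by (intro has_derivative_continuous_on[OF tangent_map_has_derivative[OF tangent_length_has_derivative]]) auto

lemma chart_inj_on:
  assumes "\<And>v. v \<in> S \<Longrightarrow> a \<le> v $ 1 \<and> v $ 1 < a + 2*pi \<and> 0 < v $ 2 \<and> v $ 2 < pi"
  shows "inj_on (tangent_map tangent_length) S"
proof (rule inj_onI)
  fix v w assume "v \<in> S" "w \<in> S" "tangent_map tangent_length v = tangent_map tangent_length w"
  then have "v $ 1 = w $ 1 \<and> v $ 2 = w $ 2"
    using assms by (intro chart_inj[of _ _ a]) (auto simp: chart_tangent_map)
  then show "v = w" by (simp add: vec_eq_iff forall_2)
qed

text \<open>On an open parameter domain the chart is a homeomorphism onto its image by invariance of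
  domain, and the visual angle is \<open>pi\<close> minus the second coordinate of the inverse.
  Continuity later yields Borel measurability of the integrand.\<close>

lemma visual_angle_continuous: "continuous_on (- K) (visual_angle K)"
proof -
  define U where "U a = {v :: real^2. a < v $ 1 \<and> v $ 1 < a + 2*pi \<and> 0 < v $ 2 \<and> v $ 2 < pi}" for a
  have openU: "open (U a)" for a
    unfolding U_def by (intro open_Collect_conj open_Collect_less continuous_intros)
  have inj: "inj_on (tangent_map tangent_length) (U a)" for a
    by (rule chart_inj_on[of _ a]) (auto simp: U_def)
  have cont: "continuous_on (U a) (tangent_map tangent_length)" for a
    by (rule continuous_on_subset[OF continuous_on_chart]) (auto simp: U_def)
  have V: "open (tangent_map tangent_length ` U a)" "continuous_on (tangent_map tangent_length ` U a) (visual_angle K)" for a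
  proof -
    show "open (tangent_map tangent_length ` U a)" by (rule invariance_of_domain[OF cont openU inj])
    obtain g where g: "homeomorphism (U a) (tangent_map tangent_length ` U a) (tangent_map tangent_length) g"
      using invariance_of_domain_homeomorphism[OF openU cont _ inj] by auto
    have "continuous_on (tangent_map tangent_length ` U a) (\<lambda>P. pi - g P $ 2)"
      using g by (intro continuous_intros) (simp add: homeomorphism_def)
    then show "continuous_on (tangent_map tangent_length ` U a) (visual_angle K)"
    proof (rule continuous_on_eq)
      fix P assume "P \<in> tangent_map tangent_length ` U a"
      then obtain v where v: "v \<in> U a" "P = tangent_map tangent_length v" by blast
      then have "g P = v" using g by (simp add: homeomorphism_def)
      then show "pi - g P $ 2 = visual_angle K P"
        using visual_angle_chart[of "v $ 2" "v $ 1"] v by (simp add: chart_tangent_map U_def)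
    qed
  qed
  \<comment> \<open>A single open period omits one tangent ray; the periods starting at
    \<open>0\<close> and at \<open>- pi\<close> together cover the exterior.\<close>
  have "- K = tangent_map tangent_length ` U 0 \<union> tangent_map tangent_length ` U (- pi)"
  proof
    show "- K \<subseteq> tangent_map tangent_length ` U 0 \<union> tangent_map tangent_length ` U (- pi)"
    proof
      fix P assume "P \<in> - K"
      then obtain x \<phi> where x: "0 \<le> x" "x < 0 + 2*pi" "0 < \<phi>" "\<phi> < pi" "P = chart x \<phi>"
        using chart_surj[of P 0] by auto
      then have "vector [x, \<phi>] \<in> U 0 \<union> U (- pi)" "P = tangent_map tangent_length (vector [x, \<phi>])"
        by (auto simp: U_def chart_tangent_map)
      then show "P \<in> tangent_map tangent_length ` U 0 \<union> tangent_map tangent_length ` U (- pi)" by blast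
    qed
    show "tangent_map tangent_length ` U 0 \<union> tangent_map tangent_length ` U (- pi) \<subseteq> - K"
      using chart_notin by (auto simp: U_def chart_tangent_map)
  qed
  then show ?thesis
    using continuous_on_open_Un[OF V(1) V(1) V(2) V(2), of 0 "- pi"] by simp
qed

end

locale constant_width_body = body p p1 p2 K + constant_width_support p p1 p2 w
  for p p1 p2 K w
begin

lemma exterior_image: "tangent_map tangent_length ` {v. v $ 1 \<in> {0..<2*pi} \<and> v $ 2 \<in> {0<..<pi}} = - K"
proof
  show "- K \<subseteq> tangent_map tangent_length ` {v. v $ 1 \<in> {0..<2*pi} \<and> v $ 2 \<in> {0<..<pi}}"
  proof
    fix P assume "P \<in> - K"
    then obtain x \<phi> where x: "0 \<le> x" "x < 0 + 2*pi" "0 < \<phi>" "\<phi> < pi" "P = chart x \<phi>"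
      using chart_surj[of P 0] by auto
    then show "P \<in> tangent_map tangent_length ` {v. v $ 1 \<in> {0..<2*pi} \<and> v $ 2 \<in> {0<..<pi}}"
      by (intro image_eqI[of _ _ "vector [x, \<phi>]"]) (auto simp: chart_tangent_map)
  qed
qed (use chart_notin in \<open>auto simp: chart_tangent_map\<close>)

text \<open>Bounded integrand on a bounded rectangle: there Fubini is harmless, and integrability
  passes to the unbounded exterior through the change of variables.\<close>

theorem exterior_integral:
  "set_integrable lborel (- K) (\<lambda>P. angle_fun (visual_angle K P))"
  "(LINT P:(- K)|lborel. angle_fun (visual_angle K P)) =
     perim^2 / 4 - 4 * pi * energy p 3 - pi * area_integral"
proof -
  define A B where "A = {0..<2*pi}" and "B = {0<..<pi}"
  define S where "S = {v :: real^2. v $ 1 \<in> A \<and> v $ 2 \<in> B}"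
  define f where "f = (\<lambda>z. angle_fun (pi - snd z) * jac (fst z) (snd z))"
  obtain C where C: "\<And>x \<phi>. 0 < \<phi> \<Longrightarrow> \<phi> < pi \<Longrightarrow> \<bar>angle_fun (pi - \<phi>) * jac x \<phi>\<bar> \<le> C"
    using angle_fun_jac_bounded by blast
  have nz: "sin y \<noteq> 0" if "y \<in> B" for y
    using sin_gt_zero[of y] that by (auto simp: B_def)
  have "continuous_on (A \<times> B) f"
    unfolding f_def jac_def N1_def N2_def
    by (intro continuous_intros p_conts continuous_on_compose2[OF angle_fun_cont[of UNIV]])
       (use nz in auto)
  moreover have "A \<times> B \<in> sets borel" unfolding borel_prod[symmetric] by (simp add: A_def B_def)
  ultimately have meas: "(\<lambda>z. indicator (A \<times> B) z * f z) \<in> borel_measurable borel"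
    using borel_measurable_continuous_on_indicator[of "A \<times> B" f] by simp
  have bnd: "\<bar>f (x, y)\<bar> \<le> C" if "x \<in> A" "y \<in> B" for x y
    using C[of y x] that by (simp add: B_def f_def)
  have AB: "A \<in> sets borel" "emeasure lborel A < \<infinity>" "B \<in> sets borel" "emeasure lborel B < \<infinity>"
    by (auto simp: A_def B_def)
  have rect: "S \<in> sets borel" "(\<lambda>v. f (v $ 1, v $ 2)) absolutely_integrable_on S"
    "integral S (\<lambda>v. f (v $ 1, v $ 2)) = integral B (\<lambda>y. integral A (\<lambda>x. f (x, y)))"
    by (rule integral_rectangle[OF AB meas _ S_def], erule (1) bnd)+
  have inner: "integral A (\<lambda>x. f (x, y)) = angle_fun (pi - y) * numer y / (sin y)^3" if "y \<in> B" for y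
  proof -
    have "((\<lambda>x. angle_fun (pi - y) / (sin y)^3 * (N1 x y * N2 x y)) has_integral angle_fun (pi - y) / (sin y)^3 * numer y) {0..2*pi}"
      by (intro has_integral_mult_right integral_N1_N2) (use that in \<open>auto simp: B_def\<close>)
    then have "circ (\<lambda>x. f (x, y)) = angle_fun (pi - y) * numer y / (sin y)^3"
      by (intro integral_unique) (simp add: f_def jac_def)
    moreover have "integral A (\<lambda>x. f (x, y)) = circ (\<lambda>x. f (x, y))"
      by (rule integral_subset_negligible) (auto simp: A_def intro: negligible_subset[of "{2*pi}"])
    ultimately show ?thesis by simp
  qed
  have "integral S (\<lambda>v. f (v $ 1, v $ 2)) = integral B (\<lambda>y. angle_fun (pi - y) * numer y / (sin y)^3)"
    unfolding rect(3) by (rule hk_cong) (rule inner)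
  also have "\<dots> = integral {0..pi} (\<lambda>y. angle_fun (pi - y) * numer y / (sin y)^3)"
    by (rule integral_subset_negligible) (auto simp: B_def intro: negligible_subset[of "{0, pi}"])
  finally have val: "integral S (\<lambda>v. f (v $ 1, v $ 2)) = integral {0..pi} (\<lambda>y. angle_fun (pi - y) * numer y / (sin y)^3)" .
  define D where "D = (\<lambda>v :: real^2. tangent_map_deriv (v $ 1) (tangent_length v)
     ((p1 (v $ 1 + v $ 2) - p1 (v $ 1) * cos (v $ 2) - p2 (v $ 1) * sin (v $ 2)) / sin (v $ 2))
     (N2 (v $ 1) (v $ 2) / (sin (v $ 2))^2))"
  have der: "(tangent_map tangent_length has_derivative D v) (at v within S)" if "v \<in> S" for v
    unfolding D_def by (intro tangent_map_has_derivative tangent_length_has_derivative) (use that in \<open>auto simp: S_def B_def\<close>)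
  have inj: "inj_on (tangent_map tangent_length) S"
    by (rule chart_inj_on[of _ 0]) (auto simp: S_def A_def B_def)
  have eq: "\<bar>det (matrix (D v))\<bar> * angle_fun (visual_angle K (tangent_map tangent_length v)) = f (v $ 1, v $ 2)" if "v \<in> S" for v
    using that unfolding D_def tangent_length_def chart_tangent_map
    by (subst jac_eq, auto simp: S_def B_def visual_angle_chart f_def)
  have SL: "S \<in> sets lebesgue" using rect(1) by simp
  have int: "(\<lambda>v. \<bar>det (matrix (D v))\<bar> * angle_fun (visual_angle K (tangent_map tangent_length v))) absolutely_integrable_on S"
    using rect(2) by (rule absolutely_integrable_spike[of _ _ "{}"]) (use eq in auto)
  have img: "tangent_map tangent_length ` S = - K"
    unfolding S_def A_def B_def by (rule exterior_image)
  have cov: "(\<lambda>P. angle_fun (visual_angle K P)) absolutely_integrable_on - K"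
    "integral (- K) (\<lambda>P. angle_fun (visual_angle K P)) =
       integral S (\<lambda>v. \<bar>det (matrix (D v))\<bar> * angle_fun (visual_angle K (tangent_map tangent_length v)))"
    by (rule integral_change_of_variables_real[OF SL _ inj int, unfolded img], erule der)+
  have openK: "open (- K)" using compact by (simp add: compact_imp_closed open_Compl)
  \<comment> \<open>The change of variables gives integrability for the completed measure; Borel
    measurability transfers it to \<open>lborel\<close>.\<close>
  have "continuous_on (- K) (\<lambda>P. angle_fun (visual_angle K P))"
    by (rule continuous_on_compose2[OF angle_fun_cont[of UNIV] visual_angle_continuous]) auto
  then have bm: "(\<lambda>P. indicator (- K) P *\<^sub>R angle_fun (visual_angle K P)) \<in> borel_measurable lborel"
    using borel_measurable_continuous_on_indicator[of "- K" "\<lambda>P. angle_fun (visual_angle K P)"] openK by simp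
  show si: "set_integrable lborel (- K) (\<lambda>P. angle_fun (visual_angle K P))"
    using cov(1) integrable_completion[OF bm] by (simp add: set_integrable_def)
  have "(LINT P:(- K)|lborel. angle_fun (visual_angle K P)) = integral (- K) (\<lambda>P. angle_fun (visual_angle K P))"
    by (rule set_borel_integral_eq_integral(2)[OF si])
  also have "\<dots> = integral S (\<lambda>v. f (v $ 1, v $ 2))"
    unfolding cov(2) by (rule hk_cong) (rule eq)
  also have "\<dots> = perim^2 / 4 - 4 * pi * energy p 3 - pi * area_integral"
    unfolding val using has_integral_angle_fun by (rule integral_unique)
  finally show "(LINT P:(- K)|lborel. angle_fun (visual_angle K P)) =
     perim^2 / 4 - 4 * pi * energy p 3 - pi * area_integral" .
qed

end

section \<open>Area of the body\<close>

context body
begin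

text \<open>The part of a large disk of radius \<open>R\<close> outside \<open>K\<close> is swept out by tangent segments of length
  \<open>T = sqrt (R^2 - p^2) - p'\<close>, whose Jacobian is the distance to the point of contact.\<close>

theorem area_formula: "area K = area_integral"
proof -
  obtain R where R: "R > 0" "\<And>x. x \<in> K \<Longrightarrow> norm x < R"
    using compact_imp_bounded[OF compact] by (metis bounded_pos_less)
  \<comment> \<open>The left side is the squared norm of the boundary point, which lies strictly
    inside the disk. Hence \<open>q > \<bar>p1\<bar>\<close>, so that every tangent segment has
    positive length \<open>T\<close>.\<close>
  have pR: "(p x)^2 + (p1 x)^2 < R^2" for x
  proof -
    have "(norm (gam x))^2 = (p x)^2 + (p1 x)^2"
      unfolding power2_norm_eq_inner gam_def
      by (simp add: inner_add_left inner_add_right frame_inner power2_eq_square)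
    moreover have "(norm (gam x))^2 < R^2" using R(2)[OF gam_in] by (intro power_strict_mono) auto
    ultimately show ?thesis by simp
  qed
  define q where "q = (\<lambda>x. sqrt (R^2 - (p x)^2))"
  have q: "(q x)^2 = R^2 - (p x)^2" "\<bar>p1 x\<bar> < q x" "q x \<le> R" for x
  proof -
    have nn: "(p1 x)^2 < R^2 - (p x)^2" using pR[of x] by simp
    then have "0 \<le> R^2 - (p x)^2" using zero_le_power2[of "p1 x"] by linarith
    then show "(q x)^2 = R^2 - (p x)^2" by (simp add: q_def)
    show "\<bar>p1 x\<bar> < q x" using real_sqrt_less_mono[OF nn] by (simp add: q_def)
    show "q x \<le> R" unfolding q_def using R(1) by (intro real_le_lsqrt) auto
  qed
  have q_cont: "continuous_on UNIV q" unfolding q_def by (intro continuous_intros p_conts)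
  define T where "T = (\<lambda>x. q x - p1 x)"
  have T: "0 < T x" "T x < 2 * R" for x using q[of x] by (auto simp: T_def abs_less_iff)
  have T_cont: "continuous_on A T" for A
    unfolding T_def by (intro continuous_intros p_conts continuous_on_subset[OF q_cont]) auto
  have normsq: "(norm (gam x + s *\<^sub>R tvec x))^2 = (p x)^2 + (p1 x + s)^2" for x s
    unfolding power2_norm_eq_inner
    by (simp add: gam_def inner_add_left inner_add_right frame_inner power2_eq_square algebra_simps)
  have inball: "norm (gam x + s *\<^sub>R tvec x) \<le> R \<longleftrightarrow> s \<le> T x" if "s > 0" for x s
  proof -
    have "norm (gam x + s *\<^sub>R tvec x) \<le> R \<longleftrightarrow> (norm (gam x + s *\<^sub>R tvec x))^2 \<le> R^2"
      using R(1) by (simp add: power2_le_iff_abs_le)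
    also have "\<dots> \<longleftrightarrow> (p1 x + s)^2 \<le> (q x)^2" unfolding normsq q(1) by linarith
    also have "\<dots> \<longleftrightarrow> \<bar>p1 x + s\<bar> \<le> q x" using q(2)[of x] by (simp add: power2_le_iff_abs_le)
    also have "\<dots> \<longleftrightarrow> s \<le> T x" using q(2)[of x] that by (auto simp: T_def)
    finally show ?thesis .
  qed
  define A B where "A = {0..<2*pi}" and "B = {0<..2*R}"
  \<comment> \<open>The tangent length is cut off at \<open>T\<close>, which extends the integral
    over the region below the graph to a rectangle.\<close>
  define f where "f = (\<lambda>z. if snd z \<le> T (fst z) then snd z else 0)"
  define Q where "Q = {v :: real^2. v $ 1 \<in> A \<and> v $ 2 \<in> B}"
  define S where "S = {v :: real^2. v $ 1 \<in> A \<and> 0 < v $ 2 \<and> v $ 2 \<le> T (v $ 1)}"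
  have AB: "A \<in> sets borel" "emeasure lborel A < \<infinity>" "B \<in> sets borel" "emeasure lborel B < \<infinity>"
    using R(1) by (auto simp: A_def B_def)
  have T_meas [measurable]: "T \<in> borel_measurable borel" by (intro borel_measurable_continuous_onI T_cont)
  have [measurable]: "A \<in> sets borel" "B \<in> sets borel" using AB by auto
  have "f \<in> borel_measurable (borel \<Otimes>\<^sub>M borel)" unfolding f_def by measurable
  moreover have "A \<times> B \<in> sets (borel \<Otimes>\<^sub>M borel)" by measurable
  ultimately have "(\<lambda>z. indicator (A \<times> B) z * f z) \<in> borel_measurable (borel \<Otimes>\<^sub>M borel)" by measurable
  then have meas: "(\<lambda>z. indicator (A \<times> B) z * f z) \<in> borel_measurable borel" by (simp add: borel_prod)
  have bnd: "\<bar>f (x, y)\<bar> \<le> 2 * R" if "x \<in> A" "y \<in> B" for x y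
    using that R(1) by (auto simp: f_def B_def)
  have rect: "Q \<in> sets borel" "(\<lambda>v. f (v $ 1, v $ 2)) absolutely_integrable_on Q"
    "integral Q (\<lambda>v. f (v $ 1, v $ 2)) = integral A (\<lambda>x. integral B (\<lambda>y. f (x, y)))"
    by (rule integral_rectangle[OF AB meas _ Q_def], erule (1) bnd)+
  have SQ: "S = {v \<in> Q. v $ 2 \<le> T (v $ 1)}"
    using T by (auto simp: S_def Q_def B_def) (meson less_imp_le order_trans)
  have "(\<lambda>v :: real^2. v $ i) \<in> borel_measurable borel" for i
    by (intro borel_measurable_continuous_onI continuous_intros)
  note [measurable] = this
  have S_meas: "S \<in> sets borel"
    unfolding S_def by measurable
  have inner: "integral B (\<lambda>y. f (x, y)) = (T x)^2 / 2" for x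
  proof -
    have "((\<lambda>y. y) has_integral ((T x)^2 / 2 - 0^2 / 2)) {0..T x}"
      by (intro fundamental_theorem_of_calculus)
         (use T[of x] in \<open>auto intro!: derivative_eq_intros simp: has_real_derivative_iff_has_vector_derivative[symmetric]\<close>)
    then have i: "integral {0..T x} (\<lambda>y. y) = (T x)^2 / 2" by (simp add: integral_unique)
    have "integral B (\<lambda>y. f (x, y)) = integral {0..T x} (\<lambda>y. f (x, y))"
    proof -
      have "integral B (\<lambda>y. f (x, y)) = integral UNIV (\<lambda>y. if y \<in> B then f (x, y) else 0)"
        by (rule integral_restrict_UNIV[symmetric])
      also have "(\<lambda>y. if y \<in> B then f (x, y) else 0) = (\<lambda>y. if y \<in> {0..T x} then f (x, y) else 0)"
        using T[of x] by (auto simp: f_def B_def)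
      also have "integral UNIV \<dots> = integral {0..T x} (\<lambda>y. f (x, y))" by (rule integral_restrict_UNIV)
      finally show ?thesis .
    qed
    also have "\<dots> = integral {0..T x} (\<lambda>y. y)"
      by (rule hk_cong) (simp add: f_def)
    finally show ?thesis using i by simp
  qed
  have "integral Q (\<lambda>v. f (v $ 1, v $ 2)) = integral A (\<lambda>x. (T x)^2 / 2)"
    unfolding rect(3) inner ..
  also have "\<dots> = circ (\<lambda>x. (T x)^2 / 2)"
    by (rule integral_subset_negligible) (auto simp: A_def intro: negligible_subset[of "{2*pi}"])
  finally have valQ: "integral Q (\<lambda>v. f (v $ 1, v $ 2)) = circ (\<lambda>x. (T x)^2 / 2)" .
  have "((\<lambda>v. f (v $ 1, v $ 2)) has_integral circ (\<lambda>x. (T x)^2 / 2)) Q"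
    using integrable_integral[OF set_lebesgue_integral_eq_integral(1)[OF rect(2)]] unfolding valQ .
  then have "((\<lambda>v. if v \<in> Q then f (v $ 1, v $ 2) else 0) has_integral circ (\<lambda>x. (T x)^2 / 2)) UNIV"
    by (simp only: has_integral_restrict_UNIV)
  also have "(\<lambda>v. if v \<in> Q then f (v $ 1, v $ 2) else 0) = (\<lambda>v :: real^2. if v \<in> S then v $ 2 else 0)"
    by (auto simp: SQ f_def)
  finally have intS: "((\<lambda>v. v $ 2) has_integral circ (\<lambda>x. (T x)^2 / 2)) S"
    by (simp only: has_integral_restrict_UNIV)
  define D where "D = (\<lambda>v :: real^2. tangent_map_deriv (v $ 1) (v $ 2) 0 1)"
  have der: "(tangent_map (\<lambda>v. v $ 2) has_derivative D v) (at v within S)" for v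
    unfolding D_def by (rule tangent_map_has_derivative) (simp add: nth_has_derivative)
  have inj: "inj_on (tangent_map (\<lambda>v. v $ 2)) S"
  proof (rule inj_onI)
    fix v w assume "v \<in> S" "w \<in> S" "tangent_map (\<lambda>v. v $ 2) v = tangent_map (\<lambda>v. v $ 2) w"
    then have "v $ 1 = w $ 1 \<and> v $ 2 = w $ 2"
      by (intro tangent_inj[of _ _ 0]) (auto simp: S_def A_def tangent_map_def)
    then show "v = w" by (simp add: vec_eq_iff forall_2)
  qed
  have img: "tangent_map (\<lambda>v. v $ 2) ` S = cball 0 R - K"
  proof
    show "tangent_map (\<lambda>v. v $ 2) ` S \<subseteq> cball 0 R - K"
    proof
      fix P assume "P \<in> tangent_map (\<lambda>v. v $ 2) ` S"
      then obtain v where v: "v \<in> S" "P = gam (v $ 1) + v $ 2 *\<^sub>R tvec (v $ 1)"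
        by (auto simp: tangent_map_def)
      then have "P \<notin> K" using not_in_K[of P "v $ 1"] h_tangent[of "v $ 1" "v $ 2"] by (simp add: S_def)
      moreover have "norm P \<le> R" using v inball[of "v $ 2" "v $ 1"] by (simp add: S_def)
      ultimately show "P \<in> cball 0 R - K" by simp
    qed
    show "cball 0 R - K \<subseteq> tangent_map (\<lambda>v. v $ 2) ` S"
    proof
      fix P assume P: "P \<in> cball 0 R - K"
      then obtain x \<phi> where x: "0 \<le> x" "x < 0 + 2*pi" "0 < \<phi>" "\<phi> < pi" "P = chart x \<phi>"
        using chart_surj[of P 0] by auto
      define s where "s = N1 x \<phi> / sin \<phi>"
      have Ps: "P = gam x + s *\<^sub>R tvec x" using x(5) by (simp add: chart_def s_def)
      have "s > 0" using x sin_gt_zero[of \<phi>] N1_pos[of \<phi> x] by (simp add: s_def)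
      moreover from this have "s \<le> T x" using P inball[of s x] Ps by simp
      ultimately have "vector [x, s] \<in> S" using x by (simp add: S_def A_def)
      moreover have "P = tangent_map (\<lambda>v. v $ 2) (vector [x, s])" using Ps by (simp add: tangent_map_def)
      ultimately show "P \<in> tangent_map (\<lambda>v. v $ 2) ` S" by blast
    qed
  qed
  have "((\<lambda>v. \<bar>det (matrix (D v))\<bar>) has_integral circ (\<lambda>x. (T x)^2 / 2)) S"
    by (rule has_integral_eq[OF _ intS]) (simp add: D_def det_tangent_map_deriv S_def)
  then have m: "measure lebesgue (cball 0 R - K) = circ (\<lambda>x. (T x)^2 / 2)"
    using has_measure_differentiable_image[OF _ der inj, of "circ (\<lambda>x. (T x)^2 / 2)"] S_meas
    by (simp add: img)
  have KR: "K \<subseteq> cball 0 R" using R(2) by (force intro: less_imp_le)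
  have "measure lebesgue (cball 0 R - K) = measure lebesgue (cball (0 :: real^2) R) - measure lebesgue K"
    using KR compact by (intro measurable_measure_Diff) (auto simp: lmeasurable_compact fmeasurableD)
  moreover have "measure lebesgue (cball (0 :: real^2) R) = pi * R^2"
    using R(1) content_cball[of R "0 :: real^2"] by (simp add: unit_ball_vol_2)
  moreover have "measure lebesgue K = area K"
    unfolding area_def using compact by (intro measure_completion) (simp add: compact_imp_closed)
  ultimately have aK: "area K = pi * R^2 - circ (\<lambda>x. (T x)^2 / 2)" using m by linarith
  \<comment> \<open>\<open>p' * sqrt (R^2 - p^2)\<close> is the derivative of a function of
    \<open>p\<close>, and \<open>p\<close> returns to its initial value after a period. This is the
    cross term in the expansion of \<open>T^2\<close>.\<close>
  have sub: "((\<lambda>x. p1 x * sqrt (R^2 - (p x)^2)) has_integral 0) {0..2*pi}"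
  proof -
    have c: "continuous_on UNIV (\<lambda>y. sqrt (R^2 - y^2))" by (intro continuous_intros)
    have C: "\<bar>p x\<bar> \<le> R" for x
    proof -
      have "(p x)^2 \<le> R^2" using pR[of x] zero_le_power2[of "p1 x"] by linarith
      then show ?thesis using R(1) abs_le_square_iff[of "p x" R] by simp
    qed
    have "((\<lambda>x. p1 x *\<^sub>R sqrt (R^2 - (p x)^2)) has_integral (integral {p 0..p (2*pi)} (\<lambda>y. sqrt (R^2 - y^2)))) {0..2*pi}"
    proof (rule has_integral_substitution[where c = "-R" and d = R])
      show "p ` {0..2*pi} \<subseteq> {-R..R}"
      proof safe
        fix x show "p x \<in> {-R..R}" using C[of x] by (auto simp: abs_le_iff)
      qed
      show "continuous_on {-R..R} (\<lambda>y. sqrt (R^2 - y^2))" by (rule continuous_on_subset[OF c]) simp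
      show "(p has_field_derivative p1 x) (at x within {0..2*pi})" for x
        using p by (rule DERIV_subset) simp
    qed (auto simp: p_2pi)
    then show ?thesis by (simp add: p_2pi)
  qed
  have i1: "((\<lambda>x. (p x)^2 - (p1 x)^2) has_integral circ (\<lambda>x. (p x)^2 - (p1 x)^2)) {0..2*pi}"
    by (intro integrable_integral integrable_cont continuous_intros p_conts)
  have i2: "((\<lambda>x. R^2 / 2) has_integral (2 * pi - 0) *\<^sub>R (R^2 / 2)) {0..2*pi}"
    using has_integral_const_real[of "R^2 / 2" 0 "2*pi"] by simp
  have "((\<lambda>x. R^2 / 2 - 1/2 * ((p x)^2 - (p1 x)^2) - p1 x * sqrt (R^2 - (p x)^2)) has_integral
     (2 * pi - 0) *\<^sub>R (R^2 / 2) - 1/2 * circ (\<lambda>x. (p x)^2 - (p1 x)^2) - 0) {0..2*pi}"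
    by (intro has_integral_diff has_integral_mult_right i1 i2 sub)
  moreover have "R^2 / 2 - 1/2 * ((p x)^2 - (p1 x)^2) - p1 x * sqrt (R^2 - (p x)^2) = (T x)^2 / 2" for x
  proof -
    have "(T x)^2 = (q x)^2 - 2 * q x * p1 x + (p1 x)^2" unfolding T_def by (simp add: power2_diff)
    then have "(T x)^2 = R^2 - (p x)^2 - 2 * q x * p1 x + (p1 x)^2" unfolding q(1) .
    moreover have "q x = sqrt (R^2 - (p x)^2)" by (simp add: q_def)
    ultimately show ?thesis by (simp add: field_simps)
  qed
  ultimately have "((\<lambda>x. (T x)^2 / 2) has_integral
     (2 * pi - 0) *\<^sub>R (R^2 / 2) - 1/2 * circ (\<lambda>x. (p x)^2 - (p1 x)^2) - 0) {0..2*pi}"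
    by (simp only:)
  from integral_unique[OF this] show ?thesis unfolding aK area_integral_def by (simp add: field_simps)
qed

end

section \<open>The inequality in terms of Fourier coefficients\<close>

text \<open>Common meeting point of the two halves of the equality case: these are the frequencies
  that cannot contribute to the difference of the two sides. Order 1 only translates the
  body.\<close>

definition low_spectrum :: "(real \<Rightarrow> real) \<Rightarrow> bool" where
  "low_spectrum f \<longleftrightarrow> (\<exists>c a b a3 b3 a5 b5. f = (\<lambda>t. c + a * cos t + b * sin t
     + a3 * cos (3 * t) + b3 * sin (3 * t) + a5 * cos (5 * t) + b5 * sin (5 * t)))"

lemma energy_eq_0_iff: "energy f n = 0 \<longleftrightarrow> fcos f n = 0 \<and> fsin f n = 0"
  by (simp add: energy_def)

lemma low_spectrum_energy:
  assumes "low_spectrum f" "n \<notin> {0, 1, 3, 5}"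
  shows "energy f n = 0"
proof -
  obtain c a b a3 b3 a5 b5 where f: "f = (\<lambda>t. c + a * cos t + b * sin t
     + a3 * cos (3 * t) + b3 * sin (3 * t) + a5 * cos (5 * t) + b5 * sin (5 * t))"
    using assms(1) by (auto simp: low_spectrum_def)
  have c0: "fcos (\<lambda>t. cos (real k * t)) n = 0" if "k \<noteq> n" for k
    using integral_cos_cos[of k n] that by (simp add: fcos_def)
  have c1: "fcos (\<lambda>t. sin (real k * t)) n = 0" for k
    using integral_sin_cos[of k n] by (simp add: fcos_def)
  have s0: "fsin (\<lambda>t. sin (real k * t)) n = 0" if "k \<noteq> n" for k
    using integral_sin_sin[of k n] that by (simp add: fsin_def)
  have s1: "fsin (\<lambda>t. cos (real k * t)) n = 0" for k
    using integral_cos_sin[of k n] by (simp add: fsin_def)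
  have fk: "f = (\<lambda>t. c + a * cos (real 1 * t) + b * sin (real 1 * t)
     + a3 * cos (real 3 * t) + b3 * sin (real 3 * t) + a5 * cos (real 5 * t) + b5 * sin (real 5 * t))"
    by (simp add: f)
  have k: "1 \<noteq> n" "3 \<noteq> n" "5 \<noteq> n" "n \<noteq> 0" using assms(2) by auto
  have "fcos f n = 0" "fsin f n = 0"
    unfolding fk
    by (simp only: fcos_add fsin_add fcos_scale fsin_scale fcos_const fsin_const continuous_intros
        c0[OF k(1)] c0[OF k(2)] c0[OF k(3)] s0[OF k(1)] s0[OF k(2)] s0[OF k(3)] c1 s1 k if_False; simp)+
  then show ?thesis by (simp add: energy_def)
qed

lemma fcos_0: "fcos f 0 = circ f"
  by (simp add: fcos_def)

context convex_support
begin

text \<open>Parseval makes the mean square residual of the partial sum of degree 5 vanish; by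
  continuity \<open>p\<close> equals that sum on one period, and both sides are periodic.\<close>

lemma low_spectrum_if_energy:
  assumes "\<And>n. n \<notin> {0, 1, 3, 5} \<Longrightarrow> energy p n = 0"
  shows "low_spectrum p"
proof -
  have J: "(\<lambda>n. energy p (Suc n)) sums (circ (\<lambda>t. (p t)^2) - (fcos p 0)^2 / (2*pi))"
    by (rule parseval[OF p_cont per])
  have "(\<lambda>n. energy p (Suc n)) sums (\<Sum>n<5. energy p (Suc n))"
    by (rule sums_finite) (auto intro: assms)
  with J have e: "circ (\<lambda>t. (p t)^2) - (fcos p 0)^2 / (2*pi) = (\<Sum>n<5. energy p (Suc n))"
    by (rule sums_unique2)
  note fc = continuous_on_trig_poly[OF trig_poly_fourier_sum]
  have "circ (\<lambda>t. (p t - fourier_sum p 5 t)^2) = 0"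
    using integral_residual_sq[OF p_cont, of 5] e by (simp add: sum.atLeast1_atMost_eq)
  moreover have "continuous_on {0..2*pi} (\<lambda>t. (p t - fourier_sum p 5 t)^2)"
    by (intro continuous_intros p_cont fc)
  ultimately have z: "\<forall>t\<in>{0..2*pi}. (p t - fourier_sum p 5 t)^2 = 0"
    by (subst (asm) integral_eq_0_iff) auto
  have four: "fourier_sum p 5 t = fcos p 0 / (2*pi) + fcos p 1 / pi * cos t + fsin p 1 / pi * sin t
     + fcos p 3 / pi * cos (3 * t) + fsin p 3 / pi * sin (3 * t) + fcos p 5 / pi * cos (5 * t) + fsin p 5 / pi * sin (5 * t)" for t
  proof -
    have "fcos p 2 = 0" "fsin p 2 = 0" "fcos p 4 = 0" "fsin p 4 = 0"
      using assms[of 2] assms[of 4] by (auto simp: energy_eq_0_iff)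
    moreover have "{1..5} = {1, 2, 3, 4, 5::nat}" by auto
    ultimately show ?thesis by (simp add: fourier_sum_def)
  qed
  have "p t = fourier_sum p 5 t" for t
  proof -
    obtain d k where dk: "0 \<le> d" "d < 2*pi" "t = 0 + d + 2 * pi * of_int k"
      using angle_reduce[where a = 0 and t = t] by blast
    have per5: "fourier_sum p 5 (d + 2 * pi * of_int k) = fourier_sum p 5 d"
    proof -
      have "cos (real m * (d + 2 * pi * of_int k)) = cos (real m * d)"
        "sin (real m * (d + 2 * pi * of_int k)) = sin (real m * d)" for m
      proof -
        have "real m * (d + 2 * pi * of_int k) = real m * d + 2 * pi * of_int (int m * k)"
          by (simp add: algebra_simps)
        then show "cos (real m * (d + 2 * pi * of_int k)) = cos (real m * d)"
          "sin (real m * (d + 2 * pi * of_int k)) = sin (real m * d)"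
          by (simp_all only: cos_add sin_add sin_int_2pin cos_int_2pin mult_1_right mult_zero_right diff_0_right add_0_right)
      qed
      then show ?thesis by (simp only: fourier_sum_def)
    qed
    have "p d = fourier_sum p 5 d" using z dk by auto
    then show ?thesis using per_int(1)[of d k] per5 dk(3) by simp
  qed
  then have "p = (\<lambda>t. fcos p 0 / (2*pi) + fcos p 1 / pi * cos t + fsin p 1 / pi * sin t
     + fcos p 3 / pi * cos (3 * t) + fsin p 3 / pi * sin (3 * t) + fcos p 5 / pi * cos (5 * t) + fsin p 5 / pi * sin (5 * t))"
    using four by (simp add: fun_eq_iff)
  then show ?thesis unfolding low_spectrum_def by blast
qed

section \<open>Deficit, evolute area and visual angle integral as series\<close>

definition evolute_integral where "evolute_integral = 1/2 * circ (\<lambda>x. (p1 x)^2 - (p2 x)^2)"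
text \<open>Indexed to match the series without the constant term: index \<open>n\<close> is
  harmonic \<open>n + 1\<close>, so the harmonics 1, 3 and 5 have the indices 0, 2 and 4, and odd
  indices are even harmonics.\<close>

definition mode_energy where "mode_energy n = energy p (Suc n)"

lemma mode_energy_nonneg: "mode_energy n \<ge> 0"
  by (simp add: mode_energy_def energy_nonneg)

text \<open>Parseval for \<open>p\<close>, \<open>p'\<close> and \<open>p''\<close>, each derivative
  multiplying the energy by the squared frequency. In the deficit, the length is the constant term
  that Parseval splits off.\<close>

lemma series:
  "(\<lambda>n. ((real (Suc n))^2 - 1) * mode_energy n) sums ((perim^2 - 4 * pi * area_integral) / (2*pi))"
  "(\<lambda>n. ((real (Suc n))^4 - (real (Suc n))^2) * mode_energy n) sums (- 2 * evolute_integral)"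
proof -
  have e1: "energy p1 n = (real n)^2 * energy p n" for n
    by (rule energy_deriv[OF p p1_cont per])
  have e2: "energy p2 n = (real n)^2 * energy p1 n" for n
    by (rule energy_deriv[OF p1 p2_cont per1])
  have z: "fcos p1 0 = 0" "fcos p2 0 = 0"
    using fcos_deriv(1)[OF p p1_cont per, of 0] fcos_deriv(1)[OF p1 p2_cont per1, of 0] by auto
  have s0: "mode_energy sums (circ (\<lambda>t. (p t)^2) - perim^2 / (2*pi))"
    using parseval[OF p_cont per] by (simp add: mode_energy_def[abs_def] perim_def fcos_0)
  have s1: "(\<lambda>n. (real (Suc n))^2 * mode_energy n) sums (circ (\<lambda>t. (p1 t)^2))"
    using parseval[OF p1_cont per1] unfolding e1 z by (simp add: mode_energy_def[abs_def])
  have s2: "(\<lambda>n. (real (Suc n))^2 * ((real (Suc n))^2 * mode_energy n)) sums (circ (\<lambda>t. (p2 t)^2))"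
    using parseval[OF p2_cont per2] unfolding e2 e1 z by (simp add: mode_energy_def[abs_def])
  have F: "circ (\<lambda>x. (p x)^2 - (p1 x)^2) = circ (\<lambda>t. (p t)^2) - circ (\<lambda>t. (p1 t)^2)"
    "circ (\<lambda>x. (p1 x)^2 - (p2 x)^2) = circ (\<lambda>t. (p1 t)^2) - circ (\<lambda>t. (p2 t)^2)"
    by (intro hk_diff integrable_cont continuous_intros p_conts)+
  have "(\<lambda>n. (real (Suc n))^2 * mode_energy n - mode_energy n) sums (circ (\<lambda>t. (p1 t)^2) - (circ (\<lambda>t. (p t)^2) - perim^2 / (2*pi)))"
    by (rule sums_diff[OF s1 s0])
  moreover have "circ (\<lambda>t. (p1 t)^2) - (circ (\<lambda>t. (p t)^2) - perim^2 / (2*pi)) = (perim^2 - 4 * pi * area_integral) / (2*pi)"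
    unfolding area_integral_def F by (simp add: field_simps)
  ultimately show "(\<lambda>n. ((real (Suc n))^2 - 1) * mode_energy n) sums ((perim^2 - 4 * pi * area_integral) / (2*pi))"
    by (simp only: left_diff_distrib mult_1)
  have "(\<lambda>n. (real (Suc n))^2 * ((real (Suc n))^2 * mode_energy n) - (real (Suc n))^2 * mode_energy n) sums
     (circ (\<lambda>t. (p2 t)^2) - circ (\<lambda>t. (p1 t)^2))"
    by (rule sums_diff[OF s2 s1])
  moreover have "circ (\<lambda>t. (p2 t)^2) - circ (\<lambda>t. (p1 t)^2) = - 2 * evolute_integral"
    unfolding evolute_integral_def F by simp
  moreover have "(real (Suc n))^2 * ((real (Suc n))^2 * mode_energy n) = (real (Suc n))^4 * mode_energy n" for n
    by (simp only: mult.assoc[symmetric] power_add[symmetric]) simp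
  ultimately show "(\<lambda>n. ((real (Suc n))^4 - (real (Suc n))^2) * mode_energy n) sums (- 2 * evolute_integral)"
    by (simp only: left_diff_distrib)
qed

lemma evolute_integral_nonpos: "evolute_integral \<le> 0"
proof -
  have "0 \<le> ((real (Suc n))^4 - (real (Suc n))^2) * mode_energy n" for n
    by (intro mult_nonneg_nonneg mode_energy_nonneg) (simp add: power_increasing del: of_nat_Suc)
  then have "0 \<le> - 2 * evolute_integral" by (rule sums_le[OF _ sums_zero series(2)])
  then show ?thesis by simp
qed

end

lemma large_square: assumes "n \<ge> k" shows "(real (Suc n))^2 \<ge> (real (Suc k))^2"
  using assms by (intro power_mono) auto

lemma sums_zero_iff:
  fixes f :: "nat \<Rightarrow> real"
  assumes "f sums s" "\<And>n. 0 \<le> f n" shows "s \<ge> 0" "s = 0 \<longleftrightarrow> (\<forall>n. f n = 0)"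
proof -
  have f: "summable f" "s = suminf f" using assms(1) by (auto simp: sums_iff)
  show "s \<ge> 0" unfolding f(2) by (rule suminf_nonneg[OF f(1) assms(2)])
  show "s = 0 \<longleftrightarrow> (\<forall>n. f n = 0)" unfolding f(2) by (rule suminf_eq_zero_iff[OF f(1) assms(2)])
qed

context constant_width_support
begin

text \<open>A half turn fixes the even harmonics and sends \<open>p\<close> to \<open>w - p\<close>.
  The constant \<open>w\<close> has no coefficient of order \<open>n > 0\<close>, so each
  coefficient equals its own negative.\<close>

lemma even_energy:
  assumes "even n" "n \<noteq> 0" shows "energy p n = 0"
proof -
  have cs: "cos (real n * (x + pi)) = cos (real n * x)" "sin (real n * (x + pi)) = sin (real n * x)" for x
  proof -
    obtain m where "n = 2 * m" using assms(1) by (elim evenE)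
    then have "real n * (x + pi) = real n * x + 2 * pi * of_int (int m)" by (simp add: algebra_simps)
    then show "cos (real n * (x + pi)) = cos (real n * x)" "sin (real n * (x + pi)) = sin (real n * x)"
      by (simp_all only: cos_add sin_add sin_int_2pin cos_int_2pin mult_1_right mult_zero_right diff_0_right add_0_right)
  qed
  have np: "real n * (x + 2*pi) = real n * ((x + pi) + pi)" for x by (simp add: algebra_simps)
  have shift: "p (x + 2*pi) * cos (real n * (x + 2*pi)) = p x * cos (real n * x)"
    "p (x + 2*pi) * sin (real n * (x + 2*pi)) = p x * sin (real n * x)" for x
    by (simp_all only: per np cs)
  have pw: "p (x + pi) = w - p x" for x using width[of x] by simp
  have "circ (\<lambda>x. p (x + pi) * cos (real n * (x + pi))) = fcos p n"
    unfolding fcos_def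
    by (rule periodic_shift_integral[of "\<lambda>x. p x * cos (real n * x)"], intro continuous_intros p_conts, rule shift(1), auto)
  moreover have "circ (\<lambda>x. p (x + pi) * cos (real n * (x + pi))) = fcos (\<lambda>x. w + (-1) * p x) n"
    unfolding cs pw fcos_def by simp
  moreover have "fcos (\<lambda>x. w + (-1) * p x) n = - fcos p n"
    using assms(2) by (subst fcos_add) (auto intro!: continuous_intros p_conts simp: fcos_const fcos_scale[of "-1", simplified])
  ultimately have c: "fcos p n = 0" by simp
  have "circ (\<lambda>x. p (x + pi) * sin (real n * (x + pi))) = fsin p n"
    unfolding fsin_def
    by (rule periodic_shift_integral[of "\<lambda>x. p x * sin (real n * x)"], intro continuous_intros p_conts, rule shift(2), auto)
  moreover have "circ (\<lambda>x. p (x + pi) * sin (real n * (x + pi))) = fsin (\<lambda>x. w + (-1) * p x) n"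
    unfolding cs pw fsin_def by simp
  moreover have "fsin (\<lambda>x. w + (-1) * p x) n = - fsin p n"
    using assms(2) by (subst fsin_add) (auto intro!: continuous_intros p_conts simp: fsin_const fsin_scale[of "-1", simplified])
  ultimately have "fsin p n = 0" by simp
  with c show ?thesis by (simp add: energy_def)
qed

lemma mode_energy_odd: "odd n \<Longrightarrow> mode_energy n = 0"
  using even_energy[of "Suc n"] by (simp add: mode_energy_def)

text \<open>The left- and right-hand sides of the inequality, and the terms of their Fourier series up to a positive factor.\<close>

definition gap where "gap = 4/9 * pi * \<bar>evolute_integral\<bar> - (perim^2 - 4 * pi * area_integral)"
definition vis where "vis = 64/9 * (perim^2 / 4 - 4 * pi * energy p 3 - pi * area_integral)"

definition gap_term where "gap_term n = ((real (Suc n))^2 - 1) * ((real (Suc n))^2 - 9) * mode_energy n"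
definition vis_term where "vis_term n = (if n = 2 then 0 else ((real (Suc n))^2 - 1) * mode_energy n)"

text \<open>With \<open>N\<close> the squared frequency,
  \<open>(N^2 - N) - 9 (N - 1) = (N - 1) (N - 9)\<close>. The absolute value in \<open>gap\<close>
  is resolved by the sign of the evolute integral.\<close>

lemma gap_sums: "gap_term sums (9 / (2*pi) * gap)"
proof -
  have "(\<lambda>n. ((real (Suc n))^4 - (real (Suc n))^2) * mode_energy n - 9 * (((real (Suc n))^2 - 1) * mode_energy n)) sums
     (- 2 * evolute_integral - 9 * ((perim^2 - 4 * pi * area_integral) / (2*pi)))"
    by (intro sums_diff sums_mult series)
  moreover have "- 2 * evolute_integral - 9 * ((perim^2 - 4 * pi * area_integral) / (2*pi)) = 9 / (2*pi) * gap"
    using evolute_integral_nonpos by (simp add: gap_def field_simps)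
  moreover have "((real (Suc n))^4 - (real (Suc n))^2) * mode_energy n - 9 * (((real (Suc n))^2 - 1) * mode_energy n) = gap_term n" for n
    unfolding gap_term_def by algebra
  ultimately show ?thesis by simp
qed

text \<open>The term \<open>energy p 3\<close> of \<open>vis\<close> cancels the third harmonic of
  the deficit, whose weight is \<open>3^2 - 1 = 8\<close>.\<close>

lemma vis_sums: "vis_term sums (9 / (32*pi) * vis)"
proof -
  have "(\<lambda>n. if n = 2 then 8 * mode_energy 2 else 0) sums (8 * mode_energy 2)"
    using sums_single[of 2 "\<lambda>n. 8 * mode_energy 2"] by simp
  then have "(\<lambda>n. ((real (Suc n))^2 - 1) * mode_energy n - (if n = 2 then 8 * mode_energy 2 else 0)) sums
     ((perim^2 - 4 * pi * area_integral) / (2*pi) - 8 * mode_energy 2)"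
    by (intro sums_diff series)
  moreover have "(perim^2 - 4 * pi * area_integral) / (2*pi) - 8 * mode_energy 2 = 9 / (32*pi) * vis"
    by (simp add: vis_def mode_energy_def eval_nat_numeral field_simps)
  moreover have "((real (Suc n))^2 - 1) * mode_energy n - (if n = 2 then 8 * mode_energy 2 else 0) = vis_term n" for n
    by (simp add: vis_term_def)
  ultimately show ?thesis by simp
qed

text \<open>The difference of the terms is \<open>(N - 1) (N - 25) * mode_energy n\<close> outside
  index 2, where both terms vanish. Index 0 has \<open>N = 1\<close>, index 4 has
  \<open>N = 25\<close>, odd indices carry no energy, and from index 6 on \<open>N \<ge> 49\<close>
  makes all factors positive.\<close>

lemma gap_term_cases:
  shows "0 \<le> gap_term n" "0 \<le> vis_term n" "16 * vis_term n \<le> gap_term n"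
    "gap_term n = 0 \<longleftrightarrow> vis_term n = 0" "16 * vis_term n = gap_term n \<longleftrightarrow> n \<in> {0, 2, 4} \<or> mode_energy n = 0"
proof -
  have "odd n \<or> n = 0 \<or> n = 2 \<or> n = 4 \<or> (n \<ge> 6 \<and> even n)" by presburger
  then have "0 \<le> gap_term n \<and> 0 \<le> vis_term n \<and> 16 * vis_term n \<le> gap_term n \<and>
    (gap_term n = 0 \<longleftrightarrow> vis_term n = 0) \<and> (16 * vis_term n = gap_term n \<longleftrightarrow> n \<in> {0, 2, 4} \<or> mode_energy n = 0)"
  proof (elim disjE)
    assume "odd n" then show ?thesis by (simp add: gap_term_def vis_term_def mode_energy_odd)
  next
    assume n: "n \<ge> 6 \<and> even n"
    have q: "(real (Suc n))^2 \<ge> 49" using large_square[of 6 n] n by simp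
    define N where "N = (real (Suc n))^2"
    have N: "N \<ge> 49" using q by (simp add: N_def)
    have g: "gap_term n = (N - 1) * (N - 9) * mode_energy n" "vis_term n = (N - 1) * mode_energy n"
      using n by (auto simp: gap_term_def vis_term_def N_def)
    have d: "gap_term n = 16 * vis_term n + (N - 1) * (N - 25) * mode_energy n" unfolding g by algebra
    have "0 \<le> (N - 1) * (N - 9) * mode_energy n" "0 \<le> (N - 1) * mode_energy n" "0 \<le> (N - 1) * (N - 25) * mode_energy n"
      by (intro mult_nonneg_nonneg mode_energy_nonneg; use N in simp)+
    moreover have "(N - 1) * (N - 9) * mode_energy n = 0 \<longleftrightarrow> mode_energy n = 0" "(N - 1) * mode_energy n = 0 \<longleftrightarrow> mode_energy n = 0"
      "(N - 1) * (N - 25) * mode_energy n = 0 \<longleftrightarrow> mode_energy n = 0" using N by simp_all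
    moreover have "16 * vis_term n = gap_term n \<longleftrightarrow> (N - 1) * (N - 25) * mode_energy n = 0" using d by linarith
    ultimately show ?thesis using d g n by auto
  qed (use mode_energy_nonneg[of 4] mode_energy_nonneg[of 0] in \<open>auto simp: gap_term_def vis_term_def\<close>)
  then show "0 \<le> gap_term n" "0 \<le> vis_term n" "16 * vis_term n \<le> gap_term n"
    "gap_term n = 0 \<longleftrightarrow> vis_term n = 0" "16 * vis_term n = gap_term n \<longleftrightarrow> n \<in> {0, 2, 4} \<or> mode_energy n = 0"
    by auto
qed

theorem gap_vis:
  "vis \<ge> 0" "gap \<ge> vis" "gap = 0 \<longleftrightarrow> vis = 0" "gap = vis \<longleftrightarrow> low_spectrum p"
proof -
  note g = sums_zero_iff[OF gap_sums gap_term_cases(1)]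
  note v = sums_zero_iff[OF vis_sums gap_term_cases(2)]
  have "(\<lambda>n. gap_term n - 16 * vis_term n) sums (9 / (2*pi) * gap - 16 * (9 / (32*pi) * vis))"
    by (intro sums_diff sums_mult gap_sums vis_sums)
  moreover have "9 / (2*pi) * gap - 16 * (9 / (32*pi) * vis) = 9 / (2*pi) * (gap - vis)"
    by (simp add: field_simps)
  ultimately have d: "(\<lambda>n. gap_term n - 16 * vis_term n) sums (9 / (2*pi) * (gap - vis))" by simp
  have d0: "0 \<le> gap_term n - 16 * vis_term n" for n using gap_term_cases(3)[of n] by simp
  note dz = sums_zero_iff[OF d d0]
  show "vis \<ge> 0" using v(1) by (simp add: zero_le_mult_iff zero_le_divide_iff) (use pi_gt_zero in linarith)
  show "gap \<ge> vis" using dz(1) by (simp add: zero_le_mult_iff zero_le_divide_iff) (use pi_gt_zero in linarith)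
  show "gap = 0 \<longleftrightarrow> vis = 0" using g(2) v(2) gap_term_cases(4) by simp
  have "gap = vis \<longleftrightarrow> (\<forall>n. gap_term n - 16 * vis_term n = 0)" using dz(2) by simp
  also have "\<dots> \<longleftrightarrow> (\<forall>n. n \<in> {0, 2, 4} \<or> mode_energy n = 0)"
    using gap_term_cases(5) by (metis eq_iff_diff_eq_0)
  also have "\<dots> \<longleftrightarrow> low_spectrum p"
  proof
    assume *: "\<forall>n. n \<in> {0, 2, 4} \<or> mode_energy n = 0"
    show "low_spectrum p"
    proof (rule low_spectrum_if_energy)
      fix n :: nat assume n: "n \<notin> {0, 1, 3, 5}"
      then obtain m where "n = Suc m" by (cases n) auto
      then show "energy p n = 0" using * n by (auto simp: mode_energy_def dest!: spec[of _ m])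
    qed
  next
    assume "low_spectrum p"
    then show "\<forall>n. n \<in> {0, 2, 4} \<or> mode_energy n = 0"
      using low_spectrum_energy[of p "Suc n" for n] by (auto simp: mode_energy_def)
  qed
  finally show "gap = vis \<longleftrightarrow> low_spectrum p" .
qed

end

section \<open>The equality case\<close>

lemma low_spectrumI:
  "low_spectrum (\<lambda>t. c + a * cos t + b * sin t
     + a3 * cos (3 * t) + b3 * sin (3 * t) + a5 * cos (5 * t) + b5 * sin (5 * t))"
  unfolding low_spectrum_def by blast

lemma low_spectrum_add:
  assumes "low_spectrum f" "low_spectrum g" shows "low_spectrum (\<lambda>t. f t + g t)"
proof -
  obtain c a b a3 b3 a5 b5 where f: "f = (\<lambda>t. c + a * cos t + b * sin t
     + a3 * cos (3 * t) + b3 * sin (3 * t) + a5 * cos (5 * t) + b5 * sin (5 * t))"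
    using assms(1) by (auto simp: low_spectrum_def)
  obtain c' a' b' a3' b3' a5' b5' where g: "g = (\<lambda>t. c' + a' * cos t + b' * sin t
     + a3' * cos (3 * t) + b3' * sin (3 * t) + a5' * cos (5 * t) + b5' * sin (5 * t))"
    using assms(2) by (auto simp: low_spectrum_def)
  have "(\<lambda>t. f t + g t) = (\<lambda>t. (c + c') + (a + a') * cos t + (b + b') * sin t
     + (a3 + a3') * cos (3 * t) + (b3 + b3') * sin (3 * t) + (a5 + a5') * cos (5 * t) + (b5 + b5') * sin (5 * t))"
    unfolding f g by (rule ext) algebra
  then show ?thesis by (simp only: low_spectrumI)
qed

text \<open>The harmonics of orders 1, 3 and 5 change sign under a half turn, so only the constant
  term is reversed. This is the support function of the same curve traced with the opposite
  normal.\<close>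

lemma low_spectrum_antipodal:
  assumes "low_spectrum f" shows "low_spectrum (\<lambda>t. - f (t - pi))"
proof -
  obtain c a b a3 b3 a5 b5 where f: "f = (\<lambda>t. c + a * cos t + b * sin t
     + a3 * cos (3 * t) + b3 * sin (3 * t) + a5 * cos (5 * t) + b5 * sin (5 * t))"
    using assms(1) by (auto simp: low_spectrum_def)
  have s: "sin (3 * pi) = 0" "cos (3 * pi) = -1" "sin (5 * pi) = 0" "cos (5 * pi) = -1"
    using sin_npi[of 3] cos_npi[of 3] sin_npi[of 5] cos_npi[of 5] by simp_all
  have "(\<lambda>t. - f (t - pi)) = (\<lambda>t. (- c) + a * cos t + b * sin t
     + a3 * cos (3 * t) + b3 * sin (3 * t) + a5 * cos (5 * t) + b5 * sin (5 * t))"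
    unfolding f right_diff_distrib cos_diff sin_diff s by (simp add: fun_eq_iff)
  then show ?thesis by (simp only: low_spectrumI)
qed

lemma low_spectrum_steiner:
  assumes "parallel_to_steiner f" shows "low_spectrum f"
proof -
  obtain c a b A t0 where "f = (\<lambda>t. c + a * cos t + b * sin t + A * sin (3 * (t - t0)))"
    using assms by (auto simp: parallel_to_steiner_def)
  then have "f = (\<lambda>t. c + a * cos t + b * sin t
     + (- A * sin (3 * t0)) * cos (3 * t) + (A * cos (3 * t0)) * sin (3 * t) + 0 * cos (5 * t) + 0 * sin (5 * t))"
    by (simp add: right_diff_distrib sin_diff algebra_simps)
  then show ?thesis by (simp only: low_spectrumI)
qed

lemma low_spectrum_five_cusped:
  assumes "parallel_to_five_cusped f" shows "low_spectrum f"
proof -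
  obtain c a b A t0 where "f = (\<lambda>t. c + a * cos t + b * sin t + A * sin (5 * (t - t0)))"
    using assms by (auto simp: parallel_to_five_cusped_def)
  then have "f = (\<lambda>t. c + a * cos t + b * sin t
     + 0 * cos (3 * t) + 0 * sin (3 * t) + (- A * sin (5 * t0)) * cos (5 * t) + (A * cos (5 * t0)) * sin (5 * t))"
    by (simp add: right_diff_distrib sin_diff algebra_simps)
  then show ?thesis by (simp only: low_spectrumI)
qed

lemma low_spectrum_circle:
  "low_spectrum (\<lambda>t. r + a * cos t + b * sin t)"
  using low_spectrumI[of r a b 0 0 0 0] by simp

lemma low_spectrum_sum_list:
  assumes "\<forall>f\<in>set fs. circle_support f \<or> parallel_to_steiner f \<or> parallel_to_five_cusped f"
  shows "low_spectrum (\<lambda>t. \<Sum>f\<leftarrow>fs. f t)"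
  using assms
proof (induction fs)
  case Nil
  show ?case using low_spectrum_circle[of 0 0 0] by simp
next
  case (Cons f fs)
  then have "low_spectrum f"
    using low_spectrum_steiner low_spectrum_five_cusped low_spectrum_circle by (auto simp: circle_support_def)
  then show ?case using Cons by (simp add: low_spectrum_add)
qed

section \<open>Recovering the support function from the frontier\<close>

lemma deriv_zero_on_open:
  fixes k :: "real \<Rightarrow> real"
  assumes "open U" "\<And>t. t \<in> U \<Longrightarrow> k t = 0" "\<And>t. (k has_field_derivative k' t) (at t)" "t \<in> U"
  shows "k' t = 0"
proof -
  have "((\<lambda>t. 0) has_field_derivative k' t) (at t)"
    by (rule has_field_derivative_transform_within_open[OF assms(3) assms(1) assms(4)]) (simp add: assms(2))
  then show ?thesis using DERIV_unique DERIV_const by blast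
qed

text \<open>The two harmonics \<open>u\<close> and \<open>v\<close> satisfy
  \<open>u'' = - 9 u\<close> and \<open>v'' = - 25 v\<close>. Four differentiations therefore give
  linear equations that force \<open>u\<close>, \<open>v\<close>, their first derivatives and the
  constant to vanish at a point.\<close>

lemma trig_zero_on_open:
  fixes c a3 b3 a5 b5 :: real
  assumes U: "open U" "U \<noteq> {}"
    and z: "\<And>t. t \<in> U \<Longrightarrow> c + a3 * cos (3 * t) + b3 * sin (3 * t) + a5 * cos (5 * t) + b5 * sin (5 * t) = 0"
  shows "c = 0 \<and> a3 = 0 \<and> b3 = 0 \<and> a5 = 0 \<and> b5 = 0"
proof -
  obtain t where t: "t \<in> U" using U by auto
  define u v u' v' where "u = (\<lambda>t. a3 * cos (3 * t) + b3 * sin (3 * t))" and "v = (\<lambda>t. a5 * cos (5 * t) + b5 * sin (5 * t))"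
    and "u' = (\<lambda>t. 3 * (b3 * cos (3 * t) - a3 * sin (3 * t)))" and "v' = (\<lambda>t. 5 * (b5 * cos (5 * t) - a5 * sin (5 * t)))"
  have du: "(u has_field_derivative u' t) (at t)" "(u' has_field_derivative - 9 * u t) (at t)"
    "(v has_field_derivative v' t) (at t)" "(v' has_field_derivative - 25 * v t) (at t)" for t
    unfolding u_def v_def u'_def v'_def by (auto intro!: derivative_eq_intros simp: algebra_simps)
  have e0: "c + u t + v t = 0" if "t \<in> U" for t using z[OF that] by (simp add: u_def v_def)
  have e1: "u' t + v' t = 0" if "t \<in> U" for t
    by (rule deriv_zero_on_open[OF U(1) e0 _ that]) (auto intro!: derivative_eq_intros du)
  have e2: "- 9 * u t + - 25 * v t = 0" if "t \<in> U" for t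
    by (rule deriv_zero_on_open[OF U(1) e1 _ that]) (auto intro!: derivative_eq_intros du)
  have e3: "- 9 * u' t + - 25 * v' t = 0" if "t \<in> U" for t
    by (rule deriv_zero_on_open[OF U(1) e2 _ that]) (auto intro!: derivative_eq_intros du)
  have e4: "- 9 * (- 9 * u t) + - 25 * (- 25 * v t) = 0" if "t \<in> U" for t
    by (rule deriv_zero_on_open[OF U(1) e3 _ that]) (auto intro!: derivative_eq_intros du)
  have zero: "u t = 0" "v t = 0" "u' t = 0" "v' t = 0" "c = 0"
    using e0[OF t] e1[OF t] e2[OF t] e3[OF t] e4[OF t] by linarith+
  \<comment> \<open>The amplitude is recovered from value and slope at one point.\<close>
  have "(3 * u t)^2 + (u' t)^2 = 9 * (a3^2 + b3^2) * ((sin (3 * t))^2 + (cos (3 * t))^2)"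
    unfolding u_def u'_def by algebra
  moreover have "(5 * v t)^2 + (v' t)^2 = 25 * (a5^2 + b5^2) * ((sin (5 * t))^2 + (cos (5 * t))^2)"
    unfolding v_def v'_def by algebra
  ultimately have "9 * (a3^2 + b3^2) = 0" "25 * (a5^2 + b5^2) = 0" using zero by simp_all
  then have "a3^2 + b3^2 = 0" "a5^2 + b5^2 = 0"
    by (simp_all only: mult_eq_0_iff) simp_all
  then show ?thesis using zero by (simp add: sum_power2_eq_zero_iff)
qed

lemma sin_zero_parity:
  assumes "sin (s - t :: real) = 0"
  obtains k :: int where "s = t + 2 * pi * of_int k" | k :: int where "s = t + pi + 2 * pi * of_int k"
proof -
  obtain i :: int where i: "s - t = of_int i * pi" using assms by (auto simp: sin_zero_iff_int2)
  show thesis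
  proof (cases "even i")
    case True
    then obtain k where "i = 2 * k" by (elim evenE)
    then show ?thesis using that(1)[of k] i by (simp add: algebra_simps)
  next
    case False
    then obtain k where "i = 2 * k + 1" by (elim oddE)
    then show ?thesis using that(2)[of k] i by (simp add: algebra_simps)
  qed
qed

lemma harmonic_amplitude:
  fixes \<alpha> \<beta> :: real
  assumes "(\<alpha>, \<beta>) \<noteq> (0, 0)" "m > 0"
  obtains A t0 where "A > 0" "\<And>t. \<alpha> * cos (m * t) + \<beta> * sin (m * t) = A * sin (m * (t - t0))"
proof -
  define A where "A = sqrt (\<alpha>^2 + \<beta>^2)"
  have "0 < \<alpha>^2 + \<beta>^2" using assms(1) by (simp add: sum_power2_gt_zero_iff)
  then have A: "A > 0" "A^2 = \<alpha>^2 + \<beta>^2" by (simp_all add: A_def)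
  have "(\<beta> / A)^2 + (- \<alpha> / A)^2 = (\<alpha>^2 + \<beta>^2) / A^2"
    by (simp add: power_divide add_divide_distrib)
  also have "\<dots> = 1" unfolding A(2)[symmetric] using A(1) by simp
  finally have "(\<beta> / A)^2 + (- \<alpha> / A)^2 = 1" .
  then obtain u where u: "\<beta> / A = cos u" "- \<alpha> / A = sin u" using sincos_total_2pi by metis
  then have ab: "\<beta> = A * cos u" "\<alpha> = - A * sin u" using A(1) by (auto simp: field_simps)
  have "\<alpha> * cos (m * t) + \<beta> * sin (m * t) = A * sin (m * (t - u / m))" for t
    using assms(2) unfolding ab by (simp add: right_diff_distrib sin_diff algebra_simps)
  then show thesis using that A(1) by blast
qed

context body
begin

text \<open>Where the envelope of \<open>f\<close> is regular, its tangent at angle \<open>t\<close> is the tangent of the frontier, so the point is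
  \<open>gam t\<close> or \<open>gam (t + pi)\<close>; the regular parameters are dense, and by connectedness the same alternative holds
  throughout. The second one occurs, since \<open>c\<close> may be negative in the curves of the statement.\<close>

lemma low_spectrum_if_frontier:
  assumes f: "low_spectrum f" and fr: "frontier K = env_curve f"
  shows "low_spectrum p"
proof -
  obtain c a b a3 b3 a5 b5 where f_eq: "f = (\<lambda>t. c + a * cos t + b * sin t
     + a3 * cos (3 * t) + b3 * sin (3 * t) + a5 * cos (5 * t) + b5 * sin (5 * t))"
    using f by (auto simp: low_spectrum_def)
  define f1 where "f1 = (\<lambda>t. b * cos t - a * sin t + 3 * (b3 * cos (3 * t) - a3 * sin (3 * t))
     + 5 * (b5 * cos (5 * t) - a5 * sin (5 * t)))"
  define f2 where "f2 = (\<lambda>t. - a * cos t - b * sin t - 9 * (a3 * cos (3 * t) + b3 * sin (3 * t))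
     - 25 * (a5 * cos (5 * t) + b5 * sin (5 * t)))"
  have d1: "(f has_field_derivative f1 t) (at t)" for t
    unfolding f_eq f1_def by (auto intro!: derivative_eq_intros simp: algebra_simps)
  have d2: "(f1 has_field_derivative f2 t) (at t)" for t
    unfolding f1_def f2_def by (auto intro!: derivative_eq_intros simp: algebra_simps)
  have env: "env_point f t = f t *\<^sub>R nvec t + f1 t *\<^sub>R tvec t" for t
    using DERIV_imp_deriv[OF d1] by (simp add: env_point_def)
  \<comment> \<open>Up to sign the radius of curvature of the envelope, so its zeros are the
    singular parameters; the order 1 harmonics cancel in it. It hides the \<open>h\<close> of the
    locale.\<close>
  define h where "h = (\<lambda>t. f t + f2 t)"
  have h_eq: "h t = c + (- 8 * a3) * cos (3 * t) + (- 8 * b3) * sin (3 * t) + (- 24 * a5) * cos (5 * t) + (- 24 * b5) * sin (5 * t)" for t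
    unfolding h_def f_eq f2_def by algebra
  have alt: "f t = p t \<or> f t = - p (t + pi)" if ht: "h t \<noteq> 0" for t
  proof -
    have on: "env_point f \<tau> \<in> range gam" for \<tau>
      using fr unfolding frontier_K env_curve_def by (metis rangeI)
    obtain s where s: "env_point f t = gam s" using on[of t] by auto
    have inner_n: "env_point f \<tau> \<bullet> nvec s = f \<tau> * cos (s - \<tau>) + f1 \<tau> * sin (s - \<tau>)" for \<tau>
      by (simp add: env inner_add_left frame_inner)
    have "((\<lambda>\<tau>. f \<tau> * cos (s - \<tau>) + f1 \<tau> * sin (s - \<tau>)) has_field_derivative h t * sin (s - t)) (at t)"
      by (auto intro!: derivative_eq_intros d1 d2 simp: h_def algebra_simps)
    \<comment> \<open>The point at parameter \<open>t\<close> is \<open>gam s\<close>, which is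
      extremal in direction \<open>nvec s\<close> among all points of the frontier; so the
      derivative found above must vanish at \<open>t\<close>.\<close>
    moreover have "f \<tau> * cos (s - \<tau>) + f1 \<tau> * sin (s - \<tau>) \<le> f t * cos (s - t) + f1 t * sin (s - t)" for \<tau>
    proof -
      obtain r where "env_point f \<tau> = gam r" using on by auto
      then have "env_point f \<tau> \<bullet> nvec s \<le> p s" using gam_le by simp
      moreover have "env_point f t \<bullet> nvec s = p s" using s gam_inner0 by simp
      ultimately show ?thesis unfolding inner_n by simp
    qed
    ultimately have "h t * sin (s - t) = 0"
      using DERIV_local_max[of "\<lambda>\<tau>. f \<tau> * cos (s - \<tau>) + f1 \<tau> * sin (s - \<tau>)" "h t * sin (s - t)" t 1] by auto
    then have "sin (s - t) = 0" using ht by simp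
    then show ?thesis
    proof (cases rule: sin_zero_parity)
      case (1 k)
      then have "env_point f t = gam t" using s gam_periodic by simp
      moreover have "env_point f t \<bullet> nvec t = f t" by (simp add: env inner_add_left frame_inner)
      ultimately show ?thesis using gam_inner0 by simp
    next
      case (2 k)
      then have "env_point f t = gam (t + pi)" using s gam_periodic[of "t + pi" k] by simp
      moreover have "env_point f t \<bullet> nvec t = f t" by (simp add: env inner_add_left frame_inner)
      moreover have "gam (t + pi) \<bullet> nvec t = - p (t + pi)"
        using gam_inner(1)[of "t + pi" "- pi"] by simp
      ultimately show ?thesis by simp
    qed
  qed
  define A B where "A = {t. f t = p t}" and "B = {t. f t = - p (t + pi)}"
  have f_cont: "continuous_on UNIV f" using d1 by (meson DERIV_isCont continuous_at_imp_continuous_on)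
  have closed: "closed A" "closed B"
    unfolding A_def B_def by (intro closed_Collect_eq f_cont continuous_intros p_conts)+
  have "\<not> (t \<in> A \<and> t \<in> B)" for t using width_pos[of t] by (auto simp: A_def B_def)
  then have disj: "A \<inter> B = {}" by blast
  have cover: "A \<union> B = UNIV"
  proof (rule ccontr)
    \<comment> \<open>Off both closed sets the curvature radius vanishes on an open set, hence
      identically. The envelope is then a single point, whereas the frontier has distinct points
      \<open>gam 0\<close> and \<open>gam pi\<close>.\<close>
    assume "A \<union> B \<noteq> UNIV"
    then have U: "open (- (A \<union> B))" "- (A \<union> B) \<noteq> {}" using closed by auto
    have "h t = 0" if "t \<in> - (A \<union> B)" for t using alt[of t] that by (auto simp: A_def B_def)
    then have "c = 0 \<and> - 8 * a3 = 0 \<and> - 8 * b3 = 0 \<and> - 24 * a5 = 0 \<and> - 24 * b5 = 0"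
      unfolding h_eq by (rule trig_zero_on_open[OF U])
    then have f_f1: "f t = a * cos t + b * sin t" "f1 t = b * cos t - a * sin t" for t
      by (auto simp: f_eq f1_def)
    have const: "env_point f t = vector [a, b]" for t
      unfolding env f_f1 using frame_expand[of "vector [a, b]" t] by (simp add: inner_nvec inner_tvec)
    have "gam 0 \<in> range (env_point f)" "gam pi \<in> range (env_point f)"
      using fr unfolding frontier_K env_curve_def by (metis rangeI)+
    then have "gam 0 = gam pi" using const by auto
    then show False using gam_less[of pi 0] gam_inner0(1)[of pi] by simp
  qed
  \<comment> \<open>The two closed sets are disjoint because the width is positive, and the line is
    connected.\<close>
  have "A = {} \<or> B = {}"
    using connected_closedD[OF connected_UNIV, of A B] closed disj cover by auto
  then consider "A = UNIV" | "B = UNIV" using cover by auto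
  then show ?thesis
  proof cases
    case 1
    then have "f t = p t" for t by (auto simp: A_def)
    then have "p = f" by auto
    then show ?thesis using f by simp
  next
    case 2
    then have "f t = - p (t + pi)" for t by (auto simp: B_def)
    from this[of "t - pi" for t] have "p = (\<lambda>t. - f (t - pi))" by auto
    then show ?thesis using low_spectrum_antipodal[OF f] by simp
  qed
qed

text \<open>The circle takes the whole constant term, which is positive because the width is,
  together with the translation. The harmonics of orders 3 and 5 become curves at distance 0; one of
  zero amplitude is left out of the list, since \<open>A > 0\<close> is demanded.\<close>

lemma minkowski_sum_of_curves_if_low:
  assumes "low_spectrum p" "deriv p = p1" shows "minkowski_sum_of_curves K"
proof -
  obtain c a b a3 b3 a5 b5 where p_eq: "p = (\<lambda>t. c + a * cos t + b * sin t
     + a3 * cos (3 * t) + b3 * sin (3 * t) + a5 * cos (5 * t) + b5 * sin (5 * t))"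
    using assms by (auto simp: low_spectrum_def)
  have "cos (3 * pi) = -1" "sin (3 * pi) = 0" "cos (5 * pi) = -1" "sin (5 * pi) = 0"
    using sin_npi[of 3] cos_npi[of 3] sin_npi[of 5] cos_npi[of 5] by simp_all
  then have c: "c > 0" using width_pos[of 0] by (simp add: p_eq)
  obtain fs3 where fs3: "\<forall>f\<in>set fs3. parallel_to_steiner f"
    "\<And>t. (\<Sum>f\<leftarrow>fs3. f t) = a3 * cos (3 * t) + b3 * sin (3 * t)"
  proof (cases "(a3, b3) = (0, 0)")
    case False
    then obtain A t0 where A: "A > 0" "\<And>t. a3 * cos (3 * t) + b3 * sin (3 * t) = A * sin (3 * (t - t0))"
      using harmonic_amplitude[of a3 b3 3] by auto
    then have "parallel_to_steiner (\<lambda>t. A * sin (3 * (t - t0)))"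
      unfolding parallel_to_steiner_def by (intro exI[of _ 0] exI[of _ A] exI[of _ t0]) simp
    then show ?thesis using that[of "[\<lambda>t. A * sin (3 * (t - t0))]"] A by simp
  qed (use that[of "[]"] in auto)
  obtain fs5 where fs5: "\<forall>f\<in>set fs5. parallel_to_five_cusped f"
    "\<And>t. (\<Sum>f\<leftarrow>fs5. f t) = a5 * cos (5 * t) + b5 * sin (5 * t)"
  proof (cases "(a5, b5) = (0, 0)")
    case False
    then obtain A t0 where A: "A > 0" "\<And>t. a5 * cos (5 * t) + b5 * sin (5 * t) = A * sin (5 * (t - t0))"
      using harmonic_amplitude[of a5 b5 5] by auto
    then have "parallel_to_five_cusped (\<lambda>t. A * sin (5 * (t - t0)))"
      unfolding parallel_to_five_cusped_def by (intro exI[of _ 0] exI[of _ A] exI[of _ t0]) simp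
    then show ?thesis using that[of "[\<lambda>t. A * sin (5 * (t - t0))]"] A by simp
  qed (use that[of "[]"] in auto)
  define fs where "fs = (\<lambda>t. c + a * cos t + b * sin t) # fs3 @ fs5"
  have "(\<lambda>t. \<Sum>f\<leftarrow>fs. f t) = p"
    by (simp add: fs_def fs3(2) fs5(2) p_eq add.assoc)
  moreover have "frontier K = env_curve p"
    unfolding frontier_K env_curve_def env_point_def gam_def[abs_def] assms(2) ..
  moreover have "circle_support (\<lambda>t. c + a * cos t + b * sin t)"
    unfolding circle_support_def using c by blast
  ultimately show ?thesis
    unfolding minkowski_sum_of_curves_def using fs3(1) fs5(1)
    by (intro exI[of _ fs]) (auto simp: fs_def)
qed

end

section \<open>Support functions of disks and of Minkowski sums\<close>

lemma supp_fun_cball: "r > 0 \<Longrightarrow> supp_fun (cball z r) = (\<lambda>t. r + z $ 1 * cos t + z $ 2 * sin t)"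
proof
  fix t assume r: "r > 0"
  have "(SUP x\<in>cball z r. x \<bullet> nvec t) = r + z \<bullet> nvec t"
  proof (rule cSup_eq_maximum)
    have "(z + r *\<^sub>R nvec t) \<bullet> nvec t = r + z \<bullet> nvec t" by (simp add: inner_add_left frame_inner)
    moreover have "z + r *\<^sub>R nvec t \<in> cball z r" using r by (simp add: dist_norm)
    ultimately show "r + z \<bullet> nvec t \<in> (\<lambda>x. x \<bullet> nvec t) ` cball z r" by (metis image_eqI)
    fix y assume "y \<in> (\<lambda>x. x \<bullet> nvec t) ` cball z r"
    then obtain x where x: "x \<in> cball z r" "y = x \<bullet> nvec t" by blast
    have "(x - z) \<bullet> nvec t \<le> norm (x - z) * norm (nvec t)" by (rule norm_cauchy_schwarz)
    then show "y \<le> r + z \<bullet> nvec t" using x by (simp add: dist_norm norm_minus_commute inner_diff_left)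
  qed
  then show "supp_fun (cball z r) t = r + z $ 1 * cos t + z $ 2 * sin t"
    by (simp add: supp_fun_def inner_nvec)
qed

lemma supp_fun_minkowski_sum:
  assumes "compact X" "X \<noteq> {}" "compact Y" "Y \<noteq> {}"
  shows "supp_fun (minkowski_sum X Y) = (\<lambda>t. supp_fun X t + supp_fun Y t)"
proof
  fix t
  have max: "\<exists>x\<in>Z. \<forall>y\<in>Z. y \<bullet> nvec t \<le> x \<bullet> nvec t" if "compact Z" "Z \<noteq> {}" for Z :: "(real^2) set"
    by (intro continuous_attains_sup that continuous_intros)
  have eq: "supp_fun Z t = x \<bullet> nvec t" if "x \<in> Z" "\<forall>y\<in>Z. y \<bullet> nvec t \<le> x \<bullet> nvec t" for x and Z :: "(real^2) set"
    unfolding supp_fun_def by (rule cSup_eq_maximum) (use that in auto)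
  obtain x where x: "x \<in> X" "\<forall>y\<in>X. y \<bullet> nvec t \<le> x \<bullet> nvec t" using max[OF assms(1,2)] by blast
  obtain y where y: "y \<in> Y" "\<forall>z\<in>Y. z \<bullet> nvec t \<le> y \<bullet> nvec t" using max[OF assms(3,4)] by blast
  have "supp_fun (minkowski_sum X Y) t = (x + y) \<bullet> nvec t"
    by (rule eq) (use x y in \<open>auto simp: minkowski_sum_def inner_add_left intro!: add_mono\<close>)
  then show "supp_fun (minkowski_sum X Y) t = supp_fun X t + supp_fun Y t"
    using eq[OF x] eq[OF y] by (simp add: inner_add_left)
qed

text \<open>Compactness and non-emptiness are carried through the induction because they make
  suprema attained, so that support functions add. The \<open>C2\<close> condition enters only at
  the basic bodies, where the frontier has to be interpreted.\<close>

lemma minkowski_sum_of_bodies_low: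
  assumes "minkowski_sum_of_bodies X"
  shows "compact X \<and> X \<noteq> {} \<and> low_spectrum (supp_fun X)"
  using assms
proof induction
  case (disk X)
  then obtain z r where "r > 0" "X = cball z r" by (auto simp: is_disk_def)
  then show ?case by (simp add: supp_fun_cball low_spectrum_circle)
next
  case (steiner X)
  interpret body "supp_fun X" "deriv (supp_fun X)" "deriv (deriv (supp_fun X))" X by (rule C2_body[OF steiner(1)])
  show ?case using steiner(2) compact nonempty low_spectrum_if_frontier low_spectrum_steiner
    by (auto simp: bounded_by_parallel_to_steiner_def)
next
  case (five_cusped X)
  interpret body "supp_fun X" "deriv (supp_fun X)" "deriv (deriv (supp_fun X))" X by (rule C2_body[OF five_cusped(1)])
  show ?case using five_cusped(2) compact nonempty low_spectrum_if_frontier low_spectrum_five_cusped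
    by (auto simp: bounded_by_parallel_to_five_cusped_def)
next
  case (sum X Y)
  have "compact (minkowski_sum X Y)" unfolding minkowski_sum_def using sum by (intro compact_sums) auto
  moreover have "minkowski_sum X Y \<noteq> {}" using sum by (auto simp: minkowski_sum_def)
  ultimately show ?case using sum by (simp add: supp_fun_minkowski_sum low_spectrum_add)
qed

text \<open>Every listed alternative implies a low spectrum; conversely a low spectrum always yields
  the last one, with summands that may be non-convex.\<close>

lemma equality_iff_low_spectrum:
  assumes "C2_strictly_convex K"
  shows "is_disk K \<or> bounded_by_parallel_to_steiner K \<or> bounded_by_parallel_to_five_cusped K \<or>
     minkowski_sum_of_bodies K \<or> minkowski_sum_of_curves K \<longleftrightarrow> low_spectrum (supp_fun K)"
proof -
  interpret body "supp_fun K" "deriv (supp_fun K)" "deriv (deriv (supp_fun K))" K by (rule C2_body[OF assms])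
  show ?thesis
    using minkowski_sum_of_bodies_low[of K] minkowski_sum_of_bodies.intros[of K] assms
      low_spectrum_if_frontier low_spectrum_sum_list minkowski_sum_of_curves_if_low
    unfolding minkowski_sum_of_curves_def by blast
qed

text \<open>Cauchy's formula: the boundary has speed \<open>p + p''\<close>, positive by strict
  convexity, and \<open>p''\<close> integrates to 0 over a period.\<close>

lemma perimeter_eq:
  assumes "C2_strictly_convex K"
  shows "perimeter K = circ (supp_fun K)"
proof -
  interpret body "supp_fun K" "deriv (supp_fun K)" "deriv (deriv (supp_fun K))" K by (rule C2_body[OF assms])
  define p p1 p2 where "p = supp_fun K" and "p1 = deriv (supp_fun K)" and "p2 = deriv (deriv (supp_fun K))"
  note d = p[folded p_def p1_def] p1[folded p1_def p2_def]
  have vd: "(env_point p has_vector_derivative (p t + p2 t) *\<^sub>R tvec t) (at t)" for t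
  proof -
    have "((\<lambda>t. nvec t) has_vector_derivative tvec t) (at t)" "((\<lambda>t. tvec t) has_vector_derivative - nvec t) (at t)"
      unfolding has_vector_derivative_def
      by (subst has_derivative_componentwise_within,
          auto simp: Basis_vec_def UNIV_2 inner_axis intro!: derivative_eq_intros)+
    then have "((\<lambda>t. p t *\<^sub>R nvec t + p1 t *\<^sub>R tvec t) has_vector_derivative
       (p t *\<^sub>R tvec t + p1 t *\<^sub>R nvec t) + (p1 t *\<^sub>R (- nvec t) + p2 t *\<^sub>R tvec t)) (at t)"
      using d by (intro has_vector_derivative_add has_vector_derivative_scaleR) auto
    then show ?thesis
      by (simp add: env_point_def[abs_def] p1_def p_def algebra_simps)
  qed
  have "norm (vector_derivative (env_point p) (at t)) = p t + p2 t" for t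
    unfolding vector_derivative_at[OF vd] using pos[of t] by (simp add: p_def p2_def)
  then have "perimeter K = circ (\<lambda>t. p t + p2 t)"
    by (simp add: perimeter_def p_def)
  also have "\<dots> = circ p + circ p2"
    using p2_cont p_cont unfolding p_def p2_def
    by (intro hk_add integrable_cont) auto
  also have "circ p2 = 0"
    using fcos_deriv(1)[OF p1 p2_cont per1, of 0] by (simp add: fcos_0 p2_def)
  finally show ?thesis by (simp add: p_def)
qed

text \<open>The quarter turn in the support function of the evolute disappears when integrating over
  a full period.\<close>

lemma evolute_area_eq:
  assumes "C2_strictly_convex K"
  shows "evolute_area K = 1/2 * circ (\<lambda>t. (deriv (supp_fun K) t)^2 - (deriv (deriv (supp_fun K)) t)^2)"
proof -
  interpret body "supp_fun K" "deriv (supp_fun K)" "deriv (deriv (supp_fun K))" K by (rule C2_body[OF assms])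
  define q1 q2 where "q1 = deriv (supp_fun K)" and "q2 = deriv q1"
  have "((\<lambda>t. q1 (t - pi/2)) has_field_derivative q2 (t - pi/2)) (at t)" for t
  proof -
    have "((\<lambda>t. t - pi/2) has_field_derivative 1) (at t)" by (auto intro!: derivative_eq_intros)
    from DERIV_chain2[OF p1 this] show ?thesis by (simp add: q1_def q2_def)
  qed
  then have der: "deriv (\<lambda>t. q1 (t - pi/2)) = (\<lambda>t. q2 (t - pi/2))"
    by (auto intro!: DERIV_imp_deriv)
  define g where "g = (\<lambda>t. (q1 (t - pi/2))^2 - (q2 (t - pi/2))^2)"
  have g_cont: "continuous_on UNIV g"
    unfolding g_def q1_def q2_def by (intro continuous_intros p_conts)
  have g_per: "g (t + 2*pi) = g t" for t
    using per1[of "t - pi/2"] per2[of "t - pi/2"] by (simp add: g_def q1_def q2_def algebra_simps)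
  have "circ (\<lambda>t. g (t + pi/2)) = circ g"
    by (rule periodic_shift_integral[OF g_cont g_per]) auto
  then show ?thesis
    unfolding evolute_area_def env_area_def q1_def[symmetric] q2_def[symmetric] der
    by (simp add: g_def)
qed

theorem theorem5p3:
  fixes K :: "(real^2) set"
  assumes "C2_strictly_convex K"
    and "constant_width K"
  shows "let D = 4/9 * pi * \<bar>evolute_area K\<bar> - isoperimetric_deficit K;
             g = (\<lambda>P. let \<omega> = visual_angle K P
                      in \<omega> - 2 * sin \<omega> + sin (2 * \<omega>) - 1/4 * sin (4 * \<omega>) - (sin \<omega>) ^ 3);
             R = 64/9 * (LINT P:(- K)|lborel. g P)
         in set_integrable lborel (- K) g
          \<and> D \<ge> R
          \<and> (D \<noteq> 0 \<longrightarrow> R > 0)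
          \<and> (D = 0 \<longrightarrow> R = 0)
          \<and> (D = R \<longleftrightarrow>
               is_disk K \<or>
               bounded_by_parallel_to_steiner K \<or>
               bounded_by_parallel_to_five_cusped K \<or>
               minkowski_sum_of_bodies K \<or>
               minkowski_sum_of_curves K)"
proof -
  obtain w where w: "\<And>t. supp_fun K t + supp_fun K (t + pi) = w"
    using assms(2) by (auto simp: constant_width_def)
  interpret constant_width_body "supp_fun K" "deriv (supp_fun K)" "deriv (deriv (supp_fun K))" K w
  proof -
    interpret b: body "supp_fun K" "deriv (supp_fun K)" "deriv (deriv (supp_fun K))" K by (rule C2_body[OF assms(1)])
    show "constant_width_body (supp_fun K) (deriv (supp_fun K)) (deriv (deriv (supp_fun K))) K w"
      by unfold_locales (rule w)
  qed
  have D: "4/9 * pi * \<bar>evolute_area K\<bar> - isoperimetric_deficit K = gap"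
    unfolding gap_def evolute_integral_def perim_def isoperimetric_deficit_def evolute_area_eq[OF assms(1)]
      perimeter_eq[OF assms(1)] area_formula ..
  have g: "(let \<omega> = visual_angle K P
            in \<omega> - 2 * sin \<omega> + sin (2 * \<omega>) - 1/4 * sin (4 * \<omega>) - (sin \<omega>) ^ 3) = angle_fun (visual_angle K P)" for P
    by (simp only: Let_def angle_fun_def)
  have R: "64/9 * (LINT P:(- K)|lborel. angle_fun (visual_angle K P)) = vis"
    unfolding exterior_integral(2) vis_def ..
  show ?thesis
    unfolding g unfolding Let_def D R
    using exterior_integral(1) gap_vis equality_iff_low_spectrum[OF assms(1)] by auto
qed

end
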